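(* Let $E^{n.n}$ be a special odd symplectic superspace with volume form $d{\bf v}$, and let $M$ be a non-degenerated surface of codimension $(1.1)$ embedded in it. Let $(x^0,x^i,\theta_0,\theta_j)$, $i,j=1,\dots,n-1$, be Darboux coordinates adjusted to $M$ (so $M$ is given by $x^0=\theta_0=0$), in which $d{\bf v}=\rho\,|dx\,d\theta|$. Then the odd invariant semidensity of rank $2$ $$A\left(z(\zeta),\frac{\partial z}{\partial\zeta},\frac{\partial^2z}{\partial\zeta\partial\zeta}\right)|d\zeta|^{1/2}=\left(\Psi^A\frac{\partial\log\rho(z)}{\partial z^A}-\Psi^A\Omega_{AB}\frac{\partial^2z^B}{\partial\zeta^\alpha\partial\zeta^\beta}\Omega^{\alpha\beta}(z(\zeta))(-1)^{p(B)(p(\alpha)+p(\beta))+p(\alpha)}\right)|d\zeta|^{1/2}$$ on $M$ is equal, in these coordinates, to $$2\,\frac{\partial\sqrt{\rho}}{\partial\theta_0}\Big\vert_{x^0=\theta_0=0}\,|dx^1\cdots dx^{n-1}d\theta_1\cdots d\theta_{n-1}|^{1/2}.$$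
   Context: $E^{n.n}$ is a superspace with $n$ even and $n$ odd coordinates (points are $\Lambda$-points, $\Lambda$ an arbitrary Grassmann algebra). It is an odd symplectic superspace if it is endowed with an odd closed non-degenerate two-form $\Omega=\Omega_{AB}dz^Adz^B$; $\{\cdot,\cdot\}$ is the corresponding odd Poisson (Buttin) bracket. It is special if it is also endowed with a volume form $d{\bf v}=\rho(z)|dz|$, non-degenerate (the number part of $\rho$ vanishes nowhere). Darboux coordinates $(x^\mu,\theta_\mu)$, $\mu=0,1,\dots,n-1$, $x^\mu$ even, $\theta_\mu$ odd, satisfy $\{x^\mu,x^\nu\}=0$, $\{\theta_\mu,\theta_\nu\}=0$, $\{x^\mu,\theta_\nu\}=\delta^\mu_\nu$, and $\Omega=\sum_\mu dx^\mu d\theta_\mu$ in them, with sign conventions such that $\Omega(\partial/\partial x^\mu,\partial/\partial\theta_\nu)=\delta_{\mu}^{\nu}$. A surface $M$ is non-degenerated if the pull-back of $\Omega$ to $M$ is non-degenerate. Darboux coordinates are adjusted to a non-degenerated surface $M$ of codimension $(1.1)$ if $M$ is given in them by $x^0=\theta_0=0$. In the formula for the semidensity, $z^A$ are Darboux coordinates in $E^{n.n}$; $z(\zeta)$ is a parametrization of $M$ with parameters $\zeta=(\xi^i,\eta_j)$, $\xi^i$ even, $\eta_j$ odd, $i,j=1,\dots,n-1$; $p$ denotes parity of the corresponding coordinate; $\Omega^{\alpha\beta}$ is the tensor inverse to the two-form of the induced symplectic structure on $M$. The odd vector field ${\bf\Psi}$ along $M$ is defined as follows: one considers pairs of vectors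 $({\bf H},{\bf\Psi})$, ${\bf H}$ even and ${\bf\Psi}$ odd, symplectoorthogonal to $M$ (i.e. $\Omega$-orthogonal to the tangent space of $M$) and satisfying $$\Omega({\bf H},{\bf\Psi})=1,\quad \Omega({\bf\Psi},{\bf\Psi})=0,\qquad d{\bf v}\left(\left\{\frac{\partial z}{\partial\zeta}\right\},{\bf H},{\bf\Psi}\right)=1,$$ where $d{\bf v}$ evaluated on a frame is $\rho$ times the Berezinian of the matrix of the frame. These conditions fix ${\bf\Psi}$ (the sign being the one corresponding to ${\bf\Psi}=\sqrt{\rho}\,\partial/\partial\theta_0$ in adjusted Darboux coordinates with the parametrization $x^0=\theta_0=0$, $x^i=\xi^i$, $\theta_i=\eta_i$). The resulting expression transforms as a semidensity (is multiplied by the square root of the Berezinian) under reparametrizations of $M$ and does not depend on the choice of Darboux coordinates in $E^{n.n}$. *)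

theory Defs
  imports "HOL-Analysis.Analysis" "HOL-Combinatorics.Permutations"
begin

section \<open>The Grassmann algebra\<close>

text \<open>
  Real Grassmann algebra on anticommuting generators indexed by natural numbers.  An element is
  its family of coefficients, the coefficient at \<open>S = {s\<^sub>1 < \<dots> < s\<^sub>k}\<close> being that of the monomial
  \<open>gen s\<^sub>1 * \<dots> * gen s\<^sub>k\<close>.  The algebras that occur below are the finitely generated ones: every
  predicate confines the generators to a finite set.
\<close>

typedef grassmann = "{f :: nat set \<Rightarrow> real. \<forall>S. infinite S \<longrightarrow> f S = 0}"
  morphisms gcoeff Abs_grassmann
  by (rule exI[of _ "\<lambda>_. 0"]) simp

setup_lifting type_definition_grassmann

lemma gcoeff_infinite: "infinite S \<Longrightarrow> gcoeff a S = 0"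
  using gcoeff[of a] by blast

lemma grassmann_eqI: "(\<And>S. finite S \<Longrightarrow> gcoeff a S = gcoeff b S) \<Longrightarrow> a = b"
  by (metis gcoeff_infinite gcoeff_inject ext)

text \<open>Sign of the shuffle that sorts the concatenation of two increasing lists of generators.\<close>
definition gsign :: "nat set \<Rightarrow> nat set \<Rightarrow> real" where
  "gsign T U = (-1) ^ card {(t, u). t \<in> T \<and> u \<in> U \<and> u < t}"

lemma gsign_finite: "finite T \<Longrightarrow> finite U \<Longrightarrow> finite {(t, u). t \<in> T \<and> u \<in> U \<and> u < (t::nat)}"
  by (rule finite_subset[of _ "T \<times> U"]) auto

lemma gsign_empty [simp]: "gsign {} U = 1" "gsign T {} = 1"
  by (simp_all add: gsign_def)

lemma gsign_Un_left:
  assumes "finite T" "finite T'" "finite U" "T \<inter> T' = {}"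
  shows "gsign (T \<union> T') U = gsign T U * gsign T' U"
proof -
  have "{(t, u). t \<in> T \<union> T' \<and> u \<in> U \<and> u < t} =
      {(t, u). t \<in> T \<and> u \<in> U \<and> u < t} \<union> {(t, u). t \<in> T' \<and> u \<in> U \<and> u < t}" by auto
  moreover have "{(t, u). t \<in> T \<and> u \<in> U \<and> u < t} \<inter> {(t, u). t \<in> T' \<and> u \<in> U \<and> u < t} = {}"
    using assms(4) by auto
  ultimately show ?thesis
    using assms by (simp add: gsign_def card_Un_disjoint gsign_finite power_add)
qed

lemma gsign_Un_right:
  assumes "finite T" "finite U'" "finite U" "U \<inter> U' = {}"
  shows "gsign T (U \<union> U') = gsign T U * gsign T U'"
proof -
  have "{(t, u). t \<in> T \<and> u \<in> U \<union> U' \<and> u < t} =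
      {(t, u). t \<in> T \<and> u \<in> U \<and> u < t} \<union> {(t, u). t \<in> T \<and> u \<in> U' \<and> u < t}" by auto
  moreover have "{(t, u). t \<in> T \<and> u \<in> U \<and> u < t} \<inter> {(t, u). t \<in> T \<and> u \<in> U' \<and> u < t} = {}"
    using assms(4) by auto
  ultimately show ?thesis
    using assms by (simp add: gsign_def card_Un_disjoint gsign_finite power_add)
qed

instantiation grassmann :: real_vector
begin
lift_definition zero_grassmann :: grassmann is "\<lambda>_. 0" by simp
lift_definition plus_grassmann :: "grassmann \<Rightarrow> grassmann \<Rightarrow> grassmann" is "\<lambda>f g S. f S + g S" by simp
lift_definition uminus_grassmann :: "grassmann \<Rightarrow> grassmann" is "\<lambda>f S. - f S" by simp
lift_definition minus_grassmann :: "grassmann \<Rightarrow> grassmann \<Rightarrow> grassmann" is "\<lambda>f g S. f S - g S" by simp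
lift_definition scaleR_grassmann :: "real \<Rightarrow> grassmann \<Rightarrow> grassmann" is "\<lambda>c f S. c * f S" by simp
instance by standard (transfer; simp add: algebra_simps)+
end

instantiation grassmann :: real_algebra_1
begin
lift_definition one_grassmann :: grassmann is "\<lambda>S. if S = {} then 1 else 0" by auto
lift_definition times_grassmann :: "grassmann \<Rightarrow> grassmann \<Rightarrow> grassmann" is
  "\<lambda>f g S. \<Sum>T\<in>Pow S. gsign T (S - T) * f T * g (S - T)" by simp
instance
proof
  fix a b c :: grassmann and r :: real
  have m: "gcoeff (x * y) S = (\<Sum>T\<in>Pow S. gsign T (S - T) * gcoeff x T * gcoeff y (S - T))"
    for x y S by transfer simp
  show "a * b * c = a * (b * c)"
  proof (rule grassmann_eqI)
    fix S :: "nat set" assume S: "finite S"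
    have "gcoeff (a * b * c) S = (\<Sum>T\<in>Pow S. \<Sum>R\<in>Pow T.
        gsign T (S - T) * gsign R (T - R) * gcoeff a R * gcoeff b (T - R) * gcoeff c (S - T))"
      by (simp add: m sum_distrib_left sum_distrib_right mult_ac)
    also have "\<dots> = (\<Sum>(T, R)\<in>Sigma (Pow S) Pow.
        gsign T (S - T) * gsign R (T - R) * gcoeff a R * gcoeff b (T - R) * gcoeff c (S - T))"
      using S by (subst sum.Sigma) (auto intro: finite_subset)
    also have "\<dots> = (\<Sum>(R, Q)\<in>Sigma (Pow S) (\<lambda>R. Pow (S - R)).
        gsign R (S - R) * gsign Q (S - R - Q) * gcoeff a R * gcoeff b Q * gcoeff c (S - R - Q))"
    proof (rule sum.reindex_bij_witness[where i = "\<lambda>(R, Q). (R \<union> Q, R)" and j = "\<lambda>(T, R). (R, T - R)"],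
        goal_cases)
      case (5 x)
      obtain T R where x: "x = (T, R)" and TR: "T \<subseteq> S" "R \<subseteq> T" using 5 by auto
      have fin: "finite T" "finite R" using S TR by (auto intro: finite_subset)
      have d: "S - R - (T - R) = S - T" "S - R = (T - R) \<union> (S - T)" "T = R \<union> (T - R)"
        using TR by auto
      have "gsign T (S - T) = gsign R (S - T) * gsign (T - R) (S - T)"
        using gsign_Un_left[of R "T - R" "S - T"] fin S d(3) by auto
      moreover have "gsign R (S - R) = gsign R (T - R) * gsign R (S - T)"
        unfolding d(2) using gsign_Un_right[of R "S - T" "T - R"] fin S by auto
      ultimately show ?case by (simp add: x d(1) mult_ac)
    qed auto
    also have "\<dots> = (\<Sum>R\<in>Pow S. \<Sum>Q\<in>Pow (S - R).
        gsign R (S - R) * gsign Q (S - R - Q) * gcoeff a R * gcoeff b Q * gcoeff c (S - R - Q))"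
      using S by (subst sum.Sigma) auto
    also have "\<dots> = gcoeff (a * (b * c)) S"
      by (simp add: m sum_distrib_left sum_distrib_right mult_ac)
    finally show "gcoeff (a * b * c) S = gcoeff (a * (b * c)) S" .
  qed
  have one: "gcoeff 1 S = (if S = {} then 1 else 0)" for S by transfer simp
  show "1 * a = a"
  proof (rule grassmann_eqI)
    fix S :: "nat set" assume S: "finite S"
    have "gcoeff (1 * a) S = (\<Sum>T\<in>Pow S. if T = {} then gcoeff a S else 0)"
      unfolding m one by (rule sum.cong) auto
    then show "gcoeff (1 * a) S = gcoeff a S" using S by simp
  qed
  show "a * 1 = a"
  proof (rule grassmann_eqI)
    fix S :: "nat set" assume S: "finite S"
    have "gcoeff (a * 1) S = (\<Sum>T\<in>Pow S. if T = S then gcoeff a S else 0)"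
      unfolding m one by (rule sum.cong) auto
    then show "gcoeff (a * 1) S = gcoeff a S" using S by simp
  qed
  show "(a + b) * c = a * c + b * c"
    by transfer (auto simp: algebra_simps sum.distrib)
  show "a * (b + c) = a * b + a * c"
    by transfer (auto simp: algebra_simps sum.distrib)
  show "(r *\<^sub>R a) * b = r *\<^sub>R (a * b)"
    by transfer (auto simp: sum_distrib_left mult_ac)
  show "a * (r *\<^sub>R b) = r *\<^sub>R (a * b)"
    by transfer (auto simp: sum_distrib_left mult_ac)
  have "gcoeff 0 {} = 0" by transfer simp
  then show "(0::grassmann) \<noteq> 1" using one[of "{}"] by auto
qed
end

lift_definition gen :: "nat \<Rightarrow> grassmann" is "\<lambda>i S. if S = {i} then 1 else 0" by auto

text \<open>Number part and nilpotent part.\<close>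
definition body :: "grassmann \<Rightarrow> real" where "body a = gcoeff a {}"
definition soul :: "grassmann \<Rightarrow> grassmann" where "soul a = a - of_real (body a)"

text \<open>Left derivative with respect to a generator.\<close>
lift_definition gderiv :: "nat \<Rightarrow> grassmann \<Rightarrow> grassmann" is
  "\<lambda>i f S. if i \<in> S then 0 else (-1) ^ card {s\<in>S. s < i} * f (insert i S)" by auto

text \<open>Setting a generator to zero.\<close>
lift_definition gkill :: "nat \<Rightarrow> grassmann \<Rightarrow> grassmann" is
  "\<lambda>i f S. if i \<in> S then 0 else f S" by auto

text \<open>The homomorphism that sends the generator \<open>i\<close> to \<open>\<theta> i\<close> for \<open>i \<in> I\<close> and fixes the others.\<close>
definition gsubst :: "nat set \<Rightarrow> (nat \<Rightarrow> grassmann) \<Rightarrow> grassmann \<Rightarrow> grassmann" where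
  "gsubst I \<theta> a = (\<Sum>S\<in>{S. gcoeff a S \<noteq> 0}.
     gcoeff a S *\<^sub>R prod_list (map (\<lambda>i. if i \<in> I then \<theta> i else gen i) (sorted_list_of_set S)))"

text \<open>A function of one real variable at an even element: the Taylor expansion at the number part,
  a finite sum because the soul is nilpotent.\<close>
definition gapply :: "(real \<Rightarrow> real) \<Rightarrow> grassmann \<Rightarrow> grassmann" where
  "gapply F a = (\<Sum>k\<in>{k. soul a ^ k \<noteq> 0}. ((deriv ^^ k) F (body a) / fact k) *\<^sub>R soul a ^ k)"

subsection \<open>Matrices over the Grassmann algebra\<close>

definition gmat_inverse :: "'i set \<Rightarrow> ('i \<Rightarrow> 'i \<Rightarrow> grassmann) \<Rightarrow> ('i \<Rightarrow> 'i \<Rightarrow> grassmann) \<Rightarrow> bool" where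
  "gmat_inverse J M X \<longleftrightarrow> (\<forall>a\<in>J. \<forall>c\<in>J.
     (\<Sum>b\<in>J. M a b * X b c) = of_bool (a = c) \<and> (\<Sum>b\<in>J. X a b * M b c) = of_bool (a = c))"

definition ginvertible :: "'i set \<Rightarrow> ('i \<Rightarrow> 'i \<Rightarrow> grassmann) \<Rightarrow> bool" where
  "ginvertible J M \<longleftrightarrow> (\<exists>X. gmat_inverse J M X)"

definition ginv :: "'i set \<Rightarrow> ('i \<Rightarrow> 'i \<Rightarrow> grassmann) \<Rightarrow> 'i \<Rightarrow> 'i \<Rightarrow> grassmann" where
  "ginv J M = (SOME X. gmat_inverse J M X)"

text \<open>Determinant of a matrix with even (hence commuting) entries.\<close>
definition gdet :: "nat set \<Rightarrow> (nat \<Rightarrow> nat \<Rightarrow> grassmann) \<Rightarrow> grassmann" where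
  "gdet I M = (\<Sum>p | p permutes I.
     of_int (sign p) * prod_list (map (\<lambda>i. M i (p i)) (sorted_list_of_set I)))"

section \<open>Superfunctions\<close>

text \<open>
  \<open>Ev i\<close> and \<open>Od i\<close> are the labels of the even and of the odd coordinate number \<open>i\<close>.  The odd
  coordinate \<open>Od i\<close> is the generator \<open>gen i\<close>.  With \<open>n\<close> even and odd coordinates on the ambient
  space, the generators \<open>gen n, \<dots>, gen (n + N - 1)\<close> are the odd constants, i.e. they generate the
  (arbitrary) Grassmann algebra of coefficients.  Indices \<open>1, \<dots>, n - 1\<close> label the coordinates on
  a surface of codimension \<open>(1.1)\<close>.
\<close>

datatype sidx = Ev nat | Od nat

primrec par :: "sidx \<Rightarrow> nat" where
  "par (Ev i) = 0"
| "par (Od i) = 1"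

definition sindices :: "nat set \<Rightarrow> sidx set" where
  "sindices I = Ev ` I \<union> Od ` I"

text \<open>A superfunction assigns to a point with real coordinates \<open>x\<close> its expansion in the generators.\<close>
type_synonym sfun = "(nat \<Rightarrow> real) \<Rightarrow> grassmann"

text \<open>The space of points with coordinates indexed by \<open>I\<close>, realised inside \<open>nat \<Rightarrow> real\<close>.\<close>
definition coord_space :: "nat set \<Rightarrow> (nat \<Rightarrow> real) set" where
  "coord_space I = {x. \<forall>i. i \<notin> I \<longrightarrow> x i = 0}"

definition domain_in :: "nat set \<Rightarrow> (nat \<Rightarrow> real) set \<Rightarrow> bool" where
  "domain_in I U \<longleftrightarrow> openin (top_of_set (coord_space I)) U"

primrec Ck_on :: "nat \<Rightarrow> nat set \<Rightarrow> (nat \<Rightarrow> real) set \<Rightarrow> ((nat \<Rightarrow> real) \<Rightarrow> real) \<Rightarrow> bool" where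
  "Ck_on 0 I U f \<longleftrightarrow> continuous_on U f"
| "Ck_on (Suc k) I U f \<longleftrightarrow> continuous_on U f \<and>
     (\<forall>i\<in>I. (\<forall>x\<in>U. (\<lambda>t. f (x(i := t))) field_differentiable at (x i)) \<and>
            Ck_on k I U (\<lambda>x. deriv (\<lambda>t. f (x(i := t))) (x i)))"

text \<open>Superfunctions of parity \<open>p\<close> on a domain \<open>U\<close>, with the generators in \<open>G\<close>.\<close>
definition superfunction :: "nat set \<Rightarrow> nat set \<Rightarrow> (nat \<Rightarrow> real) set \<Rightarrow> nat \<Rightarrow> sfun \<Rightarrow> bool" where
  "superfunction I G U p f \<longleftrightarrow>
     (\<forall>S k. Ck_on k I U (\<lambda>x. gcoeff (f x) S)) \<and>
     (\<forall>x\<in>U. \<forall>S. gcoeff (f x) S \<noteq> 0 \<longrightarrow> S \<subseteq> G \<and> even (card S + p))"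

text \<open>Partial derivatives; left derivatives for the odd coordinates.\<close>
primrec pd :: "sidx \<Rightarrow> sfun \<Rightarrow> sfun" where
  "pd (Ev i) f = (\<lambda>x. Abs_grassmann (\<lambda>S. deriv (\<lambda>t. gcoeff (f (x(i := t))) S) (x i)))"
| "pd (Od i) f = (\<lambda>x. gderiv i (f x))"

primrec coord :: "sidx \<Rightarrow> sfun" where
  "coord (Ev i) = (\<lambda>x. of_real (x i))"
| "coord (Od i) = (\<lambda>x. gen i)"

text \<open>Number part of the point with even coordinates \<open>z (Ev i)\<close>, \<open>i \<in> I\<close>.\<close>
definition body_point :: "nat set \<Rightarrow> (sidx \<Rightarrow> grassmann) \<Rightarrow> nat \<Rightarrow> real" where
  "body_point I z i = (if i \<in> I then body (z (Ev i)) else 0)"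

text \<open>
  Value of the superfunction \<open>f\<close> at the \<open>\<Lambda>\<close>-point with coordinates \<open>z\<close>: Taylor expansion in the
  souls of the even coordinates (a finite sum) and substitution of the odd ones.  The sequences
  \<open>is\<close> run over all orders of differentiation, hence the factor \<open>1 / fact (length is)\<close>.
\<close>
definition eval_at :: "nat set \<Rightarrow> sfun \<Rightarrow> (sidx \<Rightarrow> grassmann) \<Rightarrow> grassmann" where
  "eval_at I f z =
     (\<Sum>is\<in>{is. set is \<subseteq> I \<and> prod_list (map (\<lambda>i. soul (z (Ev i))) is) \<noteq> 0}.
        (1 / fact (length is)) *\<^sub>R
        (prod_list (map (\<lambda>i. soul (z (Ev i))) is) *
         gsubst I (\<lambda>i. z (Od i)) (foldr (\<lambda>i. pd (Ev i)) is f (body_point I z))))"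

text \<open>Berezinian of an even supermatrix, rows and columns indexed by \<open>sindices I\<close>.\<close>
definition Berezinian :: "nat set \<Rightarrow> (sidx \<Rightarrow> sidx \<Rightarrow> grassmann) \<Rightarrow> grassmann" where
  "Berezinian I M = (let X = ginv I (\<lambda>k l. M (Od k) (Od l)) in
     gdet I (\<lambda>i j. M (Ev i) (Ev j) - (\<Sum>k\<in>I. \<Sum>l\<in>I. M (Ev i) (Od k) * X k l * M (Od l) (Ev j)))
     * gdet I X)"

section \<open>Special odd symplectic superspaces\<close>

text \<open>
  A two-form is given by its components \<open>\<Omega> A B = \<Omega>(\<partial>/\<partial>z\<^sup>A, \<partial>/\<partial>z\<^sup>B)\<close>.  The value on vectors is
  left-linear in the sense \<open>\<Omega>(fX, Y) = f \<Omega>(X, Y)\<close>, \<open>\<Omega>(X, fY) = (-1)\<^bsup>p(f)p(X)\<^esup> f \<Omega>(X, Y)\<close>; for an odd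
  form and \<open>Y\<close> of parity \<open>q\<close> this gives \<open>\<Omega>(X, Y) = X\<^sup>A \<Omega>\<^sub>A\<^sub>B Y\<^sup>B (-1)\<^bsup>q(p(B) + 1)\<^esup>\<close>.
\<close>

type_synonym sform = "sidx \<Rightarrow> sidx \<Rightarrow> sfun"

definition form_value ::
  "nat set \<Rightarrow> (sidx \<Rightarrow> sidx \<Rightarrow> grassmann) \<Rightarrow> nat \<Rightarrow> (sidx \<Rightarrow> grassmann) \<Rightarrow> (sidx \<Rightarrow> grassmann) \<Rightarrow> grassmann" where
  "form_value I \<Omega> q X Y =
     (\<Sum>A\<in>sindices I. \<Sum>B\<in>sindices I. (-1) ^ (q * (par B + 1)) * X A * \<Omega> A B * Y B)"

definition odd_symplectic :: "nat \<Rightarrow> nat \<Rightarrow> (nat \<Rightarrow> real) set \<Rightarrow> sform \<Rightarrow> bool" where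
  "odd_symplectic n N U \<Omega> \<longleftrightarrow>
     (\<forall>A\<in>sindices {..<n}. \<forall>B\<in>sindices {..<n}.
        superfunction {..<n} {..<n + N} U (par A + par B + 1) (\<Omega> A B) \<and>
        (\<forall>x\<in>U. \<Omega> B A x = - ((-1) ^ (par A * par B) * \<Omega> A B x))) \<and>
     (\<forall>A\<in>sindices {..<n}. \<forall>B\<in>sindices {..<n}. \<forall>C\<in>sindices {..<n}. \<forall>x\<in>U.
        pd A (\<Omega> B C) x
        + (-1) ^ (par A * (par B + par C)) * pd B (\<Omega> C A) x
        + (-1) ^ (par C * (par A + par B)) * pd C (\<Omega> A B) x = 0) \<and>
     (\<forall>x\<in>U. ginvertible (sindices {..<n}) (\<lambda>A B. \<Omega> A B x))"

text \<open>The volume form \<open>\<rho>(z) |dz|\<close> is given by its coefficient.\<close>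
definition volume_form :: "nat \<Rightarrow> nat \<Rightarrow> (nat \<Rightarrow> real) set \<Rightarrow> sfun \<Rightarrow> bool" where
  "volume_form n N U \<rho> \<longleftrightarrow>
     superfunction {..<n} {..<n + N} U 0 \<rho> \<and> (\<forall>x\<in>U. body (\<rho> x) \<noteq> 0)"

text \<open>The Buttin bracket of \<open>f\<close>, of parity \<open>p\<close>, with \<open>g\<close>; in Darboux coordinates it is
  \<open>{f, g} = \<Sum>\<^sub>\<mu> (\<partial>f/\<partial>x\<^sup>\<mu> \<partial>g/\<partial>\<theta>\<^sub>\<mu> + (-1)\<^sup>p \<partial>f/\<partial>\<theta>\<^sub>\<mu> \<partial>g/\<partial>x\<^sup>\<mu>)\<close>.\<close>
definition buttin_bracket :: "nat \<Rightarrow> sform \<Rightarrow> nat \<Rightarrow> sfun \<Rightarrow> sfun \<Rightarrow> sfun" where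
  "buttin_bracket n \<Omega> p f g x =
     - (\<Sum>A\<in>sindices {..<n}. \<Sum>B\<in>sindices {..<n}. (-1) ^ (par A * (p + 1)) *
          pd A f x * ginv (sindices {..<n}) (\<lambda>A B. \<Omega> A B x) A B * pd B g x)"

text \<open>The coordinates \<open>x\<^sup>\<mu> = coord (Ev \<mu>)\<close>, \<open>\<theta>\<^sub>\<mu> = coord (Od \<mu>)\<close> are Darboux coordinates.\<close>
definition darboux_coordinates :: "nat \<Rightarrow> (nat \<Rightarrow> real) set \<Rightarrow> sform \<Rightarrow> bool" where
  "darboux_coordinates n U \<Omega> \<longleftrightarrow> (\<forall>x\<in>U. \<forall>\<mu><n. \<forall>\<nu><n.
     buttin_bracket n \<Omega> 0 (coord (Ev \<mu>)) (coord (Ev \<nu>)) x = 0 \<and>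
     buttin_bracket n \<Omega> 1 (coord (Od \<mu>)) (coord (Od \<nu>)) x = 0 \<and>
     buttin_bracket n \<Omega> 0 (coord (Ev \<mu>)) (coord (Od \<nu>)) x = of_bool (\<mu> = \<nu>) \<and>
     \<Omega> (Ev \<mu>) (Ev \<nu>) x = 0 \<and> \<Omega> (Od \<mu>) (Od \<nu>) x = 0 \<and>
     \<Omega> (Ev \<mu>) (Od \<nu>) x = of_bool (\<mu> = \<nu>) \<and> \<Omega> (Od \<mu>) (Ev \<nu>) x = - of_bool (\<mu> = \<nu>))"

section \<open>Surfaces of codimension (1.1)\<close>

text \<open>The number parts of the points \<open>z(\<zeta>)\<close>.\<close>
abbreviation body_map :: "nat \<Rightarrow> (sidx \<Rightarrow> sfun) \<Rightarrow> (nat \<Rightarrow> real) \<Rightarrow> nat \<Rightarrow> real" where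
  "body_map n z \<xi> \<equiv> body_point {..<n} (\<lambda>A. z A \<xi>)"

text \<open>
  An embedded surface given by a parametrization \<open>z(\<zeta>)\<close> whose parameters \<open>\<zeta> = (\<xi>, \<eta>)\<close> have number
  part \<open>\<xi> \<in> V\<close>: the underlying map is a topological embedding into \<open>U\<close>, and the tangent vectors
  are linearly independent (the matrix of \<open>\<partial>z/\<partial>\<zeta>\<close> has a right inverse).
\<close>
definition embedded_surface ::
  "nat \<Rightarrow> nat \<Rightarrow> (nat \<Rightarrow> real) set \<Rightarrow> (nat \<Rightarrow> real) set \<Rightarrow> (sidx \<Rightarrow> sfun) \<Rightarrow> bool" where
  "embedded_surface n N U V z \<longleftrightarrow>
     domain_in {1..<n} V \<and>
     (\<forall>A\<in>sindices {..<n}. superfunction {1..<n} {1..<n + N} V (par A) (z A)) \<and>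
     body_map n z ` V \<subseteq> U \<and>
     (\<exists>h. homeomorphism V (body_map n z ` V) (body_map n z) h) \<and>
     (\<forall>\<xi>\<in>V. \<exists>L. \<forall>\<alpha>\<in>sindices {1..<n}. \<forall>\<beta>\<in>sindices {1..<n}.
        (\<Sum>A\<in>sindices {..<n}. pd \<alpha> (z A) \<xi> * L A \<beta>) = of_bool (\<alpha> = \<beta>))"

definition form_along :: "nat \<Rightarrow> sform \<Rightarrow> (sidx \<Rightarrow> sfun) \<Rightarrow> sform" where
  "form_along n \<Omega> z A B \<xi> = eval_at {..<n} (\<Omega> A B) (\<lambda>C. z C \<xi>)"

definition pullback_form :: "nat \<Rightarrow> sform \<Rightarrow> (sidx \<Rightarrow> sfun) \<Rightarrow> sform" where
  "pullback_form n \<Omega> z \<alpha> \<beta> \<xi> = form_value {..<n} (\<lambda>A B. form_along n \<Omega> z A B \<xi>) (par \<beta>)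
     (\<lambda>A. pd \<alpha> (z A) \<xi>) (\<lambda>B. pd \<beta> (z B) \<xi>)"

definition nondegenerate_surface ::
  "nat \<Rightarrow> (nat \<Rightarrow> real) set \<Rightarrow> sform \<Rightarrow> (sidx \<Rightarrow> sfun) \<Rightarrow> bool" where
  "nondegenerate_surface n V \<Omega> z \<longleftrightarrow>
     (\<forall>\<xi>\<in>V. ginvertible (sindices {1..<n}) (\<lambda>\<alpha> \<beta>. pullback_form n \<Omega> z \<alpha> \<beta> \<xi>))"

text \<open>The surface is given by \<open>x\<^sup>0 = \<theta>\<^sub>0 = 0\<close>.\<close>
definition adjusted ::
  "nat \<Rightarrow> (nat \<Rightarrow> real) set \<Rightarrow> (nat \<Rightarrow> real) set \<Rightarrow> (sidx \<Rightarrow> sfun) \<Rightarrow> bool" where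
  "adjusted n U V z \<longleftrightarrow>
     (\<forall>\<xi>\<in>V. z (Ev 0) \<xi> = 0 \<and> z (Od 0) \<xi> = 0) \<and> body_map n z ` V = {x\<in>U. x 0 = 0}"

text \<open>
  The matrix of the frame \<open>({\<partial>z/\<partial>\<zeta>}, H, \<Psi>)\<close>, with \<open>H\<close> in the even row \<open>0\<close> and \<open>\<Psi>\<close> in the odd
  row \<open>0\<close>.  Moving \<open>H\<close> past the even and \<open>\<Psi>\<close> past the odd tangent vectors does not change the
  Berezinian, since the two signs cancel.
\<close>
definition frame ::
  "(sidx \<Rightarrow> sfun) \<Rightarrow> (sidx \<Rightarrow> sfun) \<Rightarrow> (sidx \<Rightarrow> sfun) \<Rightarrow> (nat \<Rightarrow> real) \<Rightarrow> sidx \<Rightarrow> sidx \<Rightarrow> grassmann" where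
  "frame z H \<Psi> \<xi> \<alpha> A =
     (if \<alpha> = Ev 0 then H A \<xi> else if \<alpha> = Od 0 then \<Psi> A \<xi> else pd \<alpha> (z A) \<xi>)"

definition normal_pair ::
  "nat \<Rightarrow> nat \<Rightarrow> (nat \<Rightarrow> real) set \<Rightarrow> sform \<Rightarrow> sfun \<Rightarrow> (sidx \<Rightarrow> sfun) \<Rightarrow>
   (sidx \<Rightarrow> sfun) \<Rightarrow> (sidx \<Rightarrow> sfun) \<Rightarrow> bool" where
  "normal_pair n N V \<Omega> \<rho> z H \<Psi> \<longleftrightarrow>
     (\<forall>A\<in>sindices {..<n}. superfunction {1..<n} {1..<n + N} V (par A) (H A) \<and>
                          superfunction {1..<n} {1..<n + N} V (par A + 1) (\<Psi> A)) \<and>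
     (\<forall>\<xi>\<in>V. let \<omega> = form_value {..<n} (\<lambda>A B. form_along n \<Omega> z A B \<xi>);
                h = (\<lambda>A. H A \<xi>); \<psi> = (\<lambda>A. \<Psi> A \<xi>) in
        (\<forall>\<alpha>\<in>sindices {1..<n}. \<omega> (par \<alpha>) h (\<lambda>A. pd \<alpha> (z A) \<xi>) = 0 \<and>
                              \<omega> (par \<alpha>) \<psi> (\<lambda>A. pd \<alpha> (z A) \<xi>) = 0) \<and>
        \<omega> 1 h \<psi> = 1 \<and> \<omega> 1 \<psi> \<psi> = 0 \<and>
        eval_at {..<n} \<rho> (\<lambda>A. z A \<xi>) * Berezinian {..<n} (frame z H \<Psi> \<xi>) = 1)"

section \<open>The semidensity\<close>

text \<open>Both functions are smooth where the number part of \<open>\<rho>\<close> is nonzero; for negative \<open>t\<close> the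
  library has \<open>ln t = ln \<bar>t\<bar>\<close> and \<open>sqrt t = - sqrt \<bar>t\<bar>\<close>.\<close>
definition log_sfun :: "sfun \<Rightarrow> sfun" where "log_sfun \<rho> x = gapply ln (\<rho> x)"
definition sqrt_sfun :: "sfun \<Rightarrow> sfun" where "sqrt_sfun \<rho> x = gapply sqrt (\<rho> x)"

text \<open>\<open>\<Omega>\<^sup>\<alpha>\<^sup>\<beta>\<close> is the inverse matrix of the components \<open>\<Omega>\<^sub>\<alpha>\<^sub>\<beta>\<close> of the induced form.\<close>
definition semidensity_A ::
  "nat \<Rightarrow> sform \<Rightarrow> sfun \<Rightarrow> (sidx \<Rightarrow> sfun) \<Rightarrow> (sidx \<Rightarrow> sfun) \<Rightarrow> sfun" where
  "semidensity_A n \<Omega> \<rho> z \<Psi> \<xi> =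
     (\<Sum>A\<in>sindices {..<n}. \<Psi> A \<xi> * eval_at {..<n} (pd A (log_sfun \<rho>)) (\<lambda>C. z C \<xi>))
     - (\<Sum>A\<in>sindices {..<n}. \<Sum>B\<in>sindices {..<n}. \<Sum>\<alpha>\<in>sindices {1..<n}. \<Sum>\<beta>\<in>sindices {1..<n}.
          (-1) ^ (par B * (par \<alpha> + par \<beta>) + par \<alpha>) *
          \<Psi> A \<xi> * form_along n \<Omega> z A B \<xi> * pd \<alpha> (pd \<beta> (z B)) \<xi> *
          ginv (sindices {1..<n}) (\<lambda>\<alpha> \<beta>. pullback_form n \<Omega> z \<alpha> \<beta> \<xi>) \<alpha> \<beta>)"

text \<open>Restriction of a superfunction to \<open>x\<^sup>0 = \<theta>\<^sub>0 = 0\<close>, a superfunction of \<open>(x\<^sup>i, \<theta>\<^sub>i)\<close>.\<close>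
definition restrict0 :: "sfun \<Rightarrow> sfun" where
  "restrict0 f x = gkill 0 (f (x(0 := 0)))"

text \<open>
  Coefficient at \<open>|d\<zeta>|\<^bsup>1/2\<^esup>\<close> of the semidensity \<open>s |dx\<^sup>1 \<dots> dx\<^sup>n\<^sup>-\<^sup>1 d\<theta>\<^sub>1 \<dots> d\<theta>\<^sub>n\<^sub>-\<^sub>1|\<^bsup>1/2\<^esup>\<close>, where \<open>w A\<close>
  expresses the coordinates \<open>(x\<^sup>i, \<theta>\<^sub>i)\<close> through the parameters \<open>\<zeta>\<close>.
\<close>
definition semidensity_in_parameters :: "nat \<Rightarrow> sfun \<Rightarrow> (sidx \<Rightarrow> sfun) \<Rightarrow> sfun" where
  "semidensity_in_parameters n s w \<xi> =
     eval_at {1..<n} s (\<lambda>A. w A \<xi>) * gapply sqrt (Berezinian {1..<n} (\<lambda>\<alpha> A. pd \<alpha> (w A) \<xi>))"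

end

theory Submission
  imports Defs "Jordan_Normal_Form.Determinant"
begin

text \<open>
  In adjusted Darboux coordinates the components of \<open>\<Omega>\<close> are constant and symplectoorthogonality to
  \<open>M\<close> kills the tangential components of \<open>H\<close> and \<open>\<Psi>\<close>.  The remaining conditions on the pair leave
  \<open>\<Psi> = b \<partial>/\<partial>\<theta>\<^sub>0\<close>, with \<open>b\<^sup>2 = \<rho>(z(\<zeta>)) Ber W\<close> for \<open>W\<close> the matrix of \<open>\<partial>(x\<^sup>i, \<theta>\<^sub>i)/\<partial>\<zeta>\<close>.  As \<open>\<theta>\<^sub>0\<close> is
  conjugate to \<open>x\<^sup>0\<close> and \<open>x\<^sup>0\<close> vanishes on \<open>M\<close>, the terms with second derivatives drop out, and
  \<open>b \<partial> log \<rho>/\<partial>\<theta>\<^sub>0 = 2 \<partial>\<surd>\<rho>/\<partial>\<theta>\<^sub>0 \<surd>(Ber W)\<close> follows from \<open>b = \<surd>\<rho> \<surd>(Ber W)\<close>, because evaluation of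
  superfunctions at a \<open>\<Lambda>\<close>-point is multiplicative and square roots with positive number part are unique.
\<close>

text \<open>Two obstacles shape the proof. The number part of \<rho> may be negative, with a sign
  that changes from one component of \<open>U\<close> to another, while \<open>sqrt\<close> and
  \<open>ln\<close> are extended by sqrt t = - sqrt |t| and ln t = ln |t|. A sign \<open>s\<close>
  is therefore fixed on a neighbourhood of the point; the square of \<open>gapply sqrt a\<close> is
  then \<open>s\<close> times \<open>a\<close>, and this sign enters once through \<rho> and once
  through the Berezinian, so that it cancels in their product. Second, neither the support nor the
  commutation properties of the Berezinian are computed from determinants: they are extracted from
  \<rho> Ber W = b^2, where b is even with positive number part. That equation arises because the
  normal vectors form a (1.1) block with diagonal h and b, and \<Omega>(H, \<Psi>) = 1 forces h b =
  1; the block has Berezinian h / b = h^2, and the volume condition reads \<rho> h^2 Ber W = 1. The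
  factor 2 comes from sqrt t (ln t)' = 2 (sqrt t)', valid for both signs of t.\<close>

lemma gcoeff_zero [simp]: "gcoeff 0 S = 0" by transfer simp
lemma gcoeff_plus [simp]: "gcoeff (a + b) S = gcoeff a S + gcoeff b S" by transfer simp
lemma gcoeff_minus [simp]: "gcoeff (a - b) S = gcoeff a S - gcoeff b S" by transfer simp
lemma gcoeff_scaleR [simp]: "gcoeff (c *\<^sub>R a) S = c * gcoeff a S" by transfer simp
lemma gcoeff_one: "gcoeff 1 S = of_bool (S = {})" by transfer simp
lemma gcoeff_of_real: "gcoeff (of_real r) S = (if S = {} then r else 0)"
  by (simp add: of_real_def gcoeff_one)
lemma gcoeff_sum [simp]: "gcoeff (sum f A) S = (\<Sum>i\<in>A. gcoeff (f i) S)"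
  by (induction A rule: infinite_finite_induct) simp_all
lemma gcoeff_times:
  "gcoeff (a * b) S = (\<Sum>T\<in>Pow S. gsign T (S - T) * gcoeff a T * gcoeff b (S - T))"
  by transfer simp
lemma gcoeff_gen: "gcoeff (gen i) S = of_bool (S = {i})" by transfer simp
lemma gcoeff_gderiv:
  "gcoeff (gderiv i a) S = (if i \<in> S then 0 else (-1) ^ card {s\<in>S. s < i} * gcoeff a (insert i S))"
  by transfer simp
lemma gcoeff_gkill: "gcoeff (gkill i a) S = (if i \<in> S then 0 else gcoeff a S)" by transfer simp

lemma body_zero [simp]: "body 0 = 0" by (simp add: body_def)
lemma body_one [simp]: "body 1 = 1" by (simp add: body_def gcoeff_one)
lemma body_plus [simp]: "body (a + b) = body a + body b" by (simp add: body_def)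
lemma body_minus [simp]: "body (a - b) = body a - body b" by (simp add: body_def)
lemma body_scaleR [simp]: "body (c *\<^sub>R a) = c * body a" by (simp add: body_def)
lemma body_times [simp]: "body (a * b) = body a * body b" by (simp add: body_def gcoeff_times)
lemma body_of_real [simp]: "body (of_real r) = r" by (simp add: body_def gcoeff_of_real)
lemma body_sum [simp]: "body (sum f A) = (\<Sum>i\<in>A. body (f i))" by (simp add: body_def)
lemma body_of_bool [simp]: "body (of_bool P) = of_bool P" by (cases P) simp_all
lemma body_soul [simp]: "body (soul a) = 0" by (simp add: soul_def)
lemma body_plus_soul: "a = of_real (body a) + soul a" by (simp add: soul_def)

section \<open>Filtration by degree, support and parity\<close>

text \<open>Infinite \<open>S\<close> have \<open>card S = 0\<close> in HOL and so fall under the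
  condition, harmlessly, since the type already forces their coefficients to be 0.\<close>

definition gvanish :: "nat \<Rightarrow> grassmann \<Rightarrow> bool" where
  "gvanish k a \<longleftrightarrow> (\<forall>S. card S < k \<longrightarrow> gcoeff a S = 0)"

text \<open>A finite \<open>G\<close> is what makes souls nilpotent: an element of the type may have
  infinitely many nonzero coefficients, and then its soul need not be nilpotent.\<close>

definition gsupp :: "nat set \<Rightarrow> grassmann \<Rightarrow> bool" where
  "gsupp G a \<longleftrightarrow> (\<forall>S. gcoeff a S \<noteq> 0 \<longrightarrow> S \<subseteq> G)"

definition gparity :: "nat \<Rightarrow> grassmann \<Rightarrow> bool" where
  "gparity p a \<longleftrightarrow> (\<forall>S. gcoeff a S \<noteq> 0 \<longrightarrow> even (card S + p))"

lemma gvanish_zero [simp]: "gvanish k 0" by (simp add: gvanish_def)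
lemma gvanish_0 [simp]: "gvanish 0 a" by (simp add: gvanish_def)

lemma gvanish_1: "body a = 0 \<Longrightarrow> gvanish 1 a"
  unfolding gvanish_def body_def
  by (metis card_eq_0_iff gcoeff_infinite less_one)

lemma gvanish_sum: "(\<And>i. i \<in> A \<Longrightarrow> gvanish k (f i)) \<Longrightarrow> gvanish k (sum f A)"
  by (simp add: gvanish_def)

lemma gvanish_times:
  assumes "gvanish j a" "gvanish k b"
  shows "gvanish (j + k) (a * b)"
  unfolding gvanish_def
proof (intro allI impI)
  fix S :: "nat set" assume S: "card S < j + k"
  show "gcoeff (a * b) S = 0"
  proof (cases "finite S")
    case True
    have "gcoeff a T = 0 \<or> gcoeff b (S - T) = 0" if "T \<in> Pow S" for T
    proof -
      have "card T + card (S - T) = card S" using that True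
        by (metis PowD card_Diff_subset card_mono finite_subset le_add_diff_inverse)
      then have "card T < j \<or> card (S - T) < k" using S by linarith
      then show ?thesis using assms by (auto simp: gvanish_def)
    qed
    then show ?thesis by (auto simp: gcoeff_times intro!: sum.neutral)
  qed (simp add: gcoeff_infinite)
qed

lemma gvanish_power: "gvanish 1 a \<Longrightarrow> gvanish k (a ^ k)"
  by (induction k) (use gvanish_times[of 1 a] in auto)

lemma gvanish_all_eq_0: "(\<And>k. gvanish k a) \<Longrightarrow> a = 0"
  by (rule grassmann_eqI) (auto simp: gvanish_def)

text \<open>A monomial in the generators \<open>G\<close> has degree at most \<open>card G\<close>.
  The Taylor and Neumann sums below terminate for this reason.\<close>

lemma gvanish_supp_eq_0:
  assumes "gsupp G a" "finite G" "gvanish k a" "card G < k"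
  shows "a = 0"
proof (rule grassmann_eqI)
  fix S :: "nat set"
  show "gcoeff a S = gcoeff 0 S"
  proof (cases "S \<subseteq> G")
    case True
    then have "card S < k" using card_mono[OF assms(2) True] assms(4) by simp
    then show ?thesis using assms(3) by (simp add: gvanish_def)
  next
    case False
    then show ?thesis using assms(1) by (auto simp: gsupp_def)
  qed
qed

lemma gsupp_zero [simp]: "gsupp G 0" by (simp add: gsupp_def)
lemma gsupp_one [simp]: "gsupp G 1" by (simp add: gsupp_def gcoeff_one)
lemma gsupp_of_real [simp]: "gsupp G (of_real r)" by (simp add: gsupp_def gcoeff_of_real)
lemma gsupp_of_bool [simp]: "gsupp G (of_bool P)" by (cases P) simp_all
lemma gsupp_plus: "gsupp G a \<Longrightarrow> gsupp G b \<Longrightarrow> gsupp G (a + b)"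
  by (force simp: gsupp_def)
lemma gsupp_minus: "gsupp G a \<Longrightarrow> gsupp G b \<Longrightarrow> gsupp G (a - b)"
  by (force simp: gsupp_def)
lemma gsupp_scaleR: "gsupp G a \<Longrightarrow> gsupp G (c *\<^sub>R a)"
  by (auto simp: gsupp_def)
lemma gsupp_sum: "(\<And>i. i \<in> A \<Longrightarrow> gsupp G (f i)) \<Longrightarrow> gsupp G (sum f A)"
  by (induction A rule: infinite_finite_induct) (auto intro: gsupp_plus)
lemma gsupp_times:
  assumes "gsupp G a" "gsupp G b" shows "gsupp G (a * b)"
  unfolding gsupp_def
proof (intro allI impI)
  fix S assume "gcoeff (a * b) S \<noteq> 0"
  then obtain T where "T \<in> Pow S" "gsign T (S - T) * gcoeff a T * gcoeff b (S - T) \<noteq> 0"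
    unfolding gcoeff_times by (meson sum.neutral)
  then show "S \<subseteq> G" using assms unfolding gsupp_def by fastforce
qed
lemma gsupp_power: "gsupp G a \<Longrightarrow> gsupp G (a ^ k)"
  by (induction k) (auto intro: gsupp_times)
lemma gsupp_soul: "gsupp G a \<Longrightarrow> gsupp G (soul a)"
  by (simp add: soul_def gsupp_minus)
lemma gsupp_gderiv: "gsupp G a \<Longrightarrow> gsupp G (gderiv i a)"
  by (auto simp: gsupp_def gcoeff_gderiv)
lemma gsupp_gen: "i \<in> G \<Longrightarrow> gsupp G (gen i)"
  by (auto simp: gsupp_def gcoeff_gen)
lemma gsupp_prod_list: "(\<And>a. a \<in> set as \<Longrightarrow> gsupp G a) \<Longrightarrow> gsupp G (prod_list as)"
  by (induction as) (auto intro: gsupp_times)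

lemma soul_power_eq_0:
  assumes "gsupp G a" "finite G" "card G < k" shows "soul a ^ k = 0"
  by (rule gvanish_supp_eq_0[OF gsupp_power[OF gsupp_soul]])
     (use assms in \<open>auto intro!: gvanish_power gvanish_1\<close>)

text \<open>Each pair in \<open>T \<times> U\<close> is an inversion for exactly one of the two
  orders, so the inversion numbers of the two shuffles add up to
  \<open>card T * card U\<close>.\<close>

lemma gsign_commute:
  assumes "finite T" "finite U" "T \<inter> U = {}"
  shows "gsign T U = (-1) ^ (card T * card U) * gsign U T"
proof -
  let ?A = "{(t, u). t \<in> T \<and> u \<in> U \<and> u < t}" and ?B = "{(t, u). t \<in> T \<and> u \<in> U \<and> t < u}"
  have "card ?B = card (prod.swap ` ?B)" by (simp add: card_image)
  moreover have "prod.swap ` ?B = {(u, t). u \<in> U \<and> t \<in> T \<and> t < u}" by auto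
  ultimately have B: "gsign U T = (-1) ^ card ?B" by (simp add: gsign_def)
  have "T \<times> U = ?A \<union> ?B" using assms(3) by auto
  moreover have "?A \<inter> ?B = {}" by auto
  moreover have "finite ?A" "finite ?B" using assms
    by (auto intro: finite_subset[of _ "T \<times> U"])
  ultimately have "card (T \<times> U) = card ?A + card ?B"
    using card_Un_disjoint[of ?A ?B] by simp
  then have "card T * card U = card ?A + card ?B" by (simp add: card_cartesian_product)
  then have "(-1::real) ^ (card T * card U) * (-1) ^ card ?B = (-1) ^ (card ?A + (card ?B + card ?B))"
    by (simp add: power_add)
  also have "\<dots> = (-1) ^ card ?A" by (simp add: minus_one_power_iff)
  finally show ?thesis unfolding B by (simp add: gsign_def)
qed

lemma gparity_commute:
  assumes "gparity p a" "gparity q b"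
  shows "a * b = (-1) ^ (p * q) * (b * a)"
proof -
  have "a * b = ((-1) ^ (p * q)) *\<^sub>R (b * a)"
  proof (rule grassmann_eqI)
    fix S :: "nat set" assume S: "finite S"
    have "gcoeff (a * b) S = (\<Sum>T\<in>Pow S. gsign (S - T) T * gcoeff a (S - T) * gcoeff b T)"
      unfolding gcoeff_times
      by (rule sum.reindex_bij_witness[where i = "\<lambda>T. S - T" and j = "\<lambda>T. S - T"])
         (auto simp: double_diff)
    also have "\<dots> = (\<Sum>T\<in>Pow S. (-1) ^ (p * q) * (gsign T (S - T) * gcoeff b T * gcoeff a (S - T)))"
    proof (rule sum.cong[OF refl])
      fix T assume "T \<in> Pow S"
      then have fin: "finite T" "finite (S - T)" using S by (auto intro: finite_subset)
      show "gsign (S - T) T * gcoeff a (S - T) * gcoeff b T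
          = (-1) ^ (p * q) * (gsign T (S - T) * gcoeff b T * gcoeff a (S - T))"
      proof (cases "gcoeff a (S - T) = 0 \<or> gcoeff b T = 0")
        case False
        then have "even (card (S - T) + p)" "even (card T + q)"
          using assms by (auto simp: gparity_def)
        then have "(-1::real) ^ (card (S - T) * card T) = (-1) ^ (p * q)"
          by (simp add: minus_one_power_iff)
        then show ?thesis using gsign_commute[of "S - T" T] fin by (auto simp: Int_commute)
      qed auto
    qed
    finally show "gcoeff (a * b) S = gcoeff (((-1) ^ (p * q)) *\<^sub>R (b * a)) S"
      by (simp add: gcoeff_times sum_distrib_left)
  qed
  also have "\<dots> = (-1) ^ (p * q) * (b * a)"
    by (cases "even (p * q)") (simp_all add: minus_one_power_iff)
  finally show ?thesis .
qed

lemma gparity_any: "even p \<Longrightarrow> gparity p a \<Longrightarrow> gparity 0 a" by (simp add: gparity_def)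

text \<open>The element \<open>b\<close> is arbitrary; it is split into its even and odd parts
  \<open>P 0\<close> and \<open>P 1\<close>, and an even element commutes with both.\<close>

lemma gparity_even_commute:
  assumes "gparity 0 a" shows "a * b = b * a"
proof -
  define P where "P p = Abs_grassmann (\<lambda>S. if even (card S + p) then gcoeff b S else 0)" for p
  have c: "gcoeff (P p) S = (if even (card S + p) then gcoeff b S else 0)" for p S
    unfolding P_def by (subst Abs_grassmann_inverse) (auto simp: gcoeff_infinite)
  have "b = P 0 + P 1" by (rule grassmann_eqI) (simp add: c)
  moreover have "a * P p = P p * a" for p
    using gparity_commute[OF assms, of p "P p"] by (simp add: gparity_def c split: if_splits)
  ultimately show ?thesis by (metis distrib_left distrib_right)
qed

lemma gparity_odd_anticommute: "gparity 1 a \<Longrightarrow> gparity 1 b \<Longrightarrow> a * b = - (b * a)"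
  using gparity_commute[of 1 a 1 b] by simp

lemma gparity_odd_square: "gparity 1 a \<Longrightarrow> a * a = 0"
proof -
  assume "gparity 1 a"
  then have "a * a = - (a * a)" by (rule gparity_odd_anticommute) fact
  then have "2 *\<^sub>R (a * a) = 0" by (simp add: scaleR_2 eq_neg_iff_add_eq_0)
  then show ?thesis by simp
qed

lemma gparity_of_real [simp]: "gparity 0 (of_real r)" by (simp add: gparity_def gcoeff_of_real)
lemma gparity_minus: "gparity p a \<Longrightarrow> gparity p b \<Longrightarrow> gparity p (a - b)"
  by (force simp: gparity_def)
lemma gparity_soul: "gparity 0 a \<Longrightarrow> gparity 0 (soul a)"
  by (simp add: soul_def gparity_minus)
lemma gparity_gen: "gparity 1 (gen i)" by (simp add: gparity_def gcoeff_gen)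

lemma gparity_gderiv:
  assumes "gparity p a" shows "gparity (p + 1) (gderiv i a)"
  unfolding gparity_def
proof (intro allI impI)
  fix S assume "gcoeff (gderiv i a) S \<noteq> 0"
  then have i: "i \<notin> S" and c: "gcoeff a (insert i S) \<noteq> 0" by (auto simp: gcoeff_gderiv split: if_splits)
  then have "finite S" using gcoeff_infinite by (meson finite_insert)
  then show "even (card S + (p + 1))" using assms c i unfolding gparity_def
    by (metis add_Suc add_Suc_right card_insert_disjoint add.right_neutral One_nat_def)
qed

lemma body_gparity_odd: "gparity p a \<Longrightarrow> odd p \<Longrightarrow> body a = 0"
  unfolding gparity_def body_def by (metis add_0 card.empty)

text \<open>In the coefficient of \<open>b * a\<close> at \<open>S\<close> only the term
  \<open>T = {}\<close> contains \<open>gcoeff a S\<close>; the others contain coefficients of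
  \<open>a\<close> at proper subsets of \<open>S\<close>, which vanish by induction. This takes the
  place of division by \<open>b\<close>.\<close>

lemma grassmann_mult_cancel_left:
  assumes "body b \<noteq> 0" "b * a = 0" shows "a = 0"
proof (rule grassmann_eqI)
  fix S :: "nat set" assume "finite S"
  then have "gcoeff a S = 0"
  proof (induction S rule: finite_psubset_induct)
    case (psubset S)
    have "0 = gcoeff (b * a) S" using assms by simp
    also have "\<dots> = (\<Sum>T\<in>Pow S. if T = {} then body b * gcoeff a S else 0)"
      unfolding gcoeff_times
    proof (rule sum.cong[OF refl])
      fix T assume "T \<in> Pow S"
      then have "T \<noteq> {} \<Longrightarrow> S - T \<subset> S" by auto
      then show "gsign T (S - T) * gcoeff b T * gcoeff a (S - T)
          = (if T = {} then body b * gcoeff a S else 0)"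
        using psubset by (auto simp: body_def)
    qed
    also have "\<dots> = body b * gcoeff a S" using psubset by simp
    finally show ?case using assms by simp
  qed
  then show "gcoeff a S = gcoeff 0 S" by simp
qed

section \<open>The odd derivative\<close>

lemma gen_times:
  assumes "finite S"
  shows "gcoeff (gen i * c) S = (if i \<in> S then (-1) ^ card {s\<in>S. s < i} * gcoeff c (S - {i}) else 0)"
proof -
  have g: "gsign {i} (S - {i}) = (-1) ^ card {s\<in>S. s < i}"
  proof -
    have "{(t, u). t \<in> {i} \<and> u \<in> S - {i} \<and> u < t} = Pair i ` {s\<in>S. s < i}" by auto
    then show ?thesis by (simp add: gsign_def card_image inj_on_def)
  qed
  have "gcoeff (gen i * c) S = (\<Sum>T\<in>Pow S. if T = {i} then gsign {i} (S - {i}) * gcoeff c (S - {i}) else 0)"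
    unfolding gcoeff_times by (rule sum.cong) (auto simp: gcoeff_gen)
  then show ?thesis using assms g by simp
qed

text \<open>Left multiplication by \<open>gen i\<close> and \<open>gderiv i\<close> both carry the
  sign of moving generator \<open>i\<close> to the front, so the two signs cancel. The Leibniz rule
  is proved by splitting both factors in this way.\<close>

lemma gkill_gderiv_decomp: "a = gkill i a + gen i * gderiv i a"
proof (rule grassmann_eqI)
  fix S :: "nat set" assume S: "finite S"
  have "{s \<in> S - {i}. s < i} = {s\<in>S. s < i}" by auto
  then show "gcoeff a S = gcoeff (gkill i a + gen i * gderiv i a) S"
    by (simp add: gen_times[OF S] gcoeff_gkill gcoeff_gderiv insert_absorb minus_one_power_iff)
qed

lemma gderiv_plus: "gderiv i (a + b) = gderiv i a + gderiv i b"
  by (rule grassmann_eqI) (simp add: gcoeff_gderiv algebra_simps)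
lemma gderiv_minus: "gderiv i (a - b) = gderiv i a - gderiv i b"
  by (rule grassmann_eqI) (simp add: gcoeff_gderiv algebra_simps)
lemma gderiv_scaleR: "gderiv i (c *\<^sub>R a) = c *\<^sub>R gderiv i a"
  by (rule grassmann_eqI) (simp add: gcoeff_gderiv)
lemma gderiv_zero [simp]: "gderiv i 0 = 0"
  by (rule grassmann_eqI) (simp add: gcoeff_gderiv)
lemma gderiv_sum: "gderiv i (sum f A) = (\<Sum>x\<in>A. gderiv i (f x))"
  by (induction A rule: infinite_finite_induct) (simp_all add: gderiv_plus)
lemma gderiv_of_real [simp]: "gderiv i (of_real r) = 0"
  by (rule grassmann_eqI) (simp add: gcoeff_gderiv gcoeff_of_real)

lemma gderiv_free: "gsupp (- {i}) a \<Longrightarrow> gderiv i a = 0"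
  by (rule grassmann_eqI) (auto simp: gcoeff_gderiv gsupp_def)

lemma gderiv_gen_times: "gsupp (- {i}) c \<Longrightarrow> gderiv i (gen i * c) = c"
proof (rule grassmann_eqI)
  fix S :: "nat set" assume c: "gsupp (- {i}) c" and S: "finite S"
  have "{s \<in> insert i S. s < i} = {s\<in>S. s < i}" by auto
  moreover have "i \<notin> S \<Longrightarrow> insert i S - {i} = S" by auto
  moreover have "i \<in> S \<Longrightarrow> gcoeff c S = 0" using c by (auto simp: gsupp_def)
  ultimately show "gcoeff (gderiv i (gen i * c)) S = gcoeff c S"
    using S by (simp add: gcoeff_gderiv gen_times minus_one_power_iff)
qed

lemma gsupp_gkill: "gsupp (- {i}) (gkill i a)" by (auto simp: gsupp_def gcoeff_gkill)
lemma gsupp_gderiv_free: "gsupp (- {i}) (gderiv i a)" by (auto simp: gsupp_def gcoeff_gderiv)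
lemma gparity_gkill: "gparity p a \<Longrightarrow> gparity p (gkill i a)"
  by (auto simp: gparity_def gcoeff_gkill)

lemma gderiv_times_even:
  assumes "gparity 0 a"
  shows "gderiv i (a * b) = gderiv i a * b + a * gderiv i b"
proof -
  define a0 a1 b0 b1 where "a0 = gkill i a" and "a1 = gderiv i a" and "b0 = gkill i b" and "b1 = gderiv i b"
  have a: "a = a0 + gen i * a1" and b: "b = b0 + gen i * b1"
    unfolding a0_def a1_def b0_def b1_def by (rule gkill_gderiv_decomp)+
  have free: "gsupp (- {i}) a0" "gsupp (- {i}) a1" "gsupp (- {i}) b0" "gsupp (- {i}) b1"
    unfolding a0_def a1_def b0_def b1_def by (simp_all add: gsupp_gkill gsupp_gderiv_free)
  have a0: "a0 * gen i = gen i * a0"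
    unfolding a0_def by (intro gparity_even_commute gparity_gkill assms)
  have a1: "a1 * gen i = - (gen i * a1)"
    unfolding a1_def using gparity_gderiv[OF assms, of i]
    by (intro gparity_odd_anticommute gparity_gen) simp
  have sq: "gen i * gen i = 0" by (rule gparity_odd_square[OF gparity_gen])
  have e1: "gen i * a1 * (gen i * b1) = 0"
  proof -
    have "gen i * a1 * (gen i * b1) = gen i * (a1 * gen i) * b1" by (simp add: mult.assoc)
    also have "\<dots> = - (gen i * gen i * a1 * b1)" by (simp add: a1 mult.assoc)
    finally show ?thesis by (simp add: sq)
  qed
  have "a * b = a0 * b0 + gen i * a1 * b0 + a0 * gen i * b1 + gen i * a1 * (gen i * b1)"
    unfolding a b by (simp only: distrib_left distrib_right mult.assoc add.assoc)
  also have "\<dots> = a0 * b0 + gen i * (a1 * b0 + a0 * b1)"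
    unfolding a0 e1 by (simp only: distrib_left mult.assoc add.assoc add_0_right)
  finally have "gderiv i (a * b) = a1 * b0 + a0 * b1"
    using free by (simp add: gderiv_plus gderiv_free gderiv_gen_times gsupp_times gsupp_plus)
  \<comment> \<open>The full \<open>a\<close> and \<open>b\<close> are restored for free: the two
    new terms \<open>a1 * (gen i * b1)\<close> and \<open>gen i * a1 * b1\<close> cancel because
    \<open>a1\<close> is odd.\<close>
  also have "\<dots> = a1 * (b0 + gen i * b1) + (a0 + gen i * a1) * b1"
  proof -
    have "a1 * (gen i * b1) = - (gen i * a1 * b1)"
      unfolding mult.assoc[symmetric] a1 by simp
    then show ?thesis by (simp add: distrib_left distrib_right)
  qed
  finally have "gderiv i (a * b) = a1 * b + a * b1" unfolding a[symmetric] b[symmetric] .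
  then show ?thesis unfolding a1_def b1_def .
qed

section \<open>Matrices over the Grassmann algebra\<close>

lemma sum_of_bool_left:
  fixes F :: "'i \<Rightarrow> 'a::semiring_1"
  assumes "finite J" "a \<in> J" shows "(\<Sum>b\<in>J. of_bool (a = b) * F b) = F a"
proof -
  have "(\<Sum>b\<in>J. of_bool (a = b) * F b) = (\<Sum>b\<in>J. if b = a then F b else 0)"
    by (rule sum.cong) auto
  then show ?thesis using assms by simp
qed

lemma sum_of_bool_right:
  fixes F :: "'i \<Rightarrow> 'a::semiring_1"
  assumes "finite J" "c \<in> J" shows "(\<Sum>b\<in>J. F b * of_bool (b = c)) = F c"
proof -
  have "(\<Sum>b\<in>J. F b * of_bool (b = c)) = (\<Sum>b\<in>J. if b = c then F b else 0)"
    by (rule sum.cong) auto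
  then show ?thesis using assms by simp
qed

lemma matrix_product_assoc:
  fixes A B C :: "'i \<Rightarrow> 'i \<Rightarrow> 'a::semiring_0"
  shows "(\<Sum>b\<in>J. A a b * (\<Sum>d\<in>J. B b d * C d c)) = (\<Sum>d\<in>J. (\<Sum>b\<in>J. A a b * B b d) * C d c)"
  unfolding sum_distrib_left sum_distrib_right mult.assoc by (rule sum.swap)

text \<open>An enumeration \<open>f\<close> of \<open>J\<close> carries the known fact about square
  matrices over to functions on an arbitrary finite index set. It settles the number part of the
  same question over the Grassmann algebra.\<close>

lemma real_right_inverse_imp_left:
  fixes A B :: "'i \<Rightarrow> 'i \<Rightarrow> real"
  assumes J: "finite J"
    and AB: "\<And>a c. a \<in> J \<Longrightarrow> c \<in> J \<Longrightarrow> (\<Sum>b\<in>J. A a b * B b c) = of_bool (a = c)"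
    and ac: "a \<in> J" "c \<in> J"
  shows "(\<Sum>b\<in>J. B a b * A b c) = of_bool (a = c)"
proof -
  define n where "n = card J"
  obtain f where f: "bij_betw f {0..<n} J"
    using ex_bij_betw_nat_finite[OF J] n_def by blast
  define X where "X F = Matrix.mat n n (\<lambda>(i, j). F (f i) (f j))" for F :: "'i \<Rightarrow> 'i \<Rightarrow> real"
  have X: "X F \<in> carrier_mat n n" for F by (simp add: X_def)
  have inj: "f i = f j \<longleftrightarrow> i = j" if "i < n" "j < n" for i j
    using bij_betw_imp_inj_on[OF f] that by (auto simp: inj_on_def)
  have mem: "f i \<in> J" if "i < n" for i using f that by (auto simp: bij_betw_def)
  have prod: "(X F * X F') $$ (i, j) = (\<Sum>b\<in>J. F (f i) b * F' b (f j))" if "i < n" "j < n" for F F' i j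
    using that by (simp add: X_def scalar_prod_def sum.reindex_bij_betw[OF f, symmetric])
  have "X A * X B = 1\<^sub>m n"
  proof (rule eq_matI)
    fix i j assume "i < dim_row (1\<^sub>m n)" "j < dim_col (1\<^sub>m n)"
    then show "(X A * X B) $$ (i, j) = 1\<^sub>m n $$ (i, j)"
      by (simp add: prod AB mem inj)
  qed (simp_all add: X_def)
  then have BA: "X B * X A = 1\<^sub>m n" by (rule mat_mult_left_right_inverse[OF X X])
  obtain i j where "i < n" "j < n" "a = f i" "c = f j"
    using ac f by (force simp: bij_betw_def)
  then show ?thesis using prod[of i j B A] BA inj by (auto split: if_splits)
qed

text \<open>\<open>1 - X M\<close> is idempotent and has number part \<open>0\<close>, so its entries start in arbitrarily high degree.\<close>
lemma gmat_right_inverse_imp_left: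
  assumes J: "finite J"
    and MX: "\<And>a c. a \<in> J \<Longrightarrow> c \<in> J \<Longrightarrow> (\<Sum>b\<in>J. M a b * X b c) = (of_bool (a = c) :: grassmann)"
    and ac: "a \<in> J" "c \<in> J"
  shows "(\<Sum>b\<in>J. X a b * M b c) = of_bool (a = c)"
proof -
  define P where "P a c = (\<Sum>b\<in>J. X a b * M b c)" for a c
  define e where "e a c = of_bool (a = c) - P a c" for a c
  have PP: "(\<Sum>b\<in>J. P a b * P b c) = P a c" if "a \<in> J" "c \<in> J" for a c
  proof -
    have "(\<Sum>b\<in>J. P a b * P b c) = (\<Sum>b\<in>J. X a b * (\<Sum>d\<in>J. M b d * P d c))"
      unfolding P_def[of a] by (rule matrix_product_assoc[symmetric])
    also have "\<dots> = (\<Sum>b\<in>J. X a b * (\<Sum>d\<in>J. (\<Sum>f\<in>J. M b f * X f d) * M d c))"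
      unfolding P_def matrix_product_assoc ..
    also have "\<dots> = P a c"
      unfolding P_def by (rule sum.cong[OF refl]) (simp add: MX sum_of_bool_left J)
    finally show ?thesis .
  qed
  have ee: "(\<Sum>b\<in>J. e a b * e b c) = e a c" if "a \<in> J" "c \<in> J" for a c
    using that J
    by (simp add: e_def right_diff_distrib left_diff_distrib sum_subtractf
        sum_of_bool_left sum_of_bool_right PP)
  have body_e: "body (e a c) = 0" if "a \<in> J" "c \<in> J" for a c
  proof -
    have "(\<Sum>b\<in>J. body (X a b) * body (M b c)) = of_bool (a = c)"
    proof (rule real_right_inverse_imp_left[OF J _ that])
      fix a c assume "a \<in> J" "c \<in> J"
      from arg_cong[OF MX[OF this], of body]
      show "(\<Sum>b\<in>J. body (M a b) * body (X b c)) = of_bool (a = c)" by simp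
    qed
    then show ?thesis by (simp add: e_def P_def)
  qed
  have "gvanish k (e a c)" if "a \<in> J" "c \<in> J" for a c k
    using that
  proof (induction k arbitrary: a c)
    case (Suc k)
    have "gvanish (1 + k) (\<Sum>b\<in>J. e a b * e b c)"
      using Suc by (intro gvanish_sum gvanish_times gvanish_1 body_e)
    then show ?case using Suc.prems by (simp add: ee)
  qed simp
  then have "e a c = 0" using ac gvanish_all_eq_0 by blast
  then show ?thesis by (simp add: e_def P_def)
qed

text \<open>Neumann series for \<open>M Y = 1 - D\<close>; \<open>D\<close> is nilpotent because finitely many generators occur.\<close>
lemma ginvertible_if_body_invertible:
  assumes J: "finite J" and G: "finite G"
    and supp: "\<And>a b. a \<in> J \<Longrightarrow> b \<in> J \<Longrightarrow> gsupp G (M a b)"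
    and Y: "\<And>a c. a \<in> J \<Longrightarrow> c \<in> J \<Longrightarrow> (\<Sum>b\<in>J. body (M a b) * Y b c) = of_bool (a = c)"
  shows "ginvertible J M"
proof -
  define Q where "Q a c = (\<Sum>b\<in>J. M a b * of_real (Y b c))" for a c
  define D where "D a c = of_bool (a = c) - Q a c" for a c
  define P where "P = rec_nat (\<lambda>a c. of_bool (a = c)) (\<lambda>_ R a c. \<Sum>b\<in>J. D a b * R b c)"
  have P0: "P 0 = (\<lambda>a c. of_bool (a = c))" and PS: "P (Suc k) = (\<lambda>a c. \<Sum>b\<in>J. D a b * P k b c)" for k
    by (simp_all add: P_def)
  have D: "gvanish 1 (D a c)" "gsupp G (D a c)" if "a \<in> J" "c \<in> J" for a c
  proof -
    have "body (D a c) = 0" using that by (simp add: D_def Q_def Y)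
    then show "gvanish 1 (D a c)" by (rule gvanish_1)
    show "gsupp G (D a c)"
      unfolding D_def Q_def using that
      by (intro gsupp_minus gsupp_sum gsupp_times supp gsupp_of_real gsupp_of_bool) auto
  qed
  have P: "gvanish k (P k a c) \<and> gsupp G (P k a c)" if "a \<in> J" "c \<in> J" for a c k
    using that
  proof (induction k arbitrary: a c)
    case (Suc k)
    have "gvanish (1 + k) (\<Sum>b\<in>J. D a b * P k b c)"
      using Suc by (intro gvanish_sum gvanish_times D) auto
    moreover have "gsupp G (\<Sum>b\<in>J. D a b * P k b c)"
      using Suc by (intro gsupp_sum gsupp_times D) auto
    ultimately show ?case by (simp add: PS)
  qed (simp add: P0)
  \<comment> \<open>One more than the top degree in the generators \<open>G\<close>, so that the
    matrix power \<open>P K\<close> of \<open>D\<close> vanishes.\<close>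
  define K where "K = Suc (card G)"
  define S where "S a c = (\<Sum>k<K. P k a c)" for a c
  have PK: "P K a c = 0" if "a \<in> J" "c \<in> J" for a c
    using P[OF that] G by (intro gvanish_supp_eq_0[of G _ K]) (auto simp: K_def)
  have DS: "(\<Sum>b\<in>J. D a b * S b c) = S a c - of_bool (a = c)" if "a \<in> J" "c \<in> J" for a c
  proof -
    have "(\<Sum>b\<in>J. D a b * S b c) = (\<Sum>k<K. P (Suc k) a c)"
      unfolding S_def PS sum_distrib_left by (rule sum.swap)
    moreover have "(\<Sum>k<Suc K. P k a c) = P 0 a c + (\<Sum>k<K. P (Suc k) a c)"
      by (rule sum.lessThan_Suc_shift)
    moreover have "(\<Sum>k<Suc K. P k a c) = S a c + P K a c" by (simp add: S_def)
    ultimately show ?thesis using PK[OF that] by (simp add: P0 algebra_simps)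
  qed
  \<comment> \<open>From M Y = 1 - D and (1 - D) S = 1 the right inverse is the product Y S.\<close>
  define X where "X b c = (\<Sum>d\<in>J. of_real (Y b d) * S d c)" for b c
  have MX: "(\<Sum>b\<in>J. M a b * X b c) = of_bool (a = c)" if "a \<in> J" "c \<in> J" for a c
  proof -
    have "(\<Sum>b\<in>J. M a b * X b c) = (\<Sum>d\<in>J. Q a d * S d c)"
      unfolding X_def Q_def by (rule matrix_product_assoc)
    also have "\<dots> = (\<Sum>d\<in>J. of_bool (a = d) * S d c) - (\<Sum>d\<in>J. D a d * S d c)"
      by (simp add: D_def left_diff_distrib sum_subtractf)
    also have "\<dots> = of_bool (a = c)" using that by (simp add: DS sum_of_bool_left J)
    finally show ?thesis .
  qed
  show ?thesis
    unfolding ginvertible_def gmat_inverse_def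
    using MX gmat_right_inverse_imp_left[OF J MX] by blast
qed

text \<open>\<open>ginv\<close> is a choice, pinned down by uniqueness: a left inverse Y and a right
  inverse X satisfy Y = Y (M X) = (Y M) X = X.\<close>

lemma ginv_eq:
  assumes J: "finite J" and X: "gmat_inverse J M X" and ac: "a \<in> J" "c \<in> J"
  shows "ginv J M a c = X a c"
proof -
  have Y: "gmat_inverse J M (ginv J M)" unfolding ginv_def using X by (rule someI[of "gmat_inverse J M"])
  have "ginv J M a c = (\<Sum>b\<in>J. ginv J M a b * (\<Sum>d\<in>J. M b d * X d c))"
    using X ac J by (simp add: gmat_inverse_def sum_of_bool_right)
  also have "\<dots> = X a c"
    unfolding matrix_product_assoc using Y ac J by (simp add: gmat_inverse_def sum_of_bool_left)
  finally show ?thesis .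
qed

lemma gdet_cong:
  assumes "finite I" "\<And>i j. i \<in> I \<Longrightarrow> j \<in> I \<Longrightarrow> M i j = M' i j"
  shows "gdet I M = gdet I M'"
  unfolding gdet_def
proof (rule sum.cong[OF refl])
  fix p assume "p \<in> {p. p permutes I}"
  then have m: "map (\<lambda>i. M i (p i)) (sorted_list_of_set I) = map (\<lambda>i. M' i (p i)) (sorted_list_of_set I)"
    using assms by (auto simp: permutes_in_image)
  then show "of_int (sign p) * prod_list (map (\<lambda>i. M i (p i)) (sorted_list_of_set I)) =
      of_int (sign p) * prod_list (map (\<lambda>i. M' i (p i)) (sorted_list_of_set I))"
    by (simp only: m)
qed

text \<open>A permutation with \<open>p 0 \<noteq> 0\<close> picks a zero entry of row 0, and the
  remaining ones are the permutations of \<open>I\<close>. As 0 is the least index,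
  \<open>M 0 0\<close> stands first in each product and comes out on the left without passing other
  entries.\<close>

lemma gdet_insert_0:
  assumes I: "finite I" "0 \<notin> I" and M: "\<And>i. i \<in> I \<Longrightarrow> M 0 i = 0"
  shows "gdet (insert 0 I) M = M 0 0 * gdet I M"
proof -
  let ?t = "\<lambda>J p. of_int (sign p) * prod_list (map (\<lambda>i. M i (p i)) (sorted_list_of_set J))"
  have sl: "sorted_list_of_set (insert 0 I) = 0 # sorted_list_of_set I"
    using I by (simp add: insort_is_Cons)
  have "gdet (insert 0 I) M = (\<Sum>p | p permutes I. ?t (insert 0 I) p)"
    unfolding gdet_def
  proof (rule sum.mono_neutral_right)
    show "finite {p. p permutes insert 0 I}" using I by (simp add: finite_permutations)
    show "{p. p permutes I} \<subseteq> {p. p permutes insert 0 I}" by (auto intro: permutes_subset)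
    show "\<forall>p\<in>{p. p permutes insert 0 I} - {p. p permutes I}. ?t (insert 0 I) p = 0"
    proof
      fix p assume p: "p \<in> {p. p permutes insert 0 I} - {p. p permutes I}"
      then have "p 0 \<noteq> 0"
        using permutes_superset[of p "insert 0 I" I] by auto
      moreover have "p 0 \<in> insert 0 I" using p permutes_in_image[of p "insert 0 I" 0] by simp
      ultimately show "?t (insert 0 I) p = 0" by (simp add: sl M)
    qed
  qed
  also have "\<dots> = (\<Sum>p | p permutes I. M 0 0 * ?t I p)"
  proof (rule sum.cong[OF refl])
    fix p assume "p \<in> {p. p permutes I}"
    then have "p 0 = 0" using I by (simp add: permutes_not_in)
    then show "?t (insert 0 I) p = M 0 0 * ?t I p"
      by (simp add: sl flip: mult.assoc) (simp add: mult_of_int_commute)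
  qed
  finally show ?thesis by (simp add: gdet_def sum_distrib_left)
qed

section \<open>Leibniz rule and Cauchy product in divided form\<close>

lemma leibniz_sum:
  fixes A :: "nat \<Rightarrow> nat \<Rightarrow> 'a::real_vector"
  shows "(\<Sum>j\<le>k. real (Suc j) *\<^sub>R A (Suc j) (k - j) + real (Suc (k - j)) *\<^sub>R A j (Suc (k - j)))
    = real (Suc k) *\<^sub>R (\<Sum>j\<le>Suc k. A j (Suc k - j))"
proof -
  \<comment> \<open>The term \<open>A j (Suc k - j)\<close> is collected with total weight j + (k +
    1 - j) = k + 1.\<close>
  have "real (Suc k) *\<^sub>R (\<Sum>j\<le>Suc k. A j (Suc k - j))
      = (\<Sum>j\<le>Suc k. real j *\<^sub>R A j (Suc k - j) + real (Suc k - j) *\<^sub>R A j (Suc k - j))"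
    unfolding scaleR_sum_right
    by (rule sum.cong[OF refl]) (simp add: of_nat_diff flip: scaleR_add_left)
  also have "\<dots> = (\<Sum>j\<le>Suc k. real j *\<^sub>R A j (Suc k - j))
      + (\<Sum>j\<le>Suc k. real (Suc k - j) *\<^sub>R A j (Suc k - j))"
    by (rule sum.distrib)
  also have "(\<Sum>j\<le>Suc k. real j *\<^sub>R A j (Suc k - j)) = (\<Sum>j\<le>k. real (Suc j) *\<^sub>R A (Suc j) (k - j))"
    by (subst sum.atMost_Suc_shift) simp
  also have "(\<Sum>j\<le>Suc k. real (Suc k - j) *\<^sub>R A j (Suc k - j))
      = (\<Sum>j\<le>k. real (Suc (k - j)) *\<^sub>R A j (Suc (k - j)))"
    unfolding sum.atMost_Suc by (simp add: Suc_diff_le del: of_nat_Suc of_nat_diff)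
  finally show ?thesis by (simp add: sum.distrib)
qed

text \<open>Nonzero products have both indices at most \<open>K\<close>, and this square lies in the
  triangle \<open>i + j \<le> 2 * K\<close>; the rest of the triangle contributes 0.\<close>

lemma finite_cauchy_product:
  fixes a b :: "nat \<Rightarrow> 'a::semiring_0"
  assumes "\<And>i. i > K \<Longrightarrow> a i = 0" "\<And>i. i > K \<Longrightarrow> b i = 0"
  shows "(\<Sum>i\<le>K. a i) * (\<Sum>j\<le>K. b j) = (\<Sum>k\<le>2 * K. \<Sum>i\<le>k. a i * b (k - i))"
proof -
  have "(\<Sum>i\<le>K. a i) * (\<Sum>j\<le>K. b j) = (\<Sum>(i, j)\<in>{..K} \<times> {..K}. a i * b j)"
    by (simp add: sum_product sum.cartesian_product)
  also have "\<dots> = (\<Sum>(i, j)\<in>{(i, j). i + j \<le> 2 * K}. a i * b j)"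
  proof (rule sum.mono_neutral_left)
    show "finite {(i, j). i + j \<le> 2 * K}"
      by (rule finite_subset[of _ "{..2 * K} \<times> {..2 * K}"]) auto
    show "\<forall>i\<in>{(i, j). i + j \<le> 2 * K} - {..K} \<times> {..K}. (case i of (i, j) \<Rightarrow> a i * b j) = 0"
    proof
      fix p assume p: "p \<in> {(i, j). i + j \<le> 2 * K} - {..K} \<times> {..K}"
      obtain i j where ij: "p = (i, j)" by (cases p)
      have "i > K \<or> j > K" using p ij by auto
      then show "(case p of (i, j) \<Rightarrow> a i * b j) = 0" using assms ij by auto
    qed
  qed auto
  also have "\<dots> = (\<Sum>k\<le>2 * K. \<Sum>i\<le>k. a i * b (k - i))" by (rule sum.triangle_reindex_eq)
  finally show ?thesis .
qed

section \<open>Functions of one even variable\<close>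

text \<open>Smoothness on \<open>A\<close> in terms of the total operator \<open>deriv\<close>,
  since \<open>gapply\<close> is defined through its iterates. \<open>A\<close> will be an open set,
  so that the iterates on \<open>A\<close> depend only on the values there.\<close>

definition iter_diff :: "real set \<Rightarrow> (real \<Rightarrow> real) \<Rightarrow> bool" where
  "iter_diff A F \<longleftrightarrow> (\<forall>k. \<forall>t\<in>A. (deriv ^^ k) F field_differentiable at t)"

definition taylor_coeff :: "(real \<Rightarrow> real) \<Rightarrow> nat \<Rightarrow> real \<Rightarrow> real" where
  "taylor_coeff F k t = (deriv ^^ k) F t / fact k"

lemma taylor_coeff_DERIV:
  assumes "iter_diff A F" "t \<in> A"
  shows "(taylor_coeff F k has_field_derivative real (Suc k) * taylor_coeff F (Suc k) t) (at t)"
proof -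
  have "((deriv ^^ k) F has_field_derivative (deriv ^^ Suc k) F t) (at t)"
    using assms unfolding iter_diff_def by (simp add: DERIV_deriv_iff_field_differentiable)
  then have "((\<lambda>t. (deriv ^^ k) F t / fact k) has_field_derivative (deriv ^^ Suc k) F t / fact k) (at t)"
    by (rule DERIV_cdivide)
  moreover have "(deriv ^^ Suc k) F t / fact k = real (Suc k) * taylor_coeff F (Suc k) t"
    unfolding taylor_coeff_def fact_Suc by (simp del: of_nat_Suc)
  ultimately show ?thesis by (simp add: taylor_coeff_def[abs_def])
qed

lemma taylor_coeff_deriv: "taylor_coeff (deriv F) k t = real (Suc k) * taylor_coeff F (Suc k) t"
  unfolding taylor_coeff_def fact_Suc funpow_Suc_right o_apply by (simp del: of_nat_Suc)

lemma iter_diff_deriv: "iter_diff A F \<Longrightarrow> iter_diff A (deriv F)"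
  unfolding iter_diff_def by (metis comp_apply funpow_Suc_right)

lemma deriv_cong_open:
  assumes "open A" "t \<in> A" "\<And>t. t \<in> A \<Longrightarrow> F t = G t"
  shows "deriv F t = deriv G t"
  using assms by (intro deriv_cong_ev) (auto simp: eventually_nhds)

lemma iter_deriv_cong_open:
  assumes "open A" "t \<in> A" "\<And>t. t \<in> A \<Longrightarrow> F t = G t"
  shows "(deriv ^^ k) F t = (deriv ^^ k) G t"
  using assms(2)
proof (induction k arbitrary: t)
  case (Suc k)
  then show ?case using deriv_cong_open[OF assms(1), of t "(deriv ^^ k) F" "(deriv ^^ k) G"] by simp
qed (use assms in simp)

text \<open>The Leibniz rule divided by k!, which removes the binomial coefficients. The induction
  differentiates the identity of order \<open>k\<close>, which is available on all of the open set
  \<open>A\<close>, not only at \<open>t\<close>.\<close>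

lemma taylor_coeff_times:
  assumes A: "open A" and F: "iter_diff A F" and G: "iter_diff A G" and t: "t \<in> A"
  shows "taylor_coeff (\<lambda>t. F t * G t) k t = (\<Sum>j\<le>k. taylor_coeff F j t * taylor_coeff G (k - j) t)"
  using t
proof (induction k arbitrary: t)
  case 0
  then show ?case by (simp add: taylor_coeff_def)
next
  case (Suc k)
  let ?H = "\<lambda>t. F t * G t" and ?a = "taylor_coeff F" and ?b = "taylor_coeff G"
  have D: "((\<lambda>t. \<Sum>j\<le>k. ?a j t * ?b (k - j) t) has_field_derivative
      (\<Sum>j\<le>k. real (Suc j) * ?a (Suc j) t * ?b (k - j) t + real (Suc (k - j)) * ?b (Suc (k - j)) t * ?a j t)) (at t)"
    by (intro DERIV_sum DERIV_mult taylor_coeff_DERIV[OF F] taylor_coeff_DERIV[OF G] Suc.prems)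
  then have "deriv (\<lambda>t. \<Sum>j\<le>k. ?a j t * ?b (k - j) t) t
      = (\<Sum>j\<le>k. real (Suc j) * ?a (Suc j) t * ?b (k - j) t + real (Suc (k - j)) * ?b (Suc (k - j)) t * ?a j t)"
    by (rule DERIV_imp_deriv)
  also have "\<dots> = real (Suc k) * (\<Sum>j\<le>Suc k. ?a j t * ?b (Suc k - j) t)"
    using leibniz_sum[of "\<lambda>i j. ?a i t * ?b j t" k] by (simp add: mult_ac)
  finally have "deriv (taylor_coeff ?H k) t = real (Suc k) * (\<Sum>j\<le>Suc k. ?a j t * ?b (Suc k - j) t)"
    using deriv_cong_open[OF A Suc.prems, of "taylor_coeff ?H k" "\<lambda>t. \<Sum>j\<le>k. ?a j t * ?b (k - j) t"]
      Suc.IH by simp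
  moreover have "deriv (taylor_coeff ?H k) t = real (Suc k) * taylor_coeff ?H (Suc k) t"
  proof -
    \<comment> \<open>\<open>deriv\<close> pulls out the factor \<open>fact k\<close> only once
      differentiability is known; it is inherited from the sum in \<open>D\<close>, which agrees
      with \<open>taylor_coeff ?H k\<close> on \<open>A\<close> by induction.\<close>
    have "deriv (\<lambda>t. (deriv ^^ k) ?H t / fact k) t = (deriv ^^ Suc k) ?H t / fact k"
    proof -
      have diff: "(taylor_coeff ?H k) field_differentiable at t"
        using has_field_derivative_transform_within_open[OF D A Suc.prems, of "taylor_coeff ?H k"]
          Suc.IH unfolding field_differentiable_def by auto
      have "((\<lambda>t. fact k * taylor_coeff ?H k t) has_field_derivative fact k * deriv (taylor_coeff ?H k) t) (at t)"
        using diff by (intro DERIV_cmult) (simp add: DERIV_deriv_iff_field_differentiable)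
      then have "deriv ((deriv ^^ k) ?H) t = fact k * deriv (taylor_coeff ?H k) t"
        by (intro DERIV_imp_deriv) (simp add: taylor_coeff_def[abs_def])
      then show ?thesis by (simp add: taylor_coeff_def[abs_def])
    qed
    then show ?thesis unfolding taylor_coeff_def[abs_def] fact_Suc by (simp del: of_nat_Suc)
  qed
  ultimately show ?case by simp
qed

lemma iter_deriv_const: "(deriv ^^ k) (\<lambda>_. c) = (\<lambda>_. if k = 0 then c else (0::real))"
  by (induction k) auto

lemma iter_deriv_cmult_id:
  "(deriv ^^ k) (\<lambda>t. c * t) = (\<lambda>t. if k = 0 then c * t else if k = 1 then c else (0::real))"
proof (cases k)
  case (Suc m)
  have "deriv (\<lambda>t. c * t) = (\<lambda>_. c)"
    by (rule ext, rule DERIV_imp_deriv) (auto intro!: derivative_eq_intros)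
  then show ?thesis by (simp add: Suc funpow_Suc_right iter_deriv_const del: funpow.simps)
qed simp

lemma iter_deriv_cmult:
  assumes A: "open A" and F: "iter_diff A F" and t: "t \<in> A"
  shows "(deriv ^^ k) (\<lambda>t. c * F t) t = c * (deriv ^^ k) F t"
  using t
proof (induction k arbitrary: t)
  case (Suc k)
  have "deriv ((deriv ^^ k) (\<lambda>t. c * F t)) t = deriv (\<lambda>t. c * (deriv ^^ k) F t) t"
    by (rule deriv_cong_open[OF A Suc.prems]) (rule Suc.IH)
  also have "\<dots> = c * deriv ((deriv ^^ k) F) t"
    using F Suc.prems unfolding iter_diff_def by (intro deriv_cmult) auto
  finally show ?case by simp
qed simp

text \<open>A scheme for functions whose derivatives stay in a one-parameter family: every iterated
  derivative is a constant multiple of \<Phi> k, and \<Phi> k is differentiable. It is used with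
  \<open>sqrt t * inverse t ^ k\<close> and with \<open>inverse t ^ Suc k\<close>.\<close>

lemma iter_diffI_closed_form:
  assumes A: "open A"
    and D: "\<And>k t. t \<in> A \<Longrightarrow> (\<Phi> k has_field_derivative c k * \<Phi> (Suc k) t) (at t)"
    and F: "\<And>t. t \<in> A \<Longrightarrow> F t = \<Phi> 0 t"
  shows "iter_diff A F"
proof -
  have *: "\<exists>C. \<forall>t\<in>A. (deriv ^^ k) F t = C * \<Phi> k t" for k
  proof (induction k)
    case 0
    show ?case by (rule exI[of _ 1]) (simp add: F)
  next
    case (Suc k)
    then obtain C where C: "\<And>t. t \<in> A \<Longrightarrow> (deriv ^^ k) F t = C * \<Phi> k t" by blast
    have "(deriv ^^ Suc k) F t = (C * c k) * \<Phi> (Suc k) t" if t: "t \<in> A" for t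
    proof -
      have "deriv ((deriv ^^ k) F) t = deriv (\<lambda>t. C * \<Phi> k t) t"
        by (rule deriv_cong_open[OF A t C])
      also have "\<dots> = C * (c k * \<Phi> (Suc k) t)"
        by (intro DERIV_imp_deriv DERIV_cmult D t)
      finally show ?thesis by simp
    qed
    then show ?case by blast
  qed
  show ?thesis
    unfolding iter_diff_def
  proof (intro allI ballI)
    fix k t assume t: "t \<in> A"
    obtain C where C: "\<And>t. t \<in> A \<Longrightarrow> (deriv ^^ k) F t = C * \<Phi> k t" using * by blast
    have "((\<lambda>t. C * \<Phi> k t) has_field_derivative C * (c k * \<Phi> (Suc k) t)) (at t)"
      by (intro DERIV_cmult D t)
    then have "((deriv ^^ k) F has_field_derivative C * (c k * \<Phi> (Suc k) t)) (at t)"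
      by (rule has_field_derivative_transform_within_open[OF _ A t]) (simp add: C)
    then show "(deriv ^^ k) F field_differentiable at t"
      unfolding field_differentiable_def by blast
  qed
qed

text \<open>The form sqrt t / (2 t) serves both signs of t: for t < 0 the convention sqrt t = - sqrt
  |t| makes the derivative 1 / (2 sqrt |t|), whereas 1 / (2 sqrt t) would have the wrong
  sign.\<close>

lemma DERIV_sqrt_nonzero:
  fixes t :: real assumes "t \<noteq> 0"
  shows "(sqrt has_field_derivative sqrt t * inverse t / 2) (at t)"
proof -
  have "inverse (sqrt t) * \<bar>t\<bar> = sqrt t"
    unfolding real_sqrt_mult_self[symmetric] mult.assoc[symmetric] using assms by simp
  then have i: "inverse (sqrt t) = sqrt t / \<bar>t\<bar>" using assms by (intro eq_divide_imp) auto
  have "sqrt t * inverse t / 2 = inverse (sqrt t) / 2" if "t > 0"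
    unfolding i divide_inverse using that by simp
  moreover have "sqrt t * inverse t / 2 = - inverse (sqrt t) / 2" if "t < 0"
    unfolding i divide_inverse using that by simp
  ultimately show ?thesis by (rule DERIV_real_sqrt_generic[OF assms])
qed

lemma DERIV_ln_nonzero:
  fixes t :: real assumes "t \<noteq> 0"
  shows "(ln has_field_derivative inverse t) (at t)"
proof (cases "t > 0")
  case False
  then have "((\<lambda>t. ln (- t)) has_field_derivative inverse (- t) * (- 1)) (at t)"
    using assms by (intro DERIV_chain2[OF DERIV_ln]) (auto intro!: derivative_eq_intros)
  then show ?thesis by (simp add: ln_minus)
qed (rule DERIV_ln)

lemma open_nonzero: "open (- {0::real})" by (simp add: open_Compl)

lemma DERIV_inverse_power:
  fixes t :: real assumes "t \<noteq> 0"
  shows "((\<lambda>t. inverse t ^ k) has_field_derivative - real k * inverse t ^ Suc k) (at t)"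
proof -
  have "((\<lambda>t. inverse t ^ k) has_field_derivative
      of_nat k * (- (inverse t ^ Suc (Suc 0)) * inverse t ^ (k - Suc 0))) (at t)"
    by (intro DERIV_power DERIV_inverse assms)
  moreover have "of_nat k * (- (inverse t ^ Suc (Suc 0)) * inverse t ^ (k - Suc 0)) = - real k * inverse t ^ Suc k"
    by (cases k) (simp_all add: algebra_simps)
  ultimately show ?thesis by (rule DERIV_cong)
qed

lemma iter_diff_sqrt: "iter_diff (- {0}) sqrt"
proof (rule iter_diffI_closed_form[OF open_nonzero, where \<Phi> = "\<lambda>k t. sqrt t * inverse t ^ k"
      and c = "\<lambda>k. 1 / 2 - real k"])
  fix k and t :: real assume t: "t \<in> - {0}"
  show "((\<lambda>t. sqrt t * inverse t ^ k) has_field_derivative (1 / 2 - real k) * (sqrt t * inverse t ^ Suc k)) (at t)"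
    using t
    by (intro DERIV_cong[OF DERIV_mult[OF DERIV_sqrt_nonzero DERIV_inverse_power]])
       (simp_all add: algebra_simps)
qed simp

lemma iter_diff_inverse: "iter_diff (- {0}) (inverse :: real \<Rightarrow> real)"
proof (rule iter_diffI_closed_form[OF open_nonzero, where \<Phi> = "\<lambda>k t. inverse t ^ Suc k"
      and c = "\<lambda>k. - real (Suc k)"])
  fix k and t :: real assume t: "t \<in> - {0}"
  show "((\<lambda>t. inverse t ^ Suc k) has_field_derivative - real (Suc k) * inverse t ^ Suc (Suc k)) (at t)"
    using t by (intro DERIV_inverse_power) simp
qed simp

lemma deriv_ln_nonzero: "t \<noteq> 0 \<Longrightarrow> deriv ln t = inverse (t::real)"
  by (rule DERIV_imp_deriv[OF DERIV_ln_nonzero])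

lemma iter_diff_ln: "iter_diff (- {0}) (ln :: real \<Rightarrow> real)"
  unfolding iter_diff_def
proof (intro allI ballI)
  fix k and t :: real assume t: "t \<in> - {0}"
  show "(deriv ^^ k) ln field_differentiable at t"
  proof (cases k)
    case 0
    have "ln field_differentiable at t"
      using DERIV_ln_nonzero[of t] t unfolding field_differentiable_def by blast
    then show ?thesis by (simp add: 0)
  next
    case (Suc m)
    have *: "(deriv ^^ m) inverse t = (deriv ^^ k) ln t" if "t \<in> - {0}" for t :: real
      unfolding Suc funpow_Suc_right o_apply
      by (rule iter_deriv_cong_open[OF open_nonzero that]) (simp add: deriv_ln_nonzero)
    have "(deriv ^^ m) inverse field_differentiable at t"
      using iter_diff_inverse t by (simp add: iter_diff_def)
    then obtain D where "((deriv ^^ m) inverse has_field_derivative D) (at t)"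
      unfolding field_differentiable_def by blast
    then have "((deriv ^^ k) ln has_field_derivative D) (at t)"
      by (rule has_field_derivative_transform_within_open[OF _ open_nonzero t *])
    then show ?thesis unfolding field_differentiable_def by blast
  qed
qed

text \<open>Both sides are sqrt t / t. This scalar identity is later lifted to \<rho> by
  \<open>gapply\<close>.\<close>

lemma sqrt_times_deriv_ln: "t \<noteq> 0 \<Longrightarrow> sqrt t * deriv ln t = 2 * deriv sqrt t" for t :: real
  using DERIV_imp_deriv[OF DERIV_sqrt_nonzero[of t]] by (simp add: deriv_ln_nonzero)

lemma gapply_eq:
  assumes "\<And>k. k > K \<Longrightarrow> soul a ^ k = 0"
  shows "gapply F a = (\<Sum>k\<le>K. taylor_coeff F k (body a) *\<^sub>R soul a ^ k)"
  unfolding gapply_def taylor_coeff_def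
proof (rule sum.mono_neutral_left)
  show "{k. soul a ^ k \<noteq> 0} \<subseteq> {..K}" using assms by (auto simp: not_less[symmetric])
qed auto

text \<open>Equivalent to finiteness of the index set of the sum that defines \<open>gapply\<close>;
  over an infinite set that sum would be 0 by convention.\<close>

definition gnilpotent :: "grassmann \<Rightarrow> bool" where
  "gnilpotent a \<longleftrightarrow> (\<exists>K. \<forall>k>K. soul a ^ k = 0)"

lemma gnilpotentI: "gsupp G a \<Longrightarrow> finite G \<Longrightarrow> gnilpotent a"
  unfolding gnilpotent_def using soul_power_eq_0 by blast

text \<open>One bound \<open>K\<close> serves all functions and all longer truncations, so different
  expansions at \<open>a\<close> can be compared term by term; \<open>K0\<close> lets a caller ask
  for enough terms.\<close>

lemma gapply_eq':
  assumes "gnilpotent a"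
  obtains K where "K \<ge> K0" "\<And>k. k > K \<Longrightarrow> soul a ^ k = 0"
    "\<And>F L. L \<ge> K \<Longrightarrow> gapply F a = (\<Sum>k\<le>L. taylor_coeff F k (body a) *\<^sub>R soul a ^ k)"
proof -
  obtain K where K: "\<And>k. k > K \<Longrightarrow> soul a ^ k = 0" using assms gnilpotent_def by blast
  show ?thesis
  proof (rule that[of "max K0 K"])
    show "gapply F a = (\<Sum>k\<le>L. taylor_coeff F k (body a) *\<^sub>R soul a ^ k)" if "L \<ge> max K0 K" for F L
      using that K by (intro gapply_eq) auto
  qed (auto intro: K)
qed

lemma gapply_cong:
  assumes "open A" "body a \<in> A" "\<And>t. t \<in> A \<Longrightarrow> F t = G t"
  shows "gapply F a = gapply G a"
  unfolding gapply_def using iter_deriv_cong_open[OF assms] by simp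

lemma gapply_times:
  assumes a: "gnilpotent a" and A: "open A" "body a \<in> A" and F: "iter_diff A F" and G: "iter_diff A G"
  shows "gapply (\<lambda>t. F t * G t) a = gapply F a * gapply G a"
proof -
  obtain K where K: "\<And>k. k > K \<Longrightarrow> soul a ^ k = 0"
    and eq: "\<And>F L. L \<ge> K \<Longrightarrow> gapply F a = (\<Sum>k\<le>L. taylor_coeff F k (body a) *\<^sub>R soul a ^ k)"
    using gapply_eq'[OF a, of 0] by metis
  let ?a = "\<lambda>F k. taylor_coeff F k (body a) *\<^sub>R soul a ^ k"
  have "gapply F a * gapply G a = (\<Sum>k\<le>2 * K. \<Sum>i\<le>k. ?a F i * ?a G (k - i))"
    unfolding eq[OF order_refl] by (rule finite_cauchy_product) (simp_all add: K)
  also have "\<dots> = (\<Sum>k\<le>2 * K. ?a (\<lambda>t. F t * G t) k)"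
  proof (rule sum.cong[OF refl])
    fix k
    have "(\<Sum>i\<le>k. ?a F i * ?a G (k - i))
        = (\<Sum>i\<le>k. (taylor_coeff F i (body a) * taylor_coeff G (k - i) (body a)) *\<^sub>R soul a ^ k)"
      by (rule sum.cong[OF refl]) (simp flip: power_add)
    then show "(\<Sum>i\<le>k. ?a F i * ?a G (k - i)) = ?a (\<lambda>t. F t * G t) k"
      by (simp add: taylor_coeff_times[OF A(1) F G A(2)] scaleR_sum_left)
  qed
  also have "\<dots> = gapply (\<lambda>t. F t * G t) a" by (rule eq[symmetric]) simp
  finally show ?thesis by simp
qed

lemma gapply_cmult_id:
  assumes "gnilpotent a" shows "gapply (\<lambda>t. c * t) a = c *\<^sub>R a"
proof -
  obtain K where K: "K \<ge> 1"
    and eq: "\<And>F L. L \<ge> K \<Longrightarrow> gapply F a = (\<Sum>k\<le>L. taylor_coeff F k (body a) *\<^sub>R soul a ^ k)"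
    using gapply_eq'[OF assms, of 1] by metis
  have "gapply (\<lambda>t. c * t) a = (\<Sum>k\<le>K. taylor_coeff (\<lambda>t. c * t) k (body a) *\<^sub>R soul a ^ k)"
    by (rule eq) simp
  also have "\<dots> = (\<Sum>k\<in>{0, 1}. taylor_coeff (\<lambda>t. c * t) k (body a) *\<^sub>R soul a ^ k)"
    using K by (intro sum.mono_neutral_right) (auto simp: taylor_coeff_def iter_deriv_cmult_id)
  also have "\<dots> = c *\<^sub>R (of_real (body a) + soul a)"
    by (simp add: taylor_coeff_def iter_deriv_cmult_id of_real_def scaleR_add_right)
  finally show ?thesis by (simp flip: body_plus_soul)
qed

lemma gapply_cmult:
  assumes "open A" "body a \<in> A" "iter_diff A F"
  shows "gapply (\<lambda>t. c * F t) a = c *\<^sub>R gapply F a"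
  unfolding gapply_def using iter_deriv_cmult[OF assms(1,3,2)] by (simp add: scaleR_sum_right)

lemma body_power [simp]: "body (a ^ k) = body a ^ k" by (induction k) simp_all

lemma body_gapply:
  assumes "gnilpotent a" shows "body (gapply F a) = F (body a)"
proof -
  obtain K where "gapply F a = (\<Sum>k\<le>K. taylor_coeff F k (body a) *\<^sub>R soul a ^ k)"
    using gapply_eq'[OF assms, of 0] by (metis order_refl)
  then have "body (gapply F a) = (\<Sum>k\<le>K. taylor_coeff F k (body a) * 0 ^ k)" by simp
  also have "\<dots> = (\<Sum>k\<le>K. if k = 0 then F (body a) else 0)"
    by (rule sum.cong) (auto simp: taylor_coeff_def)
  finally show ?thesis by simp
qed

text \<open>The k-th power of the soul starts in degree k. The truncation at \<open>card S\<close>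
  does not depend on \<open>a\<close>, so the formula can be differentiated termwise when
  \<open>a\<close> varies with a point.\<close>

lemma gcoeff_gapply:
  assumes "gnilpotent a"
  shows "gcoeff (gapply F a) S = (\<Sum>k\<le>card S. taylor_coeff F k (body a) * gcoeff (soul a ^ k) S)"
proof -
  obtain K where K: "K \<ge> card S"
    "gapply F a = (\<Sum>k\<le>K. taylor_coeff F k (body a) *\<^sub>R soul a ^ k)"
    using gapply_eq'[OF assms, of "card S"] by (metis order_refl)
  have "gcoeff (gapply F a) S = (\<Sum>k\<le>K. taylor_coeff F k (body a) * gcoeff (soul a ^ k) S)"
    by (simp add: K)
  also have "\<dots> = (\<Sum>k\<le>card S. taylor_coeff F k (body a) * gcoeff (soul a ^ k) S)"
  proof (rule sum.mono_neutral_right)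
    have "gvanish k (soul a ^ k)" for k by (intro gvanish_power gvanish_1) simp
    then show "\<forall>k\<in>{..K} - {..card S}. taylor_coeff F k (body a) * gcoeff (soul a ^ k) S = 0"
      by (auto simp: gvanish_def)
  qed (use K in auto)
  finally show ?thesis .
qed

lemma gsupp_gapply: "gsupp G a \<Longrightarrow> gsupp G (gapply F a)"
  unfolding gapply_def by (intro gsupp_sum gsupp_scaleR gsupp_power gsupp_soul)

lemma gderiv_power_even:
  assumes "gparity 0 a" shows "gderiv i (a ^ k) = real k *\<^sub>R (a ^ (k - 1) * gderiv i a)"
proof (induction k)
  case 0
  show ?case using gderiv_of_real[of i 1] by simp
next
  case (Suc k)
  have "gderiv i (a ^ Suc k) = gderiv i a * a ^ k + a * (real k *\<^sub>R (a ^ (k - 1) * gderiv i a))"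
    by (simp add: gderiv_times_even[OF assms] Suc)
  also have "gderiv i a * a ^ k = a ^ k * gderiv i a"
    by (rule power_commuting_commutes[symmetric]) (rule gparity_even_commute[OF assms])
  also have "a * (real k *\<^sub>R (a ^ (k - 1) * gderiv i a)) = real k *\<^sub>R (a ^ k * gderiv i a)"
    by (cases k) (simp_all add: mult.assoc)
  finally show ?case by (simp add: scaleR_add_left)
qed

lemma gderiv_gapply:
  assumes a: "gnilpotent a" and even: "gparity 0 a"
  shows "gderiv i (gapply F a) = gapply (deriv F) a * gderiv i a"
proof -
  obtain K where
    eq: "\<And>F L. L \<ge> K \<Longrightarrow> gapply F a = (\<Sum>k\<le>L. taylor_coeff F k (body a) *\<^sub>R soul a ^ k)"
    using gapply_eq'[OF a, of 0] by metis
  have s: "gderiv i (soul a) = gderiv i a" by (simp add: soul_def gderiv_minus)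
  have "gderiv i (gapply F a)
      = (\<Sum>k\<le>Suc K. taylor_coeff F k (body a) *\<^sub>R real k *\<^sub>R (soul a ^ (k - 1) * gderiv i a))"
    by (subst eq[of "Suc K"])
       (simp_all only: gderiv_sum gderiv_scaleR gderiv_power_even[OF gparity_soul[OF even]] s le_Suc_eq order_refl simp_thms)
  also have "\<dots> = (\<Sum>k\<le>K. (taylor_coeff (deriv F) k (body a) *\<^sub>R soul a ^ k) * gderiv i a)"
    by (subst sum.atMost_Suc_shift) (simp add: taylor_coeff_deriv mult.commute del: of_nat_Suc)
  also have "\<dots> = gapply (deriv F) a * gderiv i a"
    by (simp add: eq[OF order_refl] sum_distrib_right)
  finally show ?thesis .
qed

lemma iter_diff_mono: "iter_diff B F \<Longrightarrow> A \<subseteq> B \<Longrightarrow> iter_diff A F"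
  unfolding iter_diff_def by blast

text \<open>On the half-line \<open>s * t > 0\<close> the extended square root satisfies (sqrt t)^2
  = |t| = s t, and multiplicativity of \<open>gapply\<close> carries this over to
  \<open>a\<close>.\<close>

lemma gapply_sqrt_square:
  assumes "gnilpotent a" "s * body a > 0" "\<bar>s\<bar> = 1"
  shows "gapply sqrt a * gapply sqrt a = s *\<^sub>R a"
proof -
  have A: "open {t::real. s * t > 0}" by (intro open_Collect_less continuous_intros)
  have "iter_diff {t. s * t > 0} sqrt"
    using iter_diff_sqrt by (rule iter_diff_mono) auto
  then have "gapply sqrt a * gapply sqrt a = gapply (\<lambda>t. sqrt t * sqrt t) a"
    using assms A by (intro gapply_times[symmetric, where A = "{t. s * t > 0}"]) auto
  also have "\<dots> = gapply (\<lambda>t. s * t) a"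
    by (rule gapply_cong[OF A])
       (use assms in \<open>auto simp: abs_if zero_less_mult_iff split: if_splits\<close>)
  finally show ?thesis using assms by (simp add: gapply_cmult_id)
qed

lemma gapply_sqrt_deriv_ln:
  assumes "gnilpotent a" "body a \<noteq> 0"
  shows "gapply sqrt a * gapply (deriv ln) a = 2 *\<^sub>R gapply (deriv sqrt) a"
proof -
  note A = open_nonzero
  have b: "body a \<in> - {0}" using assms by simp
  have "gapply sqrt a * gapply (deriv ln) a = gapply (\<lambda>t. sqrt t * deriv ln t) a"
    by (intro gapply_times[symmetric, OF assms(1) A b] iter_diff_sqrt iter_diff_deriv iter_diff_ln)
  also have "\<dots> = gapply (\<lambda>t. 2 * deriv sqrt t) a"
    by (rule gapply_cong[OF A b]) (simp add: sqrt_times_deriv_ln)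
  also have "\<dots> = 2 *\<^sub>R gapply (deriv sqrt) a"
    by (rule gapply_cmult[OF A b]) (intro iter_diff_deriv iter_diff_sqrt)
  finally show ?thesis .
qed

section \<open>Substitution of odd elements\<close>

definition odd_monomial :: "(nat \<Rightarrow> grassmann) \<Rightarrow> nat set \<Rightarrow> grassmann" where
  "odd_monomial c S = prod_list (map c (sorted_list_of_set S))"

lemma odd_monomial_empty [simp]: "odd_monomial c {} = 1" by (simp add: odd_monomial_def)

lemma odd_monomial_insert_min:
  assumes "finite S" "\<And>s. s \<in> S \<Longrightarrow> i < s"
  shows "odd_monomial c (insert i S) = c i * odd_monomial c S"
proof -
  have "i \<notin> S" using assms(2) by blast
  then have "sorted_list_of_set (insert i S) = i # sorted_list_of_set S"
    using assms by (subst sorted_list_of_set_insert) (auto simp: insort_is_Cons less_imp_le)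
  then show ?thesis by (simp add: odd_monomial_def)
qed

text \<open>Moving \<open>c i\<close> to its place passes the factors of smaller index, one sign
  each, and a repeated odd factor squares to 0. The induction inserts minima, since the least index
  heads the monomial.\<close>

lemma odd_times_monomial:
  assumes c: "\<And>i. gparity 1 (c i)" and "finite T"
  shows "c i * odd_monomial c T
    = (if i \<in> T then 0 else (-1) ^ card {t\<in>T. t < i} *\<^sub>R odd_monomial c (insert i T))"
  using \<open>finite T\<close>
proof (induction T rule: finite_linorder_min_induct)
  case empty
  show ?case using odd_monomial_insert_min[of "{}" i c] by simp
next
  case (insert b A)
  have m: "odd_monomial c (insert b A) = c b * odd_monomial c A"
    using insert by (intro odd_monomial_insert_min) auto
  consider "i = b" | "i < b" | "b < i" by linarith
  then show ?case
  proof cases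
    case 1
    then show ?thesis by (simp add: m gparity_odd_square[OF c] flip: mult.assoc)
  next
    case 2
    then have "i \<notin> insert b A" and e: "{t \<in> insert b A. t < i} = {}"
      using insert by (auto dest: less_trans)
    moreover have "odd_monomial c (insert i (insert b A)) = c i * odd_monomial c (insert b A)"
      using 2 insert by (intro odd_monomial_insert_min) (auto dest: less_trans)
    ultimately show ?thesis by (simp only: e) simp
  next
    case 3
    have "{t \<in> insert b A. t < i} = insert b {t\<in>A. t < i}" using 3 by auto
    moreover have "b \<notin> {t\<in>A. t < i}" using insert by auto
    ultimately have card: "card {t \<in> insert b A. t < i} = Suc (card {t\<in>A. t < i})"
      using insert by simp
    have "c i * odd_monomial c (insert b A) = - (c b * (c i * odd_monomial c A))"
      by (simp add: m gparity_odd_anticommute[OF c c, of i b] flip: mult.assoc)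
    also have "\<dots> = (if i \<in> A then 0 else (-1) ^ Suc (card {t\<in>A. t < i}) *\<^sub>R (c b * odd_monomial c (insert i A)))"
      by (simp add: insert.IH)
    also have "c b * odd_monomial c (insert i A) = odd_monomial c (insert i (insert b A))"
      using 3 insert by (subst insert_commute, subst odd_monomial_insert_min) auto
    finally show ?thesis unfolding card using 3 by simp
  qed
qed

text \<open>Any family of odd elements obeys the multiplication table of the generators. This is why
  \<open>gsubst\<close> is multiplicative.\<close>

lemma odd_monomial_times:
  assumes c: "\<And>i. gparity 1 (c i)" and "finite S" and T: "finite T"
  shows "odd_monomial c S * odd_monomial c T
    = (if S \<inter> T = {} then gsign S T *\<^sub>R odd_monomial c (S \<union> T) else 0)"
  using \<open>finite S\<close>
proof (induction S rule: finite_linorder_min_induct)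
  case empty
  show ?case by simp
next
  case (insert b A)
  have b: "b \<notin> A" using insert by auto
  have m: "odd_monomial c (insert b A) = c b * odd_monomial c A"
    using insert by (intro odd_monomial_insert_min) auto
  have "{(t, u). t \<in> {b} \<and> u \<in> T \<and> u < t} = Pair b ` {t\<in>T. t < b}" by auto
  then have "gsign {b} T = (-1) ^ card {t\<in>T. t < b}"
    by (simp add: gsign_def card_image inj_on_def)
  then have g: "gsign (insert b A) T = (-1) ^ card {t\<in>T. t < b} * gsign A T"
    using gsign_Un_left[of "{b}" A T] insert T b by simp
  have e: "{t \<in> A \<union> T. t < b} = {t\<in>T. t < b}" using insert by auto
  have cb: "c b * odd_monomial c (A \<union> T)
      = (if b \<in> A \<union> T then 0 else (-1) ^ card {t\<in>T. t < b} *\<^sub>R odd_monomial c (insert b (A \<union> T)))"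
    unfolding e[symmetric] by (rule odd_times_monomial[OF c]) (use insert T in auto)
  have "odd_monomial c (insert b A) * odd_monomial c T
      = c b * (if A \<inter> T = {} then gsign A T *\<^sub>R odd_monomial c (A \<union> T) else 0)"
    by (simp only: m mult.assoc insert.IH)
  also have "\<dots> = (if insert b A \<inter> T = {} then gsign (insert b A) T *\<^sub>R odd_monomial c (insert b A \<union> T) else 0)"
    using b by (simp add: cb g)
  finally show ?case .
qed

lemma body_odd_monomial:
  assumes "\<And>i. body (c i) = 0" "finite S" "S \<noteq> {}" shows "body (odd_monomial c S) = 0"
proof -
  have "sorted_list_of_set S \<noteq> []" using assms by simp
  then show ?thesis unfolding odd_monomial_def
    by (cases "sorted_list_of_set S") (simp_all add: assms)
qed

lemma gsupp_odd_monomial: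
  assumes "\<And>i. i \<in> S \<Longrightarrow> gsupp G (c i)" shows "gsupp G (odd_monomial c S)"
proof (cases "finite S")
  case True
  then show ?thesis unfolding odd_monomial_def using assms by (intro gsupp_prod_list) auto
qed (simp add: odd_monomial_def)

lemma gsubst_eq:
  assumes "finite G" "gsupp G a"
  shows "gsubst I \<theta> a = (\<Sum>S\<in>Pow G. gcoeff a S *\<^sub>R odd_monomial (\<lambda>i. if i \<in> I then \<theta> i else gen i) S)"
  unfolding gsubst_def odd_monomial_def
  by (rule sum.mono_neutral_left) (use assms in \<open>auto simp: gsupp_def\<close>)

lemma gsubst_zero [simp]: "gsubst I \<theta> 0 = 0" by (simp add: gsubst_def)

lemma gsubst_of_real: "gsubst I \<theta> (of_real r) = of_real r"
  using gsubst_eq[of "{}" "of_real r" I \<theta>] by (simp add: gcoeff_of_real) (simp add: of_real_def)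

lemma gsubst_plus:
  assumes "finite G" "gsupp G a" "gsupp G b"
  shows "gsubst I \<theta> (a + b) = gsubst I \<theta> a + gsubst I \<theta> b"
  using assms by (simp add: gsubst_eq[of G] gsupp_plus scaleR_add_left sum.distrib)

text \<open>The left side is a sum over pairs T \<subseteq> S, which U = S - T turns into disjoint
  pairs \<open>T\<close>, \<open>U\<close>. Overlapping pairs contribute 0 on the right side, so
  there the sum may run over all pairs of subsets of \<open>G\<close>.\<close>

lemma gsubst_times:
  assumes G: "finite G" "gsupp G a" "gsupp G b" and \<theta>: "\<And>i. i \<in> I \<Longrightarrow> gparity 1 (\<theta> i)"
  shows "gsubst I \<theta> (a * b) = gsubst I \<theta> a * gsubst I \<theta> b"
proof -
  let ?m = "odd_monomial (\<lambda>i. if i \<in> I then \<theta> i else gen i)"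
  have c: "gparity 1 (if i \<in> I then \<theta> i else gen i)" for i using \<theta> gparity_gen by simp
  have fin: "finite S" if "S \<subseteq> G" for S using that G(1) by (rule finite_subset)
  have "gsubst I \<theta> (a * b)
      = (\<Sum>S\<in>Pow G. \<Sum>T\<in>Pow S. (gsign T (S - T) * gcoeff a T * gcoeff b (S - T)) *\<^sub>R ?m S)"
    using G by (simp add: gsubst_eq[of G] gsupp_times gcoeff_times scaleR_sum_left)
  also have "\<dots> = (\<Sum>(S, T)\<in>Sigma (Pow G) Pow. (gsign T (S - T) * gcoeff a T * gcoeff b (S - T)) *\<^sub>R ?m S)"
    by (rule sum.Sigma) (use G fin in auto)
  also have "\<dots> = (\<Sum>(T, U)\<in>Sigma (Pow G) (\<lambda>T. Pow (G - T)). (gsign T U * gcoeff a T * gcoeff b U) *\<^sub>R ?m (T \<union> U))"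
    by (rule sum.reindex_bij_witness[where i = "\<lambda>(T, U). (T \<union> U, T)" and j = "\<lambda>(S, T). (T, S - T)"])
       (auto simp: Un_absorb1)
  also have "\<dots> = (\<Sum>T\<in>Pow G. \<Sum>U\<in>Pow (G - T). (gsign T U * gcoeff a T * gcoeff b U) *\<^sub>R ?m (T \<union> U))"
    by (rule sum.Sigma[symmetric]) (use G in auto)
  also have "\<dots> = (\<Sum>T\<in>Pow G. \<Sum>U\<in>Pow G. (gcoeff a T *\<^sub>R ?m T) * (gcoeff b U *\<^sub>R ?m U))"
  proof (rule sum.cong[OF refl])
    fix T assume T: "T \<in> Pow G"
    have "(\<Sum>U\<in>Pow (G - T). (gsign T U * gcoeff a T * gcoeff b U) *\<^sub>R ?m (T \<union> U))
        = (\<Sum>U\<in>Pow (G - T). (gcoeff a T *\<^sub>R ?m T) * (gcoeff b U *\<^sub>R ?m U))"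
    proof (rule sum.cong[OF refl])
      fix U assume U: "U \<in> Pow (G - T)"
      then have "T \<inter> U = {}" "finite T" "finite U" using T fin by auto
      then show "(gsign T U * gcoeff a T * gcoeff b U) *\<^sub>R ?m (T \<union> U)
          = (gcoeff a T *\<^sub>R ?m T) * (gcoeff b U *\<^sub>R ?m U)"
        by (simp add: odd_monomial_times[OF c] mult_ac)
    qed
    also have "\<dots> = (\<Sum>U\<in>Pow G. (gcoeff a T *\<^sub>R ?m T) * (gcoeff b U *\<^sub>R ?m U))"
    proof (rule sum.mono_neutral_left)
      show "\<forall>U\<in>Pow G - Pow (G - T). (gcoeff a T *\<^sub>R ?m T) * (gcoeff b U *\<^sub>R ?m U) = 0"
      proof
        fix U assume U: "U \<in> Pow G - Pow (G - T)"
        then have "T \<inter> U \<noteq> {}" "finite T" "finite U" using T fin by auto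
        then show "(gcoeff a T *\<^sub>R ?m T) * (gcoeff b U *\<^sub>R ?m U) = 0"
          by (simp add: odd_monomial_times[OF c])
      qed
    qed (use G in auto)
    finally show "(\<Sum>U\<in>Pow (G - T). (gsign T U * gcoeff a T * gcoeff b U) *\<^sub>R ?m (T \<union> U))
        = (\<Sum>U\<in>Pow G. (gcoeff a T *\<^sub>R ?m T) * (gcoeff b U *\<^sub>R ?m U))" .
  qed
  also have "\<dots> = gsubst I \<theta> a * gsubst I \<theta> b"
    using G by (simp only: gsubst_eq[of G] sum_product)
  finally show ?thesis .
qed

lemma body_gsubst:
  assumes "finite G" "gsupp G a" "\<And>i. i \<in> I \<Longrightarrow> gparity 1 (\<theta> i)"
  shows "body (gsubst I \<theta> a) = body a"
proof -
  let ?c = "\<lambda>i. if i \<in> I then \<theta> i else gen i"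
  have c: "body (?c i) = 0" for i
    by (rule body_gparity_odd[of 1]) (use assms(3) gparity_gen in auto)
  have "body (gsubst I \<theta> a) = (\<Sum>S\<in>Pow G. gcoeff a S * body (odd_monomial ?c S))"
    using assms by (simp add: gsubst_eq[of G])
  also have "\<dots> = (\<Sum>S\<in>Pow G. if S = {} then body a else 0)"
  proof (rule sum.cong[OF refl])
    fix S assume "S \<in> Pow G"
    then have "finite S" using assms(1) by (auto intro: finite_subset)
    then show "gcoeff a S * body (odd_monomial ?c S) = (if S = {} then body a else 0)"
      using body_odd_monomial[OF c, of S] by (simp add: body_def[of a])
  qed
  finally show ?thesis using assms(1) by simp
qed

lemma gsupp_gsubst:
  assumes "finite G" "gsupp G a" "\<And>i. i \<in> G \<Longrightarrow> gsupp G' (if i \<in> I then \<theta> i else gen i)"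
  shows "gsupp G' (gsubst I \<theta> a)"
proof -
  have "gsupp G' (odd_monomial (\<lambda>i. if i \<in> I then \<theta> i else gen i) S)" if "S \<in> Pow G" for S
    using that by (intro gsupp_odd_monomial assms(3)) auto
  then show ?thesis
    unfolding gsubst_eq[OF assms(1,2)] by (intro gsupp_sum gsupp_scaleR)
qed

lemma prod_list_zero_mem: "0 \<in> set xs \<Longrightarrow> prod_list xs = (0 :: 'a::semiring_1)"
  by (induction xs) auto

lemma gsubst_insert_zero:
  assumes "finite G" "gsupp G a" "\<theta> i = 0" "i \<notin> I"
  shows "gsubst (insert i I) \<theta> a = gsubst I \<theta> (gkill i a)"
proof -
  have "gsupp G (gkill i a)" using assms by (auto simp: gsupp_def gcoeff_gkill)
  moreover have "gcoeff a S *\<^sub>R odd_monomial (\<lambda>j. if j \<in> insert i I then \<theta> j else gen j) S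
      = gcoeff (gkill i a) S *\<^sub>R odd_monomial (\<lambda>j. if j \<in> I then \<theta> j else gen j) S" if "S \<in> Pow G" for S
  proof (cases "i \<in> S")
    case True
    have "finite S" using that assms by (auto intro: finite_subset)
    then have "0 \<in> set (map (\<lambda>j. if j \<in> insert i I then \<theta> j else gen j) (sorted_list_of_set S))"
      using True assms(3) by force
    then have "odd_monomial (\<lambda>j. if j \<in> insert i I then \<theta> j else gen j) S = 0"
      unfolding odd_monomial_def by (rule prod_list_zero_mem)
    then show ?thesis using True by (simp add: gcoeff_gkill)
  next
    case False
    have "finite S" using that assms by (auto intro: finite_subset)
    then have "map (\<lambda>j. if j \<in> insert i I then \<theta> j else gen j) (sorted_list_of_set S)
        = map (\<lambda>j. if j \<in> I then \<theta> j else gen j) (sorted_list_of_set S)"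
      using False by auto
    then show ?thesis using False by (simp only: odd_monomial_def gcoeff_gkill if_False)
  qed
  ultimately show ?thesis
    using assms by (simp only: gsubst_eq[of G] cong: sum.cong)
qed

section \<open>Smooth superfunctions\<close>

abbreviation pder :: "nat \<Rightarrow> ((nat \<Rightarrow> real) \<Rightarrow> real) \<Rightarrow> (nat \<Rightarrow> real) \<Rightarrow> real" where
  "pder i f \<equiv> \<lambda>x. deriv (\<lambda>t. f (x(i := t))) (x i)"

text \<open>The differentiability content of \<open>Ck_on\<close> along coordinate lines, for which
  closure under products and composition is one-variable calculus.\<close>

primrec pdiffs :: "nat \<Rightarrow> nat set \<Rightarrow> (nat \<Rightarrow> real) set \<Rightarrow> ((nat \<Rightarrow> real) \<Rightarrow> real) \<Rightarrow> bool" where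
  "pdiffs 0 I U f \<longleftrightarrow> True"
| "pdiffs (Suc k) I U f \<longleftrightarrow>
     (\<forall>i\<in>I. (\<forall>x\<in>U. (\<lambda>t. f (x(i := t))) field_differentiable at (x i)) \<and> pdiffs k I U (pder i f))"

lemma Ck_on_imp_pdiffs: "Ck_on k I U f \<Longrightarrow> pdiffs k I U f"
  by (induction k arbitrary: f) simp_all

lemma pdiffs_mono: "pdiffs (Suc k) I U f \<Longrightarrow> pdiffs k I U f"
  by (induction k arbitrary: f) simp_all

lemma pdiffs_pder: "pdiffs (Suc k) I U f \<Longrightarrow> i \<in> I \<Longrightarrow> pdiffs k I U (pder i f)"
  by simp

lemma pdiffs_subset: "pdiffs k I U f \<Longrightarrow> V \<subseteq> U \<Longrightarrow> pdiffs k I V f"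
  by (induction k arbitrary: f) auto

text \<open>Parity is left out and tracked separately by \<open>gparity\<close>, so that one class
  is stable under products, odd derivatives and Taylor expansion.\<close>

definition smooth_sfun :: "nat set \<Rightarrow> nat set \<Rightarrow> (nat \<Rightarrow> real) set \<Rightarrow> sfun \<Rightarrow> bool" where
  "smooth_sfun I G U f \<longleftrightarrow>
     (\<forall>S k. pdiffs k I U (\<lambda>x. gcoeff (f x) S)) \<and> (\<forall>x\<in>U. gsupp G (f x))"

lemma superfunction_imp_smooth: "superfunction I G U p f \<Longrightarrow> smooth_sfun I G U f"
  unfolding superfunction_def smooth_sfun_def gsupp_def by (auto intro: Ck_on_imp_pdiffs)

lemma superfunction_gparity: "superfunction I G U p f \<Longrightarrow> x \<in> U \<Longrightarrow> gparity p (f x)"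
  unfolding superfunction_def gparity_def by blast

lemma superfunction_gsupp: "superfunction I G U p f \<Longrightarrow> x \<in> U \<Longrightarrow> gsupp G (f x)"
  unfolding superfunction_def gsupp_def by blast

lemma smooth_sfun_subset: "smooth_sfun I G U f \<Longrightarrow> V \<subseteq> U \<Longrightarrow> smooth_sfun I G V f"
  unfolding smooth_sfun_def using pdiffs_subset by blast

lemma gcoeff_pd_Ev: "gcoeff (pd (Ev i) f x) S = pder i (\<lambda>x. gcoeff (f x) S) x"
proof -
  have "pder i (\<lambda>x. gcoeff (f x) T) x = 0" if "infinite T" for T
    using that by (simp add: gcoeff_infinite)
  then show ?thesis by (simp add: Abs_grassmann_inverse)
qed

lemma continuous_on_fun_upd_line: "continuous_on UNIV (\<lambda>t. (x::nat \<Rightarrow> real)(i := t))"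
proof (rule continuous_on_coordinatewise_then_product)
  show "continuous_on UNIV (\<lambda>t. (x(i := t)) j)" for j by (cases "j = i") auto
qed

locale superdomain =
  fixes I G :: "nat set" and U :: "(nat \<Rightarrow> real) set"
  assumes dom: "domain_in I U" and fin_I: "finite I" and fin_G: "finite G"
begin

text \<open>A coordinate direction \<open>i \<in> I\<close> stays in \<open>coord_space I\<close>,
  so relative openness gives a full neighbourhood on the line. Hence derivatives at points of
  \<open>U\<close> see only values on \<open>U\<close>.\<close>

lemma line_in_domain:
  assumes x: "x \<in> U" and i: "i \<in> I"
  shows "eventually (\<lambda>t. x(i := t) \<in> U) (nhds (x i))"
proof -
  obtain W where W: "open W" "U = coord_space I \<inter> W"
    using dom unfolding domain_in_def openin_open by blast
  have "open ((\<lambda>t. x(i := t)) -` W)"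
    using open_vimage[OF W(1) continuous_on_fun_upd_line] .
  moreover have "x i \<in> (\<lambda>t. x(i := t)) -` W" using x W by simp
  moreover have "x(i := t) \<in> U" if "t \<in> (\<lambda>t. x(i := t)) -` W" for t
    using that x W i by (auto simp: coord_space_def)
  ultimately show ?thesis unfolding eventually_nhds by blast
qed

lemma line_cong:
  assumes "x \<in> U" "i \<in> I" "\<And>x. x \<in> U \<Longrightarrow> f x = g x"
  shows "eventually (\<lambda>t. f (x(i := t)) = g (x(i := t))) (nhds (x i))"
  using line_in_domain[OF assms(1,2)] by eventually_elim (rule assms(3))

lemma pder_cong:
  assumes "x \<in> U" "i \<in> I" "\<And>x. x \<in> U \<Longrightarrow> f x = g x"
  shows "pder i f x = pder i g x"
  by (rule deriv_cong_ev[OF line_cong[OF assms] refl])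

lemma pdiffs_cong:
  assumes "pdiffs k I U f" "\<And>x. x \<in> U \<Longrightarrow> f x = g x" shows "pdiffs k I U g"
  using assms
proof (induction k arbitrary: f g)
  case (Suc k)
  show ?case
  proof (clarsimp, intro conjI ballI)
    fix i x assume i: "i \<in> I" and x: "x \<in> U"
    have "(\<lambda>t. f (x(i := t))) field_differentiable at (x i)" using Suc.prems i x by simp
    then show "(\<lambda>t. g (x(i := t))) field_differentiable at (x i)"
      unfolding field_differentiable_def
      using DERIV_cong_ev[OF refl line_cong[where f = f and g = g, OF x i Suc.prems(2)] refl] by simp
  next
    fix i assume i: "i \<in> I"
    show "pdiffs k I U (pder i g)"
      by (rule Suc.IH[OF pdiffs_pder[OF Suc.prems(1) i]]) (rule pder_cong[OF _ i Suc.prems(2)])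
  qed
qed simp

lemma pdiffs_DERIV:
  assumes "pdiffs (Suc k) I U f" "i \<in> I" "x \<in> U"
  shows "((\<lambda>t. f (x(i := t))) has_field_derivative pder i f x) (at (x i))"
  using assms by (simp add: DERIV_deriv_iff_field_differentiable)

lemma pdiffs_SucI:
  assumes "\<And>i x. i \<in> I \<Longrightarrow> x \<in> U \<Longrightarrow> ((\<lambda>t. f (x(i := t))) has_field_derivative f' i x) (at (x i))"
    and "\<And>i. i \<in> I \<Longrightarrow> pdiffs k I U (f' i)"
  shows "pdiffs (Suc k) I U f"
proof -
  have "pdiffs k I U (pder i f)" if i: "i \<in> I" for i
    by (rule pdiffs_cong[OF assms(2)[OF i]]) (simp add: DERIV_imp_deriv[OF assms(1)[OF i]])
  then show ?thesis using assms(1) by (auto simp: field_differentiable_def)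
qed

lemma pdiffs_const: "pdiffs k I U (\<lambda>x. c)"
  by (induction k arbitrary: c) simp_all

lemma pdiffs_add:
  "pdiffs k I U f \<Longrightarrow> pdiffs k I U g \<Longrightarrow> pdiffs k I U (\<lambda>x. f x + g x)"
proof (induction k arbitrary: f g)
  case (Suc k)
  show ?case
  proof (rule pdiffs_SucI)
    fix i x assume "i \<in> I" "x \<in> U"
    then show "((\<lambda>t. f (x(i := t)) + g (x(i := t))) has_field_derivative pder i f x + pder i g x) (at (x i))"
      by (intro DERIV_add pdiffs_DERIV[OF Suc.prems(1)] pdiffs_DERIV[OF Suc.prems(2)])
  next
    fix i assume "i \<in> I"
    then show "pdiffs k I U (\<lambda>x. pder i f x + pder i g x)"
      by (intro Suc.IH pdiffs_pder[OF Suc.prems(1)] pdiffs_pder[OF Suc.prems(2)])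
  qed
qed simp

lemma pdiffs_mult:
  "pdiffs k I U f \<Longrightarrow> pdiffs k I U g \<Longrightarrow> pdiffs k I U (\<lambda>x. f x * g x)"
proof (induction k arbitrary: f g)
  case (Suc k)
  show ?case
  proof (rule pdiffs_SucI)
    fix i x assume "i \<in> I" "x \<in> U"
    then have "((\<lambda>t. f (x(i := t)) * g (x(i := t))) has_field_derivative
        pder i f x * g (x(i := x i)) + pder i g x * f (x(i := x i))) (at (x i))"
      by (intro DERIV_mult pdiffs_DERIV[OF Suc.prems(1)] pdiffs_DERIV[OF Suc.prems(2)])
    then show "((\<lambda>t. f (x(i := t)) * g (x(i := t))) has_field_derivative
        pder i f x * g x + pder i g x * f x) (at (x i))" by simp
  next
    fix i assume "i \<in> I"
    then show "pdiffs k I U (\<lambda>x. pder i f x * g x + pder i g x * f x)"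
      by (intro pdiffs_add Suc.IH pdiffs_pder[OF Suc.prems(1)] pdiffs_pder[OF Suc.prems(2)]
          pdiffs_mono[OF Suc.prems(1)] pdiffs_mono[OF Suc.prems(2)])
  qed
qed simp

lemma pdiffs_sum:
  "(\<And>j. j \<in> A \<Longrightarrow> pdiffs k I U (f j)) \<Longrightarrow> pdiffs k I U (\<lambda>x. \<Sum>j\<in>A. f j x)"
  by (induction A rule: infinite_finite_induct) (auto intro: pdiffs_const pdiffs_add)

text \<open>Stated for every iterate \<open>m\<close>, because the derivative of the composite
  contains the next iterate of \<open>F\<close>.\<close>

lemma pdiffs_compose:
  assumes F: "iter_diff A F" and f: "\<And>x. x \<in> U \<Longrightarrow> f x \<in> A"
  shows "pdiffs k I U f \<Longrightarrow> pdiffs k I U (\<lambda>x. (deriv ^^ m) F (f x))"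
proof (induction k arbitrary: m)
  case (Suc k)
  show ?case
  proof (rule pdiffs_SucI)
    fix i x assume ix: "i \<in> I" "x \<in> U"
    have "((deriv ^^ m) F has_field_derivative (deriv ^^ Suc m) F (f x)) (at (f (x(i := x i))))"
      using F f[OF ix(2)] by (simp add: iter_diff_def DERIV_deriv_iff_field_differentiable)
    from DERIV_chain2[OF this pdiffs_DERIV[OF Suc.prems ix]]
    show "((\<lambda>t. (deriv ^^ m) F (f (x(i := t)))) has_field_derivative
        (deriv ^^ Suc m) F (f x) * pder i f x) (at (x i))" .
  next
    fix i assume "i \<in> I"
    then show "pdiffs k I U (\<lambda>x. (deriv ^^ Suc m) F (f x) * pder i f x)"
      by (intro pdiffs_mult Suc.IH pdiffs_mono[OF Suc.prems] pdiffs_pder[OF Suc.prems])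
  qed
qed simp

lemma smooth_supp: "smooth_sfun I G U f \<Longrightarrow> x \<in> U \<Longrightarrow> gsupp G (f x)"
  by (simp add: smooth_sfun_def)

lemma smooth_DERIV:
  assumes "smooth_sfun I G U f" "i \<in> I" "x \<in> U"
  shows "((\<lambda>t. gcoeff (f (x(i := t))) S) has_field_derivative gcoeff (pd (Ev i) f x) S) (at (x i))"
  unfolding gcoeff_pd_Ev
  by (rule pdiffs_DERIV[where k = 0]) (use assms in \<open>simp_all only: smooth_sfun_def\<close>)

lemma pd_Ev_cong:
  assumes "x \<in> U" "i \<in> I" "\<And>x. x \<in> U \<Longrightarrow> f x = g x"
  shows "pd (Ev i) f x = pd (Ev i) g x"
  by (rule grassmann_eqI) (use assms in \<open>simp only: gcoeff_pd_Ev pder_cong[of x i "\<lambda>x. gcoeff (f x) _" "\<lambda>x. gcoeff (g x) _"]\<close>)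

lemma pd_Ev_const_on:
  assumes "x \<in> U" "i \<in> I" "\<And>x. x \<in> U \<Longrightarrow> f x = c"
  shows "pd (Ev i) f x = 0"
proof -
  have "pd (Ev i) f x = pd (Ev i) (\<lambda>_. c) x" by (rule pd_Ev_cong[OF assms])
  also have "\<dots> = 0" by (rule grassmann_eqI) (simp only: gcoeff_pd_Ev deriv_const gcoeff_zero)
  finally show ?thesis .
qed

lemma gcoeff_pd_Ev_zero:
  assumes "x \<in> U" "i \<in> I" "\<And>x. x \<in> U \<Longrightarrow> gcoeff (f x) S = 0"
  shows "gcoeff (pd (Ev i) f x) S = 0"
proof -
  have "pder i (\<lambda>x. gcoeff (f x) S) x = pder i (\<lambda>_. 0) x" by (rule pder_cong[OF assms])
  then show ?thesis by (simp only: gcoeff_pd_Ev deriv_const)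
qed

lemma smooth_pd_Ev:
  assumes f: "smooth_sfun I G U f" and i: "i \<in> I"
  shows "smooth_sfun I G U (pd (Ev i) f)"
  unfolding smooth_sfun_def
proof (intro conjI allI ballI)
  fix S k
  have "pdiffs (Suc k) I U (\<lambda>x. gcoeff (f x) S)" using f by (simp only: smooth_sfun_def)
  then show "pdiffs k I U (\<lambda>x. gcoeff (pd (Ev i) f x) S)" using i by (simp only: gcoeff_pd_Ev pdiffs.simps)
next
  fix x assume x: "x \<in> U"
  have "gcoeff (pd (Ev i) f x) S = 0" if "\<not> S \<subseteq> G" for S
    by (rule gcoeff_pd_Ev_zero[OF x i]) (use f that in \<open>unfold smooth_sfun_def gsupp_def, blast\<close>)
  then show "gsupp G (pd (Ev i) f x)" unfolding gsupp_def by blast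
qed

lemma smooth_const: "gsupp G c \<Longrightarrow> smooth_sfun I G U (\<lambda>x. c)"
  by (simp add: smooth_sfun_def pdiffs_const)

lemma smooth_times:
  "smooth_sfun I G U f \<Longrightarrow> smooth_sfun I G U g \<Longrightarrow> smooth_sfun I G U (\<lambda>x. f x * g x)"
  unfolding smooth_sfun_def gcoeff_times
  by (auto intro!: pdiffs_sum pdiffs_mult pdiffs_const gsupp_times)

lemma smooth_gderiv: "smooth_sfun I G U f \<Longrightarrow> smooth_sfun I G U (\<lambda>x. gderiv i (f x))"
  unfolding smooth_sfun_def
proof (elim conjE, intro conjI allI)
  fix S k assume "\<forall>S k. pdiffs k I U (\<lambda>x. gcoeff (f x) S)"
  then show "pdiffs k I U (\<lambda>x. gcoeff (gderiv i (f x)) S)"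
    by (cases "i \<in> S") (simp_all add: gcoeff_gderiv pdiffs_const pdiffs_mult)
qed (simp add: gsupp_gderiv)

lemma smooth_power: "smooth_sfun I G U f \<Longrightarrow> smooth_sfun I G U (\<lambda>x. f x ^ k)"
  by (induction k) (auto intro: smooth_times smooth_const)

lemma smooth_soul:
  assumes "smooth_sfun I G U f" shows "smooth_sfun I G U (\<lambda>x. soul (f x))"
  unfolding smooth_sfun_def
proof (intro conjI allI ballI)
  fix S k
  show "pdiffs k I U (\<lambda>x. gcoeff (soul (f x)) S)"
    using assms
    by (cases "S = {}") (simp_all add: soul_def gcoeff_of_real body_def pdiffs_const smooth_sfun_def)
qed (use assms in \<open>auto simp: smooth_sfun_def intro: gsupp_soul\<close>)

lemma smooth_nilpotent: "smooth_sfun I G U f \<Longrightarrow> x \<in> U \<Longrightarrow> gnilpotent (f x)"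
  by (rule gnilpotentI[OF smooth_supp fin_G])

lemma smooth_gapply:
  assumes f: "smooth_sfun I G U f" and F: "iter_diff A F" and A: "\<And>x. x \<in> U \<Longrightarrow> body (f x) \<in> A"
  shows "smooth_sfun I G U (\<lambda>x. gapply F (f x))"
  unfolding smooth_sfun_def
proof (intro conjI allI ballI)
  fix S k
  have f0: "pdiffs k I U (\<lambda>x. body (f x))" using f by (simp add: smooth_sfun_def body_def)
  have "pdiffs k I U (\<lambda>x. gcoeff (soul (f x) ^ m) S)" for m
    using smooth_power[OF smooth_soul[OF f], of m] by (simp add: smooth_sfun_def)
  then have "pdiffs k I U (\<lambda>x. \<Sum>m\<le>card S. taylor_coeff F m (body (f x)) * gcoeff (soul (f x) ^ m) S)"
    unfolding taylor_coeff_def divide_inverse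
    by (intro pdiffs_sum pdiffs_mult pdiffs_const pdiffs_compose[OF F A f0]) auto
  then show "pdiffs k I U (\<lambda>x. gcoeff (gapply F (f x)) S)"
    by (rule pdiffs_cong) (simp add: gcoeff_gapply smooth_nilpotent[OF f])
qed (use f in \<open>auto simp: smooth_sfun_def intro: gsupp_gapply\<close>)

lemma pd_Ev_plus:
  assumes "smooth_sfun I G U f" "smooth_sfun I G U g" "i \<in> I" "x \<in> U"
  shows "pd (Ev i) (\<lambda>x. f x + g x) x = pd (Ev i) f x + pd (Ev i) g x"
proof (rule grassmann_eqI)
  fix S
  have "((\<lambda>t. gcoeff (f (x(i := t))) S + gcoeff (g (x(i := t))) S) has_field_derivative
      gcoeff (pd (Ev i) f x) S + gcoeff (pd (Ev i) g x) S) (at (x i))"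
    by (intro DERIV_add smooth_DERIV assms)
  then show "gcoeff (pd (Ev i) (\<lambda>x. f x + g x) x) S = gcoeff (pd (Ev i) f x + pd (Ev i) g x) S"
    by (simp only: gcoeff_pd_Ev gcoeff_plus DERIV_imp_deriv)
qed

lemma pd_Ev_times:
  assumes "smooth_sfun I G U f" "smooth_sfun I G U g" "i \<in> I" "x \<in> U"
  shows "pd (Ev i) (\<lambda>x. f x * g x) x = pd (Ev i) f x * g x + f x * pd (Ev i) g x"
proof (rule grassmann_eqI)
  fix S
  let ?f = "\<lambda>T x. gcoeff (f x) T" and ?g = "\<lambda>T x. gcoeff (g x) T"
  let ?f' = "\<lambda>T. gcoeff (pd (Ev i) f x) T" and ?g' = "\<lambda>T. gcoeff (pd (Ev i) g x) T"
  have "((\<lambda>t. \<Sum>T\<in>Pow S. gsign T (S - T) * (?f T (x(i := t)) * ?g (S - T) (x(i := t)))) has_field_derivative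
      (\<Sum>T\<in>Pow S. gsign T (S - T) * (?f' T * ?g (S - T) (x(i := x i)) + ?g' (S - T) * ?f T (x(i := x i))))) (at (x i))"
    by (intro DERIV_sum DERIV_cmult DERIV_mult smooth_DERIV assms)
  from DERIV_imp_deriv[OF this]
  show "gcoeff (pd (Ev i) (\<lambda>x. f x * g x) x) S = gcoeff (pd (Ev i) f x * g x + f x * pd (Ev i) g x) S"
    by (simp only: gcoeff_pd_Ev[of i "\<lambda>x. f x * g x"] gcoeff_plus gcoeff_times fun_upd_triv
        sum.distrib[symmetric] distrib_left mult_ac)
qed

end

section \<open>Evaluation at a point\<close>

text \<open>The part of order \<open>k\<close> of the Taylor expansion in \<open>eval_at\<close>, divided powers included; peeling off
  the last derivative gives the recursion \<open>(k + 1) T\<^sub>k\<^sub>+\<^sub>1 f = \<Sum>\<^sub>i s\<^sub>i T\<^sub>k (\<partial>\<^sub>i f)\<close>.\<close>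
primrec taylor_part :: "nat set \<Rightarrow> (sidx \<Rightarrow> grassmann) \<Rightarrow> nat \<Rightarrow> sfun \<Rightarrow> sfun" where
  "taylor_part I z 0 f x = gsubst I (\<lambda>i. z (Od i)) (f x)"
| "taylor_part I z (Suc k) f x =
     (1 / real (Suc k)) *\<^sub>R (\<Sum>i\<in>I. soul (z (Ev i)) * taylor_part I z k (pd (Ev i) f) x)"

lemma taylor_part_Suc:
  "real (Suc k) *\<^sub>R taylor_part I z (Suc k) f x
    = (\<Sum>i\<in>I. soul (z (Ev i)) * taylor_part I z k (pd (Ev i) f) x)"
  by (simp del: of_nat_Suc)

text \<open>A \<Lambda>-point at which superfunctions are evaluated. \<open>G'\<close> must contain
  the generators that occur in the coordinates and those left in place by the substitution, hence
  \<open>G - I \<subseteq> G'\<close>; its finiteness makes the Taylor expansion terminate.\<close>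

locale superpoint = superdomain +
  fixes z :: "sidx \<Rightarrow> grassmann" and G' :: "nat set"
  assumes z_even: "\<And>i. i \<in> I \<Longrightarrow> gparity 0 (z (Ev i))"
    and z_odd: "\<And>i. i \<in> I \<Longrightarrow> gparity 1 (z (Od i))"
    and z_supp: "\<And>i. i \<in> I \<Longrightarrow> gsupp G' (z (Ev i)) \<and> gsupp G' (z (Od i))"
    and fin_G': "finite G'" and G_G': "G - I \<subseteq> G'"
    and body_in: "body_point I z \<in> U"
begin

abbreviation "T \<equiv> taylor_part I z"

lemma T_cong:
  assumes "x \<in> U" "\<And>x. x \<in> U \<Longrightarrow> f x = g x" shows "T k f x = T k g x"
  using assms
proof (induction k arbitrary: f g)
  case (Suc k)
  have "T k (pd (Ev i) f) x = T k (pd (Ev i) g) x" if "i \<in> I" for i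
    by (rule Suc.IH[OF Suc.prems(1)]) (rule pd_Ev_cong[OF _ that Suc.prems(2)])
  then show ?case by (simp cong: sum.cong)
qed simp

lemma T_zero: "T k (\<lambda>_. 0) x = 0" if "x \<in> U" for k x
proof (induction k)
  case (Suc k)
  have "T k (pd (Ev i) (\<lambda>_. 0)) x = 0" if "i \<in> I" for i
    using T_cong[OF \<open>x \<in> U\<close>, of "pd (Ev i) (\<lambda>_. 0)" "\<lambda>_. 0" k] pd_Ev_const_on[OF _ that, of _ "\<lambda>_. 0" 0] Suc
    by simp
  then show ?case by simp
qed simp

lemma T_plus:
  assumes "smooth_sfun I G U f" "smooth_sfun I G U g" and x: "x \<in> U"
  shows "T k (\<lambda>x. f x + g x) x = T k f x + T k g x"
  using assms(1,2)
proof (induction k arbitrary: f g)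
  case 0
  then show ?case using x by (simp add: gsubst_plus[OF fin_G] smooth_supp)
next
  case (Suc k)
  have "T k (pd (Ev i) (\<lambda>x. f x + g x)) x = T k (pd (Ev i) f) x + T k (pd (Ev i) g) x" if i: "i \<in> I" for i
  proof -
    have "T k (pd (Ev i) (\<lambda>x. f x + g x)) x = T k (\<lambda>x. pd (Ev i) f x + pd (Ev i) g x) x"
      by (rule T_cong[OF x]) (rule pd_Ev_plus[OF Suc.prems i])
    also have "\<dots> = T k (pd (Ev i) f) x + T k (pd (Ev i) g) x"
      by (rule Suc.IH) (intro smooth_pd_Ev Suc.prems i)+
    finally show ?thesis .
  qed
  then show ?case by (simp add: distrib_left sum.distrib scaleR_add_right)
qed

text \<open>Souls of even coordinates are central and can be moved past the factors, so the
  recursion acts as a derivation and \<open>leibniz_sum\<close> collects the terms. The factor k + 1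
  is kept until the end, which avoids fractions.\<close>

lemma T_times:
  assumes "smooth_sfun I G U f" "smooth_sfun I G U g" and x: "x \<in> U"
  shows "T k (\<lambda>x. f x * g x) x = (\<Sum>j\<le>k. T j f x * T (k - j) g x)"
  using assms(1,2)
proof (induction k arbitrary: f g)
  case 0
  show ?case
    using gsubst_times[OF fin_G smooth_supp[OF 0(1) x] smooth_supp[OF 0(2) x], of I "\<lambda>i. z (Od i)"] z_odd
    by simp
next
  case (Suc k)
  let ?s = "\<lambda>i. soul (z (Ev i))"
  have s: "a * (?s i * b) = ?s i * (a * b)" if "i \<in> I" for i a b
    using gparity_even_commute[OF gparity_soul[OF z_even[OF that]], of a] by (simp flip: mult.assoc)
  have pdk: "T k (pd (Ev i) (\<lambda>x. f x * g x)) x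
      = (\<Sum>j\<le>k. T j (pd (Ev i) f) x * T (k - j) g x + T j f x * T (k - j) (pd (Ev i) g) x)" if i: "i \<in> I" for i
  proof -
    note sm = Suc.prems smooth_pd_Ev[OF Suc.prems(1) i] smooth_pd_Ev[OF Suc.prems(2) i]
    have "T k (pd (Ev i) (\<lambda>x. f x * g x)) x = T k (\<lambda>x. pd (Ev i) f x * g x + f x * pd (Ev i) g x) x"
      by (rule T_cong[OF x]) (rule pd_Ev_times[OF Suc.prems i])
    also have "\<dots> = T k (\<lambda>x. pd (Ev i) f x * g x) x + T k (\<lambda>x. f x * pd (Ev i) g x) x"
      by (intro T_plus smooth_times sm x)
    also have "\<dots> = (\<Sum>j\<le>k. T j (pd (Ev i) f) x * T (k - j) g x) + (\<Sum>j\<le>k. T j f x * T (k - j) (pd (Ev i) g) x)"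
      by (simp only: Suc.IH[OF sm(3) sm(2)] Suc.IH[OF sm(1) sm(4)])
    finally show ?thesis by (simp only: sum.distrib)
  qed
  have "real (Suc k) *\<^sub>R T (Suc k) (\<lambda>x. f x * g x) x
      = (\<Sum>i\<in>I. ?s i * (\<Sum>j\<le>k. T j (pd (Ev i) f) x * T (k - j) g x + T j f x * T (k - j) (pd (Ev i) g) x))"
    unfolding taylor_part_Suc by (intro sum.cong refl) (simp only: pdk)
  also have "\<dots> = (\<Sum>i\<in>I. \<Sum>j\<le>k. ?s i * T j (pd (Ev i) f) x * T (k - j) g x + T j f x * (?s i * T (k - j) (pd (Ev i) g) x))"
    by (intro sum.cong refl) (simp add: sum_distrib_left distrib_left mult.assoc s)
  also have "\<dots> = (\<Sum>j\<le>k. \<Sum>i\<in>I. ?s i * T j (pd (Ev i) f) x * T (k - j) g x + T j f x * (?s i * T (k - j) (pd (Ev i) g) x))"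
    by (rule sum.swap)
  also have "\<dots> = (\<Sum>j\<le>k. real (Suc j) *\<^sub>R (T (Suc j) f x * T (k - j) g x)
      + real (Suc (k - j)) *\<^sub>R (T j f x * T (Suc (k - j)) g x))"
  proof (rule sum.cong[OF refl])
    fix j
    have "real (Suc j) *\<^sub>R (T (Suc j) f x * T (k - j) g x) = (real (Suc j) *\<^sub>R T (Suc j) f x) * T (k - j) g x"
      by (simp only: mult_scaleR_left)
    moreover have "real (Suc (k - j)) *\<^sub>R (T j f x * T (Suc (k - j)) g x)
        = T j f x * (real (Suc (k - j)) *\<^sub>R T (Suc (k - j)) g x)"
      by (simp only: mult_scaleR_right)
    ultimately show "(\<Sum>i\<in>I. ?s i * T j (pd (Ev i) f) x * T (k - j) g x + T j f x * (?s i * T (k - j) (pd (Ev i) g) x))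
        = real (Suc j) *\<^sub>R (T (Suc j) f x * T (k - j) g x)
          + real (Suc (k - j)) *\<^sub>R (T j f x * T (Suc (k - j)) g x)"
      by (simp only: taylor_part_Suc sum_distrib_left sum_distrib_right sum.distrib)
  qed
  also have "\<dots> = real (Suc k) *\<^sub>R (\<Sum>j\<le>Suc k. T j f x * T (Suc k - j) g x)"
    by (rule leibniz_sum)
  finally show ?case by (simp only: scaleR_cancel_left of_nat_eq_0_iff nat.simps simp_thms)
qed

definition soul_prod :: "nat list \<Rightarrow> grassmann" where
  "soul_prod is = prod_list (map (\<lambda>i. soul (z (Ev i))) is)"

lemma gvanish_soul_prod: "gvanish (length is) (soul_prod is)"
proof (induction "is")
  case (Cons i js)
  have "gvanish (1 + length js) (soul (z (Ev i)) * soul_prod js)"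
    by (intro gvanish_times Cons gvanish_1 body_soul)
  then show ?case by (simp add: soul_prod_def)
qed (simp add: soul_prod_def)

lemma gsupp_soul_prod: "set is \<subseteq> I \<Longrightarrow> gsupp G' (soul_prod is)"
  unfolding soul_prod_def using z_supp by (intro gsupp_prod_list) (auto intro: gsupp_soul)

lemma soul_prod_eq_0: "set is \<subseteq> I \<Longrightarrow> card G' < length is \<Longrightarrow> soul_prod is = 0"
  by (rule gvanish_supp_eq_0[OF gsupp_soul_prod fin_G' gvanish_soul_prod])

text \<open>The last entry is split off, not the first: \<open>foldr\<close> applies it innermost,
  that is, directly to the superfunction, as the recursion for \<open>taylor_part\<close>
  does.\<close>

lemma lists_snoc:
  "(\<Sum>is\<in>{is. set is \<subseteq> I \<and> length is = Suc k}. h is)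
    = (\<Sum>i\<in>I. \<Sum>js\<in>{js. set js \<subseteq> I \<and> length js = k}. h (js @ [i]))"
proof -
  have "(\<Sum>is\<in>{is. set is \<subseteq> I \<and> length is = Suc k}. h is)
      = (\<Sum>(i, js)\<in>I \<times> {js. set js \<subseteq> I \<and> length js = k}. h (js @ [i]))"
  proof (rule sum.reindex_bij_witness[where i = "\<lambda>(i, js). js @ [i]" and j = "\<lambda>is. (last is, butlast is)"], goal_cases)
    case (1 a)
    then have "a \<noteq> []" by auto
    then show ?case by simp
  next
    case (2 a)
    then have "a \<noteq> []" by auto
    then have "last a \<in> set a" "set (butlast a) \<subseteq> set a" by (auto dest: in_set_butlastD)
    then show ?case using 2 by auto
  next
    case (5 a)
    then have "a \<noteq> []" by auto
    then show ?case by simp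
  qed auto
  then show ?thesis by (simp add: sum.cartesian_product)
qed

lemma T_lists:
  "T k f x = (\<Sum>is\<in>{is. set is \<subseteq> I \<and> length is = k}. (1 / fact k) *\<^sub>R
      (soul_prod is * gsubst I (\<lambda>i. z (Od i)) (foldr (\<lambda>i. pd (Ev i)) is f x)))"
proof (induction k arbitrary: f)
  case 0
  have "{is. set is \<subseteq> I \<and> length is = 0} = {[]}" by auto
  then show ?case by (simp add: soul_prod_def)
next
  case (Suc k)
  let ?t = "\<lambda>is f. soul_prod is * gsubst I (\<lambda>i. z (Od i)) (foldr (\<lambda>i. pd (Ev i)) is f x)"
  have s: "?t (js @ [i]) f = soul (z (Ev i)) * ?t js (pd (Ev i) f)" if "i \<in> I" for i js
    using gparity_even_commute[OF gparity_soul[OF z_even[OF that]], of "soul_prod js"]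
    by (simp add: soul_prod_def flip: mult.assoc)
  have "T (Suc k) f x = (1 / real (Suc k)) *\<^sub>R (\<Sum>i\<in>I. soul (z (Ev i)) *
      (\<Sum>js\<in>{js. set js \<subseteq> I \<and> length js = k}. (1 / fact k) *\<^sub>R ?t js (pd (Ev i) f)))"
    by (simp only: taylor_part.simps Suc.IH)
  also have "\<dots> = (\<Sum>i\<in>I. \<Sum>js\<in>{js. set js \<subseteq> I \<and> length js = k}. (1 / fact (Suc k)) *\<^sub>R ?t (js @ [i]) f)"
    unfolding scaleR_sum_right sum_distrib_left
    by (intro sum.cong refl) (simp only: s mult_scaleR_right scaleR_scaleR fact_Suc, simp)
  also have "\<dots> = (\<Sum>is\<in>{is. set is \<subseteq> I \<and> length is = Suc k}. (1 / fact (Suc k)) *\<^sub>R ?t is f)"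
    by (rule lists_snoc[symmetric])
  finally show ?case .
qed

text \<open>The sequences are sorted by length; a product of more than \<open>card G'\<close> souls
  exceeds the top degree and vanishes. \<open>K\<close> is kept free so that a product of two
  superfunctions can be expanded to twice that order.\<close>

lemma eval_at_eq:
  assumes "card G' \<le> K" shows "eval_at I f z = (\<Sum>k\<le>K. T k f (body_point I z))"
proof -
  let ?t = "\<lambda>is. (1 / fact (length is)) *\<^sub>R
      (soul_prod is * gsubst I (\<lambda>i. z (Od i)) (foldr (\<lambda>i. pd (Ev i)) is f (body_point I z)))"
  have "eval_at I f z = (\<Sum>is\<in>{is. set is \<subseteq> I \<and> soul_prod is \<noteq> 0}. ?t is)"
    unfolding eval_at_def soul_prod_def ..
  also have "\<dots> = (\<Sum>is\<in>{is. set is \<subseteq> I \<and> length is \<le> K}. ?t is)"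
  proof (rule sum.mono_neutral_left)
    show "finite {is. set is \<subseteq> I \<and> length is \<le> K}" by (rule finite_lists_length_le[OF fin_I])
    show "{is. set is \<subseteq> I \<and> soul_prod is \<noteq> 0} \<subseteq> {is. set is \<subseteq> I \<and> length is \<le> K}"
    proof clarify
      fix "is" assume "set is \<subseteq> I" "soul_prod is \<noteq> 0"
      then have "\<not> card G' < length is" using soul_prod_eq_0 by blast
      then show "length is \<le> K" using assms by simp
    qed
  qed auto
  also have "{is. set is \<subseteq> I \<and> length is \<le> K} = (\<Union>k\<in>{..K}. {is. set is \<subseteq> I \<and> length is = k})" by auto
  also have "(\<Sum>is\<in>\<dots>. ?t is) = (\<Sum>k\<le>K. \<Sum>is\<in>{is. set is \<subseteq> I \<and> length is = k}. ?t is)"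
    by (rule sum.UNION_disjoint) (auto simp: finite_lists_length_eq[OF fin_I])
  also have "\<dots> = (\<Sum>k\<le>K. T k f (body_point I z))"
    unfolding T_lists by (intro sum.cong refl) simp
  finally show ?thesis .
qed

lemma T_eq_0: "card G' < k \<Longrightarrow> T k f x = 0"
  unfolding T_lists by (rule sum.neutral) (simp add: soul_prod_eq_0)

lemma eval_at_cong:
  assumes "\<And>x. x \<in> U \<Longrightarrow> f x = g x" shows "eval_at I f z = eval_at I g z"
  unfolding eval_at_eq[OF order_refl] by (rule sum.cong[OF refl]) (rule T_cong[OF body_in assms])

lemma eval_at_times:
  assumes "smooth_sfun I G U f" "smooth_sfun I G U g"
  shows "eval_at I (\<lambda>x. f x * g x) z = eval_at I f z * eval_at I g z"
proof -
  let ?K = "card G'" and ?x = "body_point I z"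
  have "eval_at I (\<lambda>x. f x * g x) z = (\<Sum>k\<le>2 * ?K. \<Sum>j\<le>k. T j f ?x * T (k - j) g ?x)"
    by (simp only: eval_at_eq[of "2 * ?K"] T_times[OF assms body_in])
  also have "\<dots> = (\<Sum>k\<le>?K. T k f ?x) * (\<Sum>k\<le>?K. T k g ?x)"
    by (rule finite_cauchy_product[symmetric]) (rule T_eq_0, assumption)+
  finally show ?thesis by (simp only: eval_at_eq[OF order_refl])
qed

lemma eval_at_const:
  assumes "\<And>x. x \<in> U \<Longrightarrow> f x = of_real c" shows "eval_at I f z = of_real c"
proof -
  have "T k (\<lambda>_. of_real c) (body_point I z) = (if k = 0 then of_real c else 0)" for k
  proof (cases k)
    case (Suc m)
    have "T m (pd (Ev i) (\<lambda>_. of_real c)) (body_point I z) = T m (\<lambda>_. 0) (body_point I z)" if "i \<in> I" for i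
      by (rule T_cong[OF body_in]) (rule pd_Ev_const_on[OF _ that refl])
    then show ?thesis by (simp add: Suc T_zero[OF body_in])
  qed (simp add: gsubst_of_real)
  then have "eval_at I (\<lambda>_. of_real c) z = of_real c"
    by (simp add: eval_at_eq[OF order_refl])
  then show ?thesis using eval_at_cong[of f "\<lambda>_. of_real c"] assms by simp
qed

lemma eval_at_scaleR:
  assumes "smooth_sfun I G U f" shows "eval_at I (\<lambda>x. c *\<^sub>R f x) z = c *\<^sub>R eval_at I f z"
proof -
  have "eval_at I (\<lambda>x. of_real c * f x) z = of_real c * eval_at I f z"
    using eval_at_times[OF smooth_const[OF gsupp_of_real] assms] eval_at_const[of "\<lambda>_. of_real c"] by simp
  then show ?thesis by (simp add: scaleR_conv_of_real)
qed

lemma body_eval_at: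
  assumes "smooth_sfun I G U f" shows "body (eval_at I f z) = body (f (body_point I z))"
proof -
  have "body (T k f (body_point I z)) = (if k = 0 then body (f (body_point I z)) else 0)" for k
    by (cases k) (simp_all add: body_gsubst[OF fin_G smooth_supp[OF assms body_in] z_odd])
  then show ?thesis by (simp add: eval_at_eq[OF order_refl])
qed

lemma gsupp_eval_at:
  assumes "smooth_sfun I G U f" shows "gsupp G' (eval_at I f z)"
proof -
  have "gsupp G' (T k f (body_point I z))" for k
    using assms
  proof (induction k arbitrary: f)
    case 0
    have "gsupp G' (if i \<in> I then z (Od i) else gen i)" if "i \<in> G" for i
      using that z_supp G_G' by (auto intro: gsupp_gen)
    then show ?case
      using gsupp_gsubst[OF fin_G smooth_supp[OF 0 body_in]] by simp
  next
    case (Suc k)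
    then show ?case
      using z_supp by (auto intro!: gsupp_scaleR gsupp_sum gsupp_times gsupp_soul smooth_pd_Ev simp del: pd.simps)
  qed
  then show ?thesis unfolding eval_at_eq[OF order_refl] by (intro gsupp_sum)
qed

end

section \<open>Restriction to x^0 = \<theta>_0 = 0\<close>

lemma foldr_pd_restrict0:
  assumes "0 \<notin> set is"
  shows "foldr (\<lambda>i. pd (Ev i)) is (restrict0 f) = restrict0 (foldr (\<lambda>i. pd (Ev i)) is f)"
  using assms
proof (induction "is")
  case (Cons i js)
  have "pd (Ev i) (restrict0 g) x = restrict0 (pd (Ev i) g) x" for g x
  proof (rule grassmann_eqI)
    fix S
    have i: "i \<noteq> 0" using Cons.prems by auto
    then have "(x(i := t))(0 := 0) = (x(0 := 0))(i := t)" for t :: real by (simp add: fun_upd_twist)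
    then show "gcoeff (pd (Ev i) (restrict0 g) x) S = gcoeff (restrict0 (pd (Ev i) g) x) S"
      using i by (simp add: gcoeff_pd_Ev restrict0_def gcoeff_gkill del: pd.simps)
  qed
  then show ?case using Cons by (auto simp del: pd.simps)
qed simp

text \<open>Taylor sequences that contain 0 vanish because they contain the soul of a zero
  coordinate, so derivatives in x^0 never occur. The number part already has x^0 = 0, and
  substituting 0 for the generator 0 amounts to \<open>gkill 0\<close>.\<close>

lemma (in superpoint) eval_at_restrict0:
  assumes I: "I = insert 0 J" "0 \<notin> J" and z0: "z (Ev 0) = 0" "z (Od 0) = 0"
    and f: "smooth_sfun I G U f"
  shows "eval_at J (restrict0 f) z = eval_at I f z"
proof -
  have bp: "body_point J z = body_point I z"
    using I z0 by (auto simp: body_point_def)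
  have bp0: "(body_point I z)(0 := 0) = body_point I z"
    using z0 by (auto simp: body_point_def)
  have z00: "soul (z (Ev 0)) = 0" by (simp add: z0 soul_def)
  have sets: "{is. set is \<subseteq> J \<and> soul_prod is \<noteq> 0} = {is. set is \<subseteq> I \<and> soul_prod is \<noteq> 0}"
  proof -
    have "soul_prod is = 0" if "0 \<in> set is" for "is"
      unfolding soul_prod_def by (rule prod_list_zero_mem) (use that z00 in force)
    then show ?thesis using I by blast
  qed
  have "gsubst J (\<lambda>i. z (Od i)) (foldr (\<lambda>i. pd (Ev i)) is (restrict0 f) (body_point I z))
      = gsubst I (\<lambda>i. z (Od i)) (foldr (\<lambda>i. pd (Ev i)) is f (body_point I z))" if "set is \<subseteq> J" for "is"
  proof -
    have "set is \<subseteq> I" using that I(1) by auto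
    then have "smooth_sfun I G U (foldr (\<lambda>i. pd (Ev i)) is f)"
      by (induction "is") (simp_all add: f smooth_pd_Ev del: pd.simps)
    then have supp: "gsupp G (foldr (\<lambda>i. pd (Ev i)) is f (body_point I z))"
      using smooth_supp body_in by blast
    have "0 \<notin> set is" using that I(2) by auto
    then have r: "foldr (\<lambda>i. pd (Ev i)) is (restrict0 f) = restrict0 (foldr (\<lambda>i. pd (Ev i)) is f)"
      by (rule foldr_pd_restrict0)
    show ?thesis
      unfolding r restrict0_def bp0
      unfolding I(1) by (rule gsubst_insert_zero[symmetric, OF fin_G]) (use supp I z0 in simp_all)
  qed
  note gs = this
  show ?thesis
    unfolding eval_at_def soul_prod_def[symmetric] bp sets
  proof (rule sum.cong[OF refl])
    fix "is" assume "is \<in> {is. set is \<subseteq> I \<and> soul_prod is \<noteq> 0}"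
    then have "set is \<subseteq> J" unfolding sets[symmetric] by simp
    then show "(1 / fact (length is)) *\<^sub>R (soul_prod is *
          gsubst J (\<lambda>i. z (Od i)) (foldr (\<lambda>i. pd (Ev i)) is (restrict0 f) (body_point I z)))
        = (1 / fact (length is)) *\<^sub>R (soul_prod is *
          gsubst I (\<lambda>i. z (Od i)) (foldr (\<lambda>i. pd (Ev i)) is f (body_point I z)))"
      by (simp only: gs)
  qed
qed

section \<open>Linear algebra at a point of the surface\<close>

lemma sum_sindices:
  assumes "finite I"
  shows "sum f (sindices I) = (\<Sum>i\<in>I. f (Ev i)) + (\<Sum>i\<in>I. f (Od i))"
proof -
  have "sum f (sindices I) = sum f (Ev ` I) + sum f (Od ` I)"
    unfolding sindices_def by (rule sum.union_disjoint) (use assms in auto)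
  then show ?thesis by (simp add: sum.reindex inj_on_def)
qed

lemma finite_sindices: "finite I \<Longrightarrow> finite (sindices I)" by (simp add: sindices_def)

lemma Ev_in_sindices [simp]: "Ev i \<in> sindices I \<longleftrightarrow> i \<in> I" by (auto simp: sindices_def)
lemma Od_in_sindices [simp]: "Od i \<in> sindices I \<longleftrightarrow> i \<in> I" by (auto simp: sindices_def)

lemma form_value_darboux:
  assumes I: "finite I"
    and \<Omega>: "\<And>i j. i \<in> I \<Longrightarrow> j \<in> I \<Longrightarrow> \<Omega> (Ev i) (Ev j) = 0"
      "\<And>i j. i \<in> I \<Longrightarrow> j \<in> I \<Longrightarrow> \<Omega> (Od i) (Od j) = 0"
      "\<And>i j. i \<in> I \<Longrightarrow> j \<in> I \<Longrightarrow> \<Omega> (Ev i) (Od j) = of_bool (i = j)"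
      "\<And>i j. i \<in> I \<Longrightarrow> j \<in> I \<Longrightarrow> \<Omega> (Od i) (Ev j) = - of_bool (i = j)"
  shows "form_value I \<Omega> q X Y = (\<Sum>i\<in>I. X (Ev i) * Y (Od i) - (-1) ^ q * (X (Od i) * Y (Ev i)))"
proof -
  \<comment> \<open>The sign in \<open>form_value\<close> is trivial for odd \<open>B\<close> and
    equals (-1)^q for even \<open>B\<close>.\<close>
  have e: "(-1::grassmann) ^ (q * (1 + 1)) = 1" by (simp add: minus_one_power_iff)
  have "(\<Sum>j\<in>I. X (Ev i) * of_bool (i = j) * Y (Od j)) = X (Ev i) * Y (Od i)" if "i \<in> I" for i
    using sum_of_bool_left[OF I that, of "\<lambda>j. Y (Od j)"] by (simp add: mult.assoc flip: sum_distrib_left)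
  moreover have "(\<Sum>j\<in>I. (-1) ^ q * X (Od i) * - of_bool (i = j) * Y (Ev j)) = - ((-1) ^ q * (X (Od i) * Y (Ev i)))"
    if "i \<in> I" for i
  proof -
    have "(\<Sum>j\<in>I. (-1) ^ q * X (Od i) * - of_bool (i = j) * Y (Ev j))
        = - ((-1) ^ q * X (Od i) * (\<Sum>j\<in>I. of_bool (i = j) * Y (Ev j)))"
      by (simp add: mult.assoc sum_negf sum_distrib_left)
    then show ?thesis by (simp add: sum_of_bool_left[OF I that] mult.assoc)
  qed
  ultimately show ?thesis
    unfolding form_value_def sum_sindices[OF I]
    by (simp add: \<Omega> e sum_subtractf sum_negf cong: sum.cong)
qed

lemma minus_one_power_mult_eq_0: "(-1) ^ m * x = 0 \<Longrightarrow> x = (0 :: 'a::ring_1)"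
  by (cases "even m") (simp_all add: minus_one_power_iff)

text \<open>Once the factors are exchanged according to their parities, orthogonality becomes a
  homogeneous linear system W v = 0, and the right inverse \<open>L\<close> of the square matrix
  \<open>W\<close> is also a left inverse.\<close>

lemma orthogonal_to_frame_eq_0:
  assumes J: "finite J"
    and inv: "\<And>\<alpha> \<beta>. \<alpha> \<in> sindices J \<Longrightarrow> \<beta> \<in> sindices J \<Longrightarrow> (\<Sum>B\<in>sindices J. W \<alpha> B * L B \<beta>) = of_bool (\<alpha> = \<beta>)"
    and W: "\<And>\<alpha> B. \<alpha> \<in> sindices J \<Longrightarrow> B \<in> sindices J \<Longrightarrow> gparity (par B + par \<alpha>) (W \<alpha> B)"
    and X: "\<And>A. A \<in> sindices J \<Longrightarrow> gparity (par A + p) (X A)"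
    and orth: "\<And>\<alpha>. \<alpha> \<in> sindices J \<Longrightarrow>
      (\<Sum>i\<in>J. X (Ev i) * W \<alpha> (Od i) - (-1) ^ par \<alpha> * (X (Od i) * W \<alpha> (Ev i))) = 0"
    and A: "A \<in> sindices J"
  shows "X A = 0"
proof -
  \<comment> \<open>Up to a common sign \<open>v\<close> is X contracted with \<Omega>, which
    exchanges even and odd components. The sign on \<open>Ev i\<close> absorbs the parity signs that
    are not common to both terms.\<close>
  define v where "v B = (case B of Od i \<Rightarrow> X (Ev i) | Ev i \<Rightarrow> - ((-1) ^ p * X (Od i)))" for B
  have Wv: "(\<Sum>B\<in>sindices J. W \<alpha> B * v B) = 0" if \<alpha>: "\<alpha> \<in> sindices J" for \<alpha>
  proof -
    let ?q = "par \<alpha>"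
    have t: "X (Ev i) * W \<alpha> (Od i) - (-1) ^ ?q * (X (Od i) * W \<alpha> (Ev i))
        = (-1) ^ (p * (?q + 1)) * (W \<alpha> (Ev i) * v (Ev i) + W \<alpha> (Od i) * v (Od i))" if i: "i \<in> J" for i
    proof -
      have "X (Ev i) * W \<alpha> (Od i) = (-1) ^ (p * (1 + ?q)) * (W \<alpha> (Od i) * X (Ev i))"
        using gparity_commute[of p "X (Ev i)" "1 + ?q" "W \<alpha> (Od i)"] X[of "Ev i"] W[OF \<alpha>, of "Od i"] i
        by simp
      moreover have "X (Od i) * W \<alpha> (Ev i) = (-1) ^ ((1 + p) * ?q) * (W \<alpha> (Ev i) * X (Od i))"
        using gparity_commute[of "1 + p" "X (Od i)" ?q "W \<alpha> (Ev i)"] X[of "Od i"] W[OF \<alpha>, of "Ev i"] i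
        by simp
      ultimately show ?thesis
        by (cases "even p"; cases "even ?q") (simp_all add: v_def minus_one_power_iff)
    qed
    have "(-1) ^ (p * (?q + 1)) * (\<Sum>B\<in>sindices J. W \<alpha> B * v B) = 0"
      using orth[OF \<alpha>] by (simp add: t sum_sindices[OF J] sum_distrib_left sum.distrib distrib_left cong: sum.cong)
    then show ?thesis by (rule minus_one_power_mult_eq_0)
  qed
  have v0: "v B = 0" if B: "B \<in> sindices J" for B
  proof -
    have "v B = (\<Sum>C\<in>sindices J. (\<Sum>\<alpha>\<in>sindices J. L B \<alpha> * W \<alpha> C) * v C)"
      using gmat_right_inverse_imp_left[OF finite_sindices[OF J] inv B]
      by (simp add: sum_of_bool_left[OF finite_sindices[OF J] B])
    also have "\<dots> = (\<Sum>\<alpha>\<in>sindices J. L B \<alpha> * (\<Sum>C\<in>sindices J. W \<alpha> C * v C))"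
      by (rule matrix_product_assoc[where C = "\<lambda>d _. v d", symmetric])
    also have "\<dots> = 0" by (simp add: Wv)
    finally show ?thesis .
  qed
  show ?thesis
  proof (cases A)
    case (Ev i)
    then show ?thesis using A v0[of "Od i"] by (simp add: v_def)
  next
    case (Od i)
    then show ?thesis using A v0[of "Ev i"] by (cases "even p") (simp_all add: v_def minus_one_power_iff)
  qed
qed

section \<open>Splitting a (1.1) block off the Berezinian\<close>

lemma ginv_cong:
  assumes "\<And>a b. a \<in> J \<Longrightarrow> b \<in> J \<Longrightarrow> M a b = M' a b" shows "ginv J M = ginv J M'"
proof -
  have "gmat_inverse J M = gmat_inverse J M'"
    unfolding gmat_inverse_def using assms by (intro ext) (simp cong: sum.cong)
  then show ?thesis by (simp add: ginv_def)
qed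

lemma Berezinian_cong:
  assumes J: "finite J" and M: "\<And>a b. a \<in> sindices J \<Longrightarrow> b \<in> sindices J \<Longrightarrow> M a b = M' a b"
  shows "Berezinian J M = Berezinian J M'"
proof -
  have "ginv J (\<lambda>k l. M (Od k) (Od l)) = ginv J (\<lambda>k l. M' (Od k) (Od l))"
    by (rule ginv_cong) (simp add: M)
  then show ?thesis
    unfolding Berezinian_def Let_def
    by (intro arg_cong2[of _ _ _ _ "(*)"] gdet_cong[OF J]) (simp_all add: M cong: sum.cong)
qed

text \<open>A (1.1) block whose diagonal entries are h and its inverse has Berezinian h^2. The entry
  \<open>M (Ev 0) (Od 0)\<close> can be arbitrary: the Schur complement multiplies it by entries
  \<open>M (Od l) (Ev 0)\<close>, which are all 0.\<close>

lemma Berezinian_split_0: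
  assumes J: "finite J" "0 \<notin> J"
    and e0: "\<And>i. i \<in> J \<Longrightarrow> M (Ev 0) (Ev i) = 0 \<and> M (Ev 0) (Od i) = 0"
    and o0: "\<And>i. i \<in> J \<Longrightarrow> M (Od 0) (Ev i) = 0 \<and> M (Od 0) (Od i) = 0" "M (Od 0) (Ev 0) = 0"
    and c0: "\<And>\<alpha>. \<alpha> \<in> sindices J \<Longrightarrow> M \<alpha> (Ev 0) = 0 \<and> M \<alpha> (Od 0) = 0"
    and h: "M (Ev 0) (Ev 0) = h" "h * M (Od 0) (Od 0) = 1" "gparity 0 h"
    and inv: "ginvertible J (\<lambda>k l. M (Od k) (Od l))"
  shows "Berezinian (insert 0 J) M = h * h * Berezinian J M"
proof -
  let ?I = "insert 0 J"
  let ?Y = "ginv J (\<lambda>k l. M (Od k) (Od l))" and ?X = "ginv ?I (\<lambda>k l. M (Od k) (Od l))"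
  have Y: "gmat_inverse J (\<lambda>k l. M (Od k) (Od l)) ?Y"
    using inv unfolding ginvertible_def ginv_def by (metis someI_ex)
  \<comment> \<open>The block-diagonal inverse of the odd-odd part: \<open>h\<close> inverts its
    entry at 0.\<close>
  define Z where "Z k l = (if k = 0 \<and> l = 0 then h else if k = 0 \<or> l = 0 then 0 else ?Y k l)" for k l
  have Z: "Z 0 0 = h" "\<And>k. k \<in> J \<Longrightarrow> Z 0 k = 0" "\<And>k. k \<in> J \<Longrightarrow> Z k 0 = 0"
    "\<And>k l. k \<in> J \<Longrightarrow> l \<in> J \<Longrightarrow> Z k l = ?Y k l"
    using J(2) by (auto simp: Z_def)
  have hb: "M (Od 0) (Od 0) * h = 1" using h(2) gparity_even_commute[OF h(3)] by simp
  have ne: "0 \<noteq> k" "k \<noteq> 0" if "k \<in> J" for k using that J(2) by metis+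
  have "gmat_inverse ?I (\<lambda>k l. M (Od k) (Od l)) Z"
    using Y J h(2) hb unfolding gmat_inverse_def
    by (auto simp: Z o0 c0 ne cong: sum.cong)
  then have X: "?X k l = Z k l" if "k \<in> ?I" "l \<in> ?I" for k l
    using that J by (intro ginv_eq) auto
  define S where "S i j = M (Ev i) (Ev j) - (\<Sum>k\<in>?I. \<Sum>l\<in>?I. M (Ev i) (Od k) * ?X k l * M (Od l) (Ev j))" for i j
  have S0: "S 0 j = 0" if "j \<in> J" for j
    using that J by (simp add: S_def X Z e0 o0 cong: sum.cong)
  have S00: "S 0 0 = h"
    using J by (simp add: S_def X Z e0 o0 h cong: sum.cong)
  have SJ: "S i j = M (Ev i) (Ev j) - (\<Sum>k\<in>J. \<Sum>l\<in>J. M (Ev i) (Od k) * ?Y k l * M (Od l) (Ev j))"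
    if "i \<in> J" "j \<in> J" for i j
    using that J by (simp add: S_def X Z o0 c0 cong: sum.cong)
  have "Berezinian ?I M = gdet ?I S * gdet ?I ?X"
    by (simp only: Berezinian_def Let_def S_def[abs_def])
  also have "gdet ?I S = h * gdet J S"
    using gdet_insert_0[OF J, of S] S0 S00 by simp
  also have "gdet ?I ?X = h * gdet J ?X"
    using gdet_insert_0[OF J, of ?X] by (simp add: X Z)
  also have "gdet J ?X = gdet J ?Y"
    by (rule gdet_cong[OF J(1)]) (simp add: X Z)
  also have "h * gdet J S * (h * gdet J ?Y) = h * h * (gdet J S * gdet J ?Y)"
    using gparity_even_commute[OF h(3), of "gdet J S"] by (metis mult.assoc)
  also have "gdet J S * gdet J ?Y = Berezinian J M"
    unfolding Berezinian_def Let_def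
    by (rule arg_cong2[of _ _ _ _ "(*)"], rule gdet_cong[OF J(1)]) (simp_all add: SJ)
  finally show ?thesis .
qed

section \<open>Square roots with prescribed number part\<close>

lemma gsupp_cancel_left:
  assumes r: "body r \<noteq> 0" "gsupp G r" and rB: "gsupp G (r * B)" shows "gsupp G B"
proof -
  \<comment> \<open>Induction on \<open>S\<close>: since \<open>r\<close> lives in \<open>G\<close>,
    only \<open>T \<subseteq> G\<close> contribute, and then \<open>S - T\<close> sticks out of
    \<open>G\<close> as \<open>S\<close> does.\<close>
  have "gcoeff B S = 0" if "finite S" "\<not> S \<subseteq> G" for S
    using that
  proof (induction S rule: finite_psubset_induct)
    case (psubset S)
    have "0 = gcoeff (r * B) S" using rB psubset.prems by (auto simp: gsupp_def)
    also have "\<dots> = (\<Sum>T\<in>Pow S. if T = {} then body r * gcoeff B S else 0)"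
      unfolding gcoeff_times
    proof (rule sum.cong[OF refl])
      fix T assume T: "T \<in> Pow S"
      show "gsign T (S - T) * gcoeff r T * gcoeff B (S - T) = (if T = {} then body r * gcoeff B S else 0)"
      proof (cases "T = {} \<or> gcoeff r T = 0")
        case False
        then have "T \<subseteq> G" using r by (auto simp: gsupp_def)
        then have "S - T \<subset> S" "\<not> S - T \<subseteq> G" using False T psubset.prems by auto
        then show ?thesis using psubset.IH False by simp
      qed (auto simp: body_def)
    qed
    also have "\<dots> = body r * gcoeff B S" using psubset.hyps by simp
    finally show ?case using r by simp
  qed
  then show ?thesis unfolding gsupp_def using gcoeff_infinite by blast
qed

lemma gapply_commute:
  assumes "B * x = x * B" shows "gapply F B * x = x * gapply F B"
proof -
  have "soul B * x = x * soul B"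
    by (simp add: soul_def left_diff_distrib right_diff_distrib assms of_real_def)
  then have "soul B ^ k * x = x * soul B ^ k" for k by (rule power_commuting_commutes)
  then show ?thesis unfolding gapply_def by (simp add: sum_distrib_left sum_distrib_right)
qed

text \<open>In the application \<open>r\<close> is \<rho> at the point, \<open>B\<close> the
  Berezinian of the parametrization, \<open>S\<close> the evaluated square root of \<rho>, and
  \<open>E\<close> and \<open>D\<close> are the evaluated odd derivatives of log \<rho> and of 2
  sqrt \<rho>. With q = \<open>gapply sqrt B\<close> one has S^2 = s r and q^2 = s B, so b and S q
  are both square roots of r B, with the same number part.\<close>

lemma square_root_identity:
  fixes r B b S E D :: grassmann
  assumes bb: "b * b = r * B" and b: "\<And>x. b * x = x * b" "body b > 0"
    and SS: "S * S = s *\<^sub>R r" and s: "\<bar>s\<bar> = 1" "s * body r > 0" and S: "body S = sqrt (body r)"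
    and SE: "S * E = D" and rE: "r * E = E * r"
    and G: "finite G" "gsupp G r" "gsupp G b"
  shows "b * E = D * gapply sqrt B"
proof -
  have r0: "body r \<noteq> 0" using s by auto
  define q where "q = gapply sqrt B"
  have "gsupp G B"
    by (rule gsupp_cancel_left[OF r0 G(2)]) (simp add: gsupp_times G(3) flip: bb)
  then have nB: "gnilpotent B" using G(1) by (rule gnilpotentI)
  have bodies: "body r * body B = body b * body b" using arg_cong[OF bb, of body] by simp
  have sB: "s * body B > 0"
  proof -
    have "(s * body r) * (s * body B) = body b * body b"
      using s(1) bodies by (simp add: mult.commute mult.left_commute abs_if split: if_splits)
    then show ?thesis using s(2) b(2) by (metis mult_pos_pos zero_less_mult_pos)
  qed
  have qq: "q * q = s *\<^sub>R B" unfolding q_def by (rule gapply_sqrt_square[OF nB sB s(1)])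
  \<comment> \<open>\<open>b\<close> is central, so \<open>B = r\<^sup>-\<^sup>1 b\<^sup>2\<close> commutes with whatever \<open>r\<close> commutes with.\<close>
  have commute: "B * x = x * B" if "r * x = x * r" for x
  proof -
    have "r * (B * x) = b * b * x" by (simp add: bb mult.assoc)
    also have "\<dots> = x * (b * b)" using b(1) by (metis mult.assoc)
    also have "\<dots> = r * (x * B)" using that by (metis bb mult.assoc)
    finally have "r * (B * x - x * B) = 0" by (simp add: right_diff_distrib)
    then have "B * x - x * B = 0" by (rule grassmann_mult_cancel_left[OF r0])
    then show ?thesis by simp
  qed
  \<comment> \<open>Associativity shows that \<open>S\<close> commutes with its own square.\<close>
  have "S * (s *\<^sub>R r) = (s *\<^sub>R r) * S" unfolding SS[symmetric] by (rule mult.assoc[symmetric])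
  then have "r * S = S * r" using s by auto
  then have qS: "q * S = S * q" unfolding q_def by (intro gapply_commute commute)
  have qE: "q * E = E * q" unfolding q_def by (intro gapply_commute commute rE)
  have "S * q * (S * q) = (S * S) * (q * q)" using qS by (metis mult.assoc)
  also have "\<dots> = (s * s) *\<^sub>R (r * B)" by (simp add: SS qq)
  also have "s * s = 1" using s(1) by (auto simp: abs_if split: if_splits)
  finally have sq: "S * q * (S * q) = b * b" by (simp add: bb)
  \<comment> \<open>The difference of squares factors because \<open>b\<close> is central; the first
    factor has number part 2 \<open>body b\<close> > 0 and can be cancelled.\<close>
  have "(b + S * q) * (b - S * q) = 0"
    using sq b(1)[of "S * q"] by (simp add: distrib_right right_diff_distrib)
  moreover have "body (b + S * q) \<noteq> 0"
  proof -
    have "body (S * q) = sqrt (body b * body b)"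
      by (simp add: S q_def body_gapply[OF nB] bodies flip: real_sqrt_mult)
    then show ?thesis using b(2) by simp
  qed
  ultimately have "b - S * q = 0" by (metis grassmann_mult_cancel_left)
  then have "b * E = S * (q * E)" by (simp add: mult.assoc)
  also have "\<dots> = D * q" by (simp add: qE SE flip: mult.assoc)
  finally show ?thesis by (simp add: q_def)
qed

context superdomain
begin

lemma pd_eq_0:
  assumes "\<alpha> \<in> sindices I" "x \<in> U" "\<And>x. x \<in> U \<Longrightarrow> f x = 0" shows "pd \<alpha> f x = 0"
  using assms by (cases \<alpha>) (simp_all add: pd_Ev_const_on del: pd.simps(1))

lemma gparity_pd:
  assumes \<alpha>: "\<alpha> \<in> sindices I" and x: "x \<in> U" and f: "\<And>x. x \<in> U \<Longrightarrow> gparity p (f x)"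
  shows "gparity (p + par \<alpha>) (pd \<alpha> f x)"
proof (cases \<alpha>)
  case (Ev i)
  have "gcoeff (pd (Ev i) f x) S = 0" if "\<not> even (card S + p)" for S
  proof (rule gcoeff_pd_Ev_zero[OF x])
    show "i \<in> I" using \<alpha> Ev by simp
    show "gcoeff (f x) S = 0" if "x \<in> U" for x
      using f[OF that] \<open>\<not> even (card S + p)\<close> unfolding gparity_def by blast
  qed
  then show ?thesis unfolding gparity_def Ev by auto
next
  case (Od i)
  then show ?thesis using gparity_gderiv[OF f[OF x], of i] by simp
qed

lemma gsupp_pd:
  assumes "\<alpha> \<in> sindices I" "x \<in> U" "smooth_sfun I G U f" shows "gsupp G (pd \<alpha> f x)"
proof (cases \<alpha>)
  case (Ev i)
  then show ?thesis using assms smooth_supp[OF smooth_pd_Ev] by simp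
next
  case (Od i)
  then show ?thesis using assms by (simp add: gsupp_gderiv smooth_supp)
qed

end

text \<open>The identities for \<rho> are established on all of \<open>U\<close> before evaluation,
  because \<open>eval_at\<close> involves derivatives in the even coordinates. For the same reason
  the sign \<open>s\<close> has to be constant on \<open>U\<close>.\<close>

lemma (in superpoint) semidensity_coefficient_identity:
  assumes \<rho>: "smooth_sfun I G U \<rho>" "\<And>x. x \<in> U \<Longrightarrow> gparity 0 (\<rho> x)"
    and s: "\<bar>s\<bar> = 1" "\<And>x. x \<in> U \<Longrightarrow> s * body (\<rho> x) > 0"
    and bb: "b * b = eval_at I \<rho> z * B"
    and b: "\<And>x. b * x = x * b" "body b > 0" "gsupp G' b"
  shows "b * eval_at I (pd (Od j) (log_sfun \<rho>)) z
    = eval_at I (\<lambda>x. 2 * pd (Od j) (sqrt_sfun \<rho>) x) z * gapply sqrt B"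
proof (rule square_root_identity[OF bb b(1,2) _ s(1) _ _ _ _ fin_G' gsupp_eval_at[OF \<rho>(1)] b(3)])
  have r0: "body (\<rho> x) \<noteq> 0" if "x \<in> U" for x using s(2)[OF that] by auto
  note nil = smooth_nilpotent[OF \<rho>(1)]
  have sm: "smooth_sfun I G U (\<lambda>x. gapply F (\<rho> x))" if "iter_diff (- {0}) F" for F
    by (rule smooth_gapply[OF \<rho>(1) that]) (simp add: r0)
  note sm_sqrt = sm[OF iter_diff_sqrt]
  have pd_gapply: "pd (Od j) (\<lambda>x. gapply F (\<rho> x)) x = gapply (deriv F) (\<rho> x) * gderiv j (\<rho> x)" if "x \<in> U" for F x
    using gderiv_gapply[OF nil[OF that] \<rho>(2)[OF that]] by simp
  have sm_log: "smooth_sfun I G U (pd (Od j) (log_sfun \<rho>))"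
    unfolding log_sfun_def[abs_def] pd.simps by (intro smooth_gderiv sm iter_diff_ln)
  let ?S = "eval_at I (\<lambda>x. gapply sqrt (\<rho> x)) z"
  show "?S * ?S = s *\<^sub>R eval_at I \<rho> z"
    unfolding eval_at_times[OF sm_sqrt sm_sqrt, symmetric] eval_at_scaleR[OF \<rho>(1), symmetric]
    by (rule eval_at_cong) (rule gapply_sqrt_square[OF nil s(2) s(1)])
  show "s * body (eval_at I \<rho> z) > 0"
    by (simp add: body_eval_at[OF \<rho>(1)] s(2) body_in)
  show "body ?S = sqrt (body (eval_at I \<rho> z))"
    by (simp add: body_eval_at[OF \<rho>(1)] body_eval_at[OF sm_sqrt] body_gapply[OF nil[OF body_in]])
  show "?S * eval_at I (pd (Od j) (log_sfun \<rho>)) z = eval_at I (\<lambda>x. 2 * pd (Od j) (sqrt_sfun \<rho>) x) z"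
    unfolding eval_at_times[OF sm_sqrt sm_log, symmetric]
  proof (rule eval_at_cong)
    fix x assume x: "x \<in> U"
    have "gapply sqrt (\<rho> x) * pd (Od j) (log_sfun \<rho>) x
        = gapply sqrt (\<rho> x) * gapply (deriv ln) (\<rho> x) * gderiv j (\<rho> x)"
      unfolding log_sfun_def[abs_def] pd_gapply[OF x] by (rule mult.assoc[symmetric])
    also have "\<dots> = 2 * (gapply (deriv sqrt) (\<rho> x) * gderiv j (\<rho> x))"
      by (simp add: gapply_sqrt_deriv_ln[OF nil[OF x] r0[OF x]] scaleR_conv_of_real mult.assoc)
    finally show "gapply sqrt (\<rho> x) * pd (Od j) (log_sfun \<rho>) x = 2 * pd (Od j) (sqrt_sfun \<rho>) x"
      unfolding sqrt_sfun_def[abs_def] pd_gapply[OF x] .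
  qed
  show "eval_at I \<rho> z * eval_at I (pd (Od j) (log_sfun \<rho>)) z
      = eval_at I (pd (Od j) (log_sfun \<rho>)) z * eval_at I \<rho> z"
    unfolding eval_at_times[OF \<rho>(1) sm_log, symmetric] eval_at_times[OF sm_log \<rho>(1), symmetric]
    by (rule eval_at_cong) (rule gparity_even_commute[OF \<rho>(2)])
qed

text \<open>\<open>U\<close> may be disconnected, with \<rho> of different signs on its components.
  Passing to the open part where the sign is that at \<open>x0\<close> is harmless, as
  \<open>eval_at\<close> sees only a neighbourhood of the number part of the point.\<close>

lemma volume_form_constant_sign:
  assumes U: "domain_in I U" and \<rho>: "superfunction I G U p \<rho>" and x0: "x0 \<in> U" "body (\<rho> x0) \<noteq> 0"
  obtains s U' where "\<bar>s\<bar> = 1" "domain_in I U'" "U' \<subseteq> U" "x0 \<in> U'" "\<And>x. x \<in> U' \<Longrightarrow> s * body (\<rho> x) > 0"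
proof -
  define s where "s = sgn (body (\<rho> x0))"
  define U' where "U' = U \<inter> (\<lambda>x. s * body (\<rho> x)) -` {0<..}"
  have "Ck_on 0 I U (\<lambda>x. gcoeff (\<rho> x) {})" using \<rho> unfolding superfunction_def by blast
  then have "continuous_on U (\<lambda>x. s * body (\<rho> x))"
    unfolding body_def by (intro continuous_intros) simp
  then have "openin (top_of_set U) U'"
    unfolding U'_def by (rule continuous_openin_preimage_gen) simp
  then have "domain_in I U'" using U unfolding domain_in_def by (rule openin_trans)
  then show ?thesis
  proof (rule that[rotated])
    show "\<bar>s\<bar> = 1" using x0 by (simp add: s_def abs_sgn_eq)
    show "x0 \<in> U'" using x0 by (simp add: U'_def s_def sgn_mult_self_eq mult.commute[of "sgn _"] flip: abs_sgn)
  qed (auto simp: U'_def)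
qed

text \<open>The conditions on the pair leave the sign of \<Psi> open; the positive number part of
  its \<theta>_0-component settles it. The parametrization itself serves as \<open>w\<close> in
  \<open>semidensity_in_parameters\<close>: in adjusted coordinates its components of index at least
  1 are the coordinates (x^i, \<theta>_i) on the surface.\<close>

theorem mainTheorem4:
  fixes n N :: nat
    and U V :: "(nat \<Rightarrow> real) set"
    and \<Omega> :: sform and \<rho> :: sfun
    and z H \<Psi> :: "sidx \<Rightarrow> sfun"
  assumes "n \<ge> 1"
    and "domain_in {..<n} U"
    and "odd_symplectic n N U \<Omega>"
    and "volume_form n N U \<rho>"
    and "embedded_surface n N U V z"
    and "nondegenerate_surface n V \<Omega> z"
    and "darboux_coordinates n U \<Omega>"
    and "adjusted n U V z"
    and "normal_pair n N V \<Omega> \<rho> z H \<Psi>"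
    and "\<forall>\<xi>\<in>V. body (\<Psi> (Od 0) \<xi>) > 0"
  shows "\<forall>\<xi>\<in>V. semidensity_A n \<Omega> \<rho> z \<Psi> \<xi> =
    semidensity_in_parameters n (restrict0 (\<lambda>x. 2 * pd (Od 0) (sqrt_sfun \<rho>) x)) z \<xi>"
proof
  fix \<xi> assume \<xi>: "\<xi> \<in> V"
  define I J where "I = {..<n}" and "J = {1..<n}"
  define G' where "G' = {1..<n + N}"
  have I: "I = insert 0 J" "0 \<notin> J" "finite I" "finite J" using \<open>n \<ge> 1\<close> by (auto simp: I_def J_def)
  have JI: "i \<in> I" if "i \<in> J" for i using that I by simp
  have sub: "A \<in> sindices I" if "A \<in> sindices J" for A using that JI by (cases A) auto
  have zero_in: "Ev 0 \<in> sindices I" "Od 0 \<in> sindices I" using I by simp_all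

  have V: "domain_in J V" and z: "\<And>A. A \<in> sindices I \<Longrightarrow> superfunction J G' V (par A) (z A)"
    and zU: "body_map n z ` V \<subseteq> U"
    using assms(5) unfolding embedded_surface_def I_def J_def G'_def by auto
  obtain L where L: "\<And>\<alpha> \<beta>. \<alpha> \<in> sindices J \<Longrightarrow> \<beta> \<in> sindices J \<Longrightarrow>
      (\<Sum>A\<in>sindices I. pd \<alpha> (z A) \<xi> * L A \<beta>) = of_bool (\<alpha> = \<beta>)"
    using assms(5) \<xi> unfolding embedded_surface_def I_def J_def by meson
  have z0: "z (Ev 0) \<zeta> = 0" "z (Od 0) \<zeta> = 0" if "\<zeta> \<in> V" for \<zeta>
    using assms(8) that unfolding adjusted_def by auto
  interpret V: superdomain J G' V by standard (use V I in \<open>auto simp: G'_def\<close>)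
  define W where "W \<alpha> A = pd \<alpha> (z A) \<xi>" for \<alpha> A
  have W0: "W \<alpha> (Ev 0) = 0" "W \<alpha> (Od 0) = 0" if "\<alpha> \<in> sindices J" for \<alpha>
    unfolding W_def using that \<xi> z0 by (auto intro: V.pd_eq_0)
  have W_par: "gparity (par A + par \<alpha>) (W \<alpha> A)" if "\<alpha> \<in> sindices J" "A \<in> sindices J" for \<alpha> A
    unfolding W_def using that \<xi> superfunction_gparity[OF z[OF sub]] by (intro V.gparity_pd) auto
  have W_supp: "gsupp G' (W \<alpha> A)" if "\<alpha> \<in> sindices J" "A \<in> sindices J" for \<alpha> A
    unfolding W_def using that \<xi> superfunction_imp_smooth[OF z[OF sub]] by (intro V.gsupp_pd) auto
  \<comment> \<open>The columns of x^0 and \<theta>_0 vanish, so a right inverse of the rectangular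
    matrix restricts to a right inverse of the square matrix \<open>W\<close>.\<close>
  have WL: "(\<Sum>A\<in>sindices J. W \<alpha> A * L A \<beta>) = of_bool (\<alpha> = \<beta>)" if "\<alpha> \<in> sindices J" "\<beta> \<in> sindices J" for \<alpha> \<beta>
    using L[OF that] W0[OF that(1)] I
    by (simp add: sum_sindices flip: W_def)

  let ?z = "\<lambda>A. z A \<xi>"
  let ?x = "body_point I ?z"
  have x: "?x \<in> U" using zU \<xi> unfolding I_def by blast
  have \<rho>: "superfunction I {..<n + N} U 0 \<rho>" "body (\<rho> ?x) \<noteq> 0"
    using assms(4) x unfolding volume_form_def I_def by auto
  obtain s U' where s: "\<bar>s\<bar> = 1" "\<And>x. x \<in> U' \<Longrightarrow> s * body (\<rho> x) > 0"
    and U': "domain_in I U'" "U' \<subseteq> U" "?x \<in> U'"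
    by (rule volume_form_constant_sign[OF _ \<rho>(1) x \<rho>(2)]) (use assms(2) I_def in auto)
  interpret P: superpoint I "{..<n + N}" U' ?z G'
  proof
    fix i assume i: "i \<in> I"
    show "gparity 0 (z (Ev i) \<xi>)" "gparity 1 (z (Od i) \<xi>)"
      using superfunction_gparity[OF z \<xi>, of "Ev i"] superfunction_gparity[OF z \<xi>, of "Od i"] i by auto
    show "gsupp G' (z (Ev i) \<xi>) \<and> gsupp G' (z (Od i) \<xi>)"
      using superfunction_gsupp[OF z \<xi>, of "Ev i"] superfunction_gsupp[OF z \<xi>, of "Od i"] i by auto
  qed (use U' I in \<open>auto simp: G'_def I_def\<close>)

  have \<Omega>: "form_along n \<Omega> z A B \<xi> = of_real c" if "\<And>x. x \<in> U \<Longrightarrow> \<Omega> A B x = of_real c" for A B c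
    unfolding form_along_def using P.eval_at_const[of "\<Omega> A B" c] that U'(2) by (auto simp: I_def)
  have D: "\<Omega> (Ev i) (Ev j) x = of_real 0" "\<Omega> (Od i) (Od j) x = of_real 0"
    "\<Omega> (Ev i) (Od j) x = of_real (of_bool (i = j))" "\<Omega> (Od i) (Ev j) x = of_real (- of_bool (i = j))"
    if "i \<in> I" "j \<in> I" "x \<in> U" for i j x
    using assms(7) that unfolding darboux_coordinates_def I_def by auto
  have \<Omega>0: "form_along n \<Omega> z (Ev i) (Ev j) \<xi> = 0" "form_along n \<Omega> z (Od i) (Od j) \<xi> = 0"
    "form_along n \<Omega> z (Ev i) (Od j) \<xi> = of_bool (i = j)"
    "form_along n \<Omega> z (Od i) (Ev j) \<xi> = - of_bool (i = j)" if "i \<in> I" "j \<in> I" for i j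
    using \<Omega>[OF D(1)[OF that]] \<Omega>[OF D(2)[OF that]] \<Omega>[OF D(3)[OF that]] \<Omega>[OF D(4)[OF that]]
    by auto
  have fv: "form_value I (\<lambda>A B. form_along n \<Omega> z A B \<xi>) q X Y
      = (\<Sum>i\<in>I. X (Ev i) * Y (Od i) - (-1) ^ q * (X (Od i) * Y (Ev i)))" for q X Y
    by (rule form_value_darboux[OF I(3)]) (simp_all only: \<Omega>0)

  let ?h = "\<lambda>A. H A \<xi>" and ?\<psi> = "\<lambda>A. \<Psi> A \<xi>"
  have par_H: "gparity (par A + 0) (?h A)" and par_\<Psi>: "gparity (par A + 1) (?\<psi> A)"
    and supp_\<Psi>: "gsupp G' (?\<psi> A)" if "A \<in> sindices I" for A
    using assms(9) that superfunction_gparity[OF _ \<xi>] superfunction_gsupp[OF _ \<xi>]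
    unfolding normal_pair_def I_def G'_def by fastforce+
  have orth: "form_value I (\<lambda>A B. form_along n \<Omega> z A B \<xi>) (par \<alpha>) ?h (W \<alpha>) = 0"
    "form_value I (\<lambda>A B. form_along n \<Omega> z A B \<xi>) (par \<alpha>) ?\<psi> (W \<alpha>) = 0" if "\<alpha> \<in> sindices J" for \<alpha>
    using assms(9) that \<xi> unfolding normal_pair_def I_def J_def W_def Let_def by auto
  have pair: "form_value I (\<lambda>A B. form_along n \<Omega> z A B \<xi>) 1 ?h ?\<psi> = 1"
    "form_value I (\<lambda>A B. form_along n \<Omega> z A B \<xi>) 1 ?\<psi> ?\<psi> = 0"
    and vol: "eval_at I \<rho> ?z * Berezinian I (frame z H \<Psi> \<xi>) = 1"
    using assms(9) \<xi> unfolding normal_pair_def I_def Let_def by auto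

  \<comment> \<open>Stated with a parity parameter \<open>p\<close>, to cover H
    (\<open>p = 0\<close>) and \<Psi> (\<open>p = 1\<close>) at once.\<close>
  have normal: "X A = 0"
    if "\<And>A. A \<in> sindices I \<Longrightarrow> gparity (par A + p) (X A)"
      "\<And>\<alpha>. \<alpha> \<in> sindices J \<Longrightarrow> form_value I (\<lambda>A B. form_along n \<Omega> z A B \<xi>) (par \<alpha>) X (W \<alpha>) = 0"
      "A \<in> sindices J" for X p A
  proof (rule orthogonal_to_frame_eq_0[OF I(4) WL W_par, where p = p])
    show "(\<Sum>i\<in>J. X (Ev i) * W \<alpha> (Od i) - (-1) ^ par \<alpha> * (X (Od i) * W \<alpha> (Ev i))) = 0"
      if "\<alpha> \<in> sindices J" for \<alpha>
      using \<open>\<alpha> \<in> sindices J \<Longrightarrow> form_value I _ (par \<alpha>) X (W \<alpha>) = 0\<close>[OF that] W0[OF that] I(2,4)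
      unfolding fv unfolding I(1) by simp
  qed (use that sub in auto)
  have H0: "?h A = 0" if "A \<in> sindices J" for A by (rule normal[OF par_H orth(1) that])
  have \<Psi>0: "?\<psi> A = 0" if "A \<in> sindices J" for A by (rule normal[OF par_\<Psi> orth(2) that])

  define h b where "h = ?h (Ev 0)" and "b = ?\<psi> (Od 0)"
  have h_even: "gparity 0 h" using par_H[OF zero_in(1)] by (simp add: h_def)
  have b_even: "gparity 0 b" using gparity_any[OF _ par_\<Psi>[OF zero_in(2)]] by (simp add: b_def)
  have body_b: "body b > 0" using assms(10) \<xi> by (simp add: b_def)
  have \<Psi>00: "?\<psi> (Ev 0) = 0"
  proof -
    \<comment> \<open>For q = 1 the two mixed terms of \<open>fv\<close> carry the same sign, so
      \<Omega>(\<Psi>, \<Psi>) = 0 says that twice \<open>b\<close> times the x^0-component of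
      \<Psi> is 0, with \<open>b\<close> even and cancellable.\<close>
    have "?\<psi> (Ev 0) * b + b * ?\<psi> (Ev 0) = 0"
      using pair(2) \<Psi>0 I(2,4) unfolding fv unfolding I(1) by (simp add: b_def)
    then have "b * (?\<psi> (Ev 0) + ?\<psi> (Ev 0)) = 0"
      by (simp add: distrib_left gparity_even_commute[OF b_even, of "?\<psi> (Ev 0)"])
    then have "2 *\<^sub>R ?\<psi> (Ev 0) = 0"
      using grassmann_mult_cancel_left[of b] body_b by (simp add: scaleR_2)
    then show ?thesis by simp
  qed
  have hb: "h * b = 1"
    using pair(1) \<Psi>0 \<Psi>00 I(2,4) unfolding fv unfolding I(1) by (simp add: h_def b_def)

  define B where "B = Berezinian J W"
  have inv: "ginvertible J (\<lambda>k l. frame z H \<Psi> \<xi> (Od k) (Od l))"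
  proof (rule ginvertible_if_body_invertible[where G = G' and Y = "\<lambda>k l. body (L (Od k) (Od l))"])
    have fr: "frame z H \<Psi> \<xi> (Od k) (Od l) = W (Od k) (Od l)" if "k \<in> J" for k l
      using that I(2) by (auto simp: frame_def W_def)
    show "gsupp G' (frame z H \<Psi> \<xi> (Od k) (Od l))" if "k \<in> J" "l \<in> J" for k l
      using that by (simp add: fr W_supp)
    show "(\<Sum>l\<in>J. body (frame z H \<Psi> \<xi> (Od k) (Od l)) * body (L (Od l) (Od m))) = of_bool (k = m)"
      if k: "k \<in> J" and m: "m \<in> J" for k m
    proof -
      \<comment> \<open>Mixed entries are odd and have number part 0, so the number part of W L = 1
        decouples and leaves an inverse of the odd-odd block.\<close>
      have "body (W (Od k) (Ev l)) = 0" if "l \<in> J" for l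
        using body_gparity_odd[OF W_par, of "Od k" "Ev l"] k that by simp
      then show ?thesis
        using arg_cong[OF WL[of "Od k" "Od m"], of body] k m by (simp add: fr sum_sindices I)
    qed
  qed (simp_all add: I G'_def)
  have "Berezinian I (frame z H \<Psi> \<xi>) = h * h * Berezinian J (frame z H \<Psi> \<xi>)"
    unfolding I(1)
  proof (rule Berezinian_split_0[OF I(4,2) _ _ _ _ _ _ h_even inv])
    show "frame z H \<Psi> \<xi> (Ev 0) (Ev i) = 0 \<and> frame z H \<Psi> \<xi> (Ev 0) (Od i) = 0" if "i \<in> J" for i
      using that by (simp add: frame_def H0)
    show "frame z H \<Psi> \<xi> (Od 0) (Ev i) = 0 \<and> frame z H \<Psi> \<xi> (Od 0) (Od i) = 0" if "i \<in> J" for i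
      using that by (simp add: frame_def \<Psi>0)
    show "frame z H \<Psi> \<xi> \<alpha> (Ev 0) = 0 \<and> frame z H \<Psi> \<xi> \<alpha> (Od 0) = 0" if "\<alpha> \<in> sindices J" for \<alpha>
      using that I(2) W0[OF that] by (auto simp: frame_def W_def)
  qed (use hb in \<open>simp_all add: frame_def \<Psi>00 h_def b_def\<close>)
  also have "Berezinian J (frame z H \<Psi> \<xi>) = B"
    unfolding B_def by (rule Berezinian_cong[OF I(4)]) (use I(2) in \<open>auto simp: frame_def W_def\<close>)
  finally have rB: "eval_at I \<rho> ?z * (h * h * B) = 1" using vol by simp
  have bb: "b * b = eval_at I \<rho> ?z * B"
  proof -
    note bc = gparity_even_commute[OF b_even]
    \<comment> \<open>The volume condition \<rho> h^2 Ber W = 1 is multiplied by b^2; the central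
      \<open>b\<close> is moved next to \<open>h\<close> so that h b = 1 applies twice.\<close>
    have "b * b = b * b * (eval_at I \<rho> ?z * (h * h * B))" by (simp add: rB)
    also have "\<dots> = eval_at I \<rho> ?z * ((h * (h * b) * b) * B)" using bc by (metis mult.assoc)
    finally show ?thesis by (simp add: hb)
  qed

  have first: "(\<Sum>A\<in>sindices I. \<Psi> A \<xi> * F A) = b * F (Od 0)" for F
    using I \<Psi>0 \<Psi>00 by (simp add: sum_sindices b_def)
  have dd: "pd \<alpha> (pd \<beta> (z (Ev 0))) \<xi> = 0" if "\<alpha> \<in> sindices J" "\<beta> \<in> sindices J" for \<alpha> \<beta>
    using that \<xi> z0 by (intro V.pd_eq_0) auto
  have \<Psi>\<Omega>: "\<Psi> A \<xi> * form_along n \<Omega> z A B \<xi> = 0"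
    if "A \<in> sindices I" "B \<in> sindices I" "B \<noteq> Ev 0" for A B
  proof (cases "A = Od 0")
    case True
    then show ?thesis using that \<Omega>0 I(1) by (cases B) auto
  next
    case False
    then show ?thesis using that \<Psi>0[of A] \<Psi>00 I(1) by (cases A) auto
  qed
  have second: "c * \<Psi> A \<xi> * form_along n \<Omega> z A B \<xi> * pd \<alpha> (pd \<beta> (z B)) \<xi> * Y = 0"
    if "A \<in> sindices I" "B \<in> sindices I" "\<alpha> \<in> sindices J" "\<beta> \<in> sindices J" for A B \<alpha> \<beta> c Y
  proof (cases "B = Ev 0")
    case True
    then show ?thesis using dd[OF that(3,4)] by simp
  next
    case False
    have "c * \<Psi> A \<xi> * form_along n \<Omega> z A B \<xi> = c * (\<Psi> A \<xi> * form_along n \<Omega> z A B \<xi>)"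
      by (rule mult.assoc)
    also have "\<dots> = 0" using \<Psi>\<Omega>[OF that(1,2) False] by simp
    finally show ?thesis by simp
  qed
  have "semidensity_A n \<Omega> \<rho> z \<Psi> \<xi> = b * eval_at I (pd (Od 0) (log_sfun \<rho>)) ?z"
    unfolding semidensity_A_def I_def[symmetric] J_def[symmetric] first
    by (simp add: second)
  also have "\<dots> = eval_at I (\<lambda>x. 2 * pd (Od 0) (sqrt_sfun \<rho>) x) ?z * gapply sqrt B"
  proof (rule P.semidensity_coefficient_identity[OF _ _ s bb])
    show "smooth_sfun I {..<n + N} U' \<rho>"
      using superfunction_imp_smooth[OF \<rho>(1)] U'(2) by (rule smooth_sfun_subset)
    show "gparity 0 (\<rho> x)" if "x \<in> U'" for x
      using superfunction_gparity[OF \<rho>(1)] that U'(2) by blast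
    show "b * y = y * b" for y by (rule gparity_even_commute[OF b_even])
    show "gsupp G' b" using supp_\<Psi>[OF zero_in(2)] by (simp add: b_def)
  qed (use body_b in auto)
  also have "\<dots> = semidensity_in_parameters n (restrict0 (\<lambda>x. 2 * pd (Od 0) (sqrt_sfun \<rho>) x)) z \<xi>"
  proof -
    have sm: "smooth_sfun I {..<n + N} U' (\<lambda>x. 2 * pd (Od 0) (sqrt_sfun \<rho>) x)"
    proof (rule P.smooth_times)
      show "smooth_sfun I {..<n + N} U' (\<lambda>x. 2)"
        using P.smooth_const[OF gsupp_of_real[of _ 2]] by simp
      show "smooth_sfun I {..<n + N} U' (pd (Od 0) (sqrt_sfun \<rho>))"
        unfolding sqrt_sfun_def[abs_def] pd.simps
        using superfunction_imp_smooth[OF \<rho>(1)] U'(2) s(2)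
        by (intro P.smooth_gderiv P.smooth_gapply[OF _ iter_diff_sqrt]) (force intro: smooth_sfun_subset)+
    qed
    show ?thesis
      using P.eval_at_restrict0[OF I(1,2) z0[OF \<xi>] sm]
      by (simp add: semidensity_in_parameters_def B_def W_def[abs_def] J_def)
  qed
  finally show "semidensity_A n \<Omega> \<rho> z \<Psi> \<xi> =
    semidensity_in_parameters n (restrict0 (\<lambda>x. 2 * pd (Od 0) (sqrt_sfun \<rho>) x)) z \<xi>" .
qed

end
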